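(* Let $d,n\geqslant 1$ be integers, $N=d+n$, and let $v_0(s,\overline x,\overline y)$ belong to the Schwartz class $\mathcal{S}(\mathbb{R}^{N+1})$, where $(s,\overline x,\overline y)\in\mathbb{R}\times\mathbb{R}^d\times\mathbb{R}^n$. Put $$\tilde v_0(\lambda,\overline\xi,\overline\eta)=2\int_{\mathbb{R}^{N+1}}e^{-i(s\lambda+\overline x\,\overline\xi-\overline y\,\overline\eta)}\,v_0(s,\overline x,\overline y)\,ds\,d\overline x\,d\overline y .$$ For $\zeta=(\zeta_0,\overline\zeta)\in S^d\subset\mathbb{R}\times\mathbb{R}^d$, $\sigma=(\sigma_0,\overline\sigma)\in S^n\subset\mathbb{R}\times\mathbb{R}^n$ and $r>0$ put $$a(\zeta,\sigma,r)=2\pi\,r\,|\zeta_0+\sigma_0|\;\tilde v_0\left(r(\zeta_0+\sigma_0),\,r\overline\zeta,\,r\overline\sigma\right).$$ Let $u(x,y)$, $x=(x_0,\overline x)\in\mathbb{R}\times\mathbb{R}^d$, $y=(y_0,\overline y)\in\mathbb{R}\times\mathbb{R}^n$, be the tempered distribution in $\mathbb{R}^{N+2}$ whose Fourier transform $\hat u(\xi,\eta)$ acts on test functions $\Phi(\xi,\eta)$ from $\mathcal{S}(\mathbb{R}^{N+2})$ by $$\langle\hat u,\Phi\rangle=\frac12\int_{S^d\times S^n\times(0,\infty)}r^{N-1}\,a(\zeta,\sigma,r)\,\Phi(r\zeta,r\sigma)\,d\zeta\,d\sigma\,dr .$$ Let $v(t,s,\overline x,\overline y)$ be the distribution in $\mathbb{R}^{N+2}$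 related to $u$ by the linear change of variables $$v(t,s,\overline x,\overline y)=u(x,y),\qquad x=(t+s,\overline x),\quad y=(t-s,\overline y).$$ Then $v$ belongs to the class $C\left(\mathbb{R};L_2(\mathbb{R}^{N+1})\right)$ (continuous functions of $t\in\mathbb{R}$ with values in the space $L_2(\mathbb{R}^{N+1})$ of functions of $(s,\overline x,\overline y)$), satisfies $$\left(\partial_t\partial_s+\partial_{x_1}^2+\ldots+\partial_{x_d}^2-\partial_{y_1}^2-\ldots-\partial_{y_n}^2\right)v=0$$ in the sense of distributions in $\mathbb{R}^{N+2}$, and satisfies $$v(0,\cdot)=v_0 .$$
   Context: Variables: $\overline x=(x_1,\ldots,x_d)\in\mathbb{R}^d$, $\overline y=(y_1,\ldots,y_n)\in\mathbb{R}^n$, $\xi=(\xi_0,\overline\xi)\in\mathbb{R}\times\mathbb{R}^d$, $\eta=(\eta_0,\overline\eta)\in\mathbb{R}\times\mathbb{R}^n$. Products such as $\overline x\,\overline\xi$, $\overline y\,\overline\eta$, $x\xi$, $y\eta$ denote Euclidean inner products. Functions are complex-valued. $d\zeta$ and $d\sigma$ denote the surface measures on the unit spheres $S^d\subset\mathbb{R}^{d+1}$ and $S^n\subset\mathbb{R}^{n+1}$. The bracket $\langle\cdot,\cdot\rangle$ is the bilinear pairing of a distribution and a test function (for a function $f$, $\langle f,\Phi\rangle=\int f\Phi$). Fourier transform convention on $\mathbb{R}^{N+2}=\mathbb{R}^{d+1}\times\mathbb{R}^{n+1}$: $$\hat u(\xi,\eta)=\int_{\mathbb{R}^{N+2}}e^{-i(x\xi-y\eta)}\,u(x,y)\,dx\,dy,$$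 extended to tempered distributions by duality, i.e. $\langle\hat u,\Phi\rangle=\langle u,\check\Phi\rangle$ with $\check\Phi(x,y)=\int_{\mathbb{R}^{N+2}} e^{-i(x\xi-y\eta)}\Phi(\xi,\eta)\,d\xi\,d\eta$. (Note the sign in front of $y\eta$.) The relation $v(t,s,\overline x,\overline y)=u(x,y)$ is understood as the change of variables (pullback) for distributions which agrees with composition for functions. An element of $C\left(\mathbb{R};L_2(\mathbb{R}^{N+1})\right)$ is identified with a Lebesgue measurable function of $(t,s,\overline x,\overline y)$ on $\mathbb{R}^{N+2}$ which, for each $t$, coincides a.e. in $(s,\overline x,\overline y)$ with the value of the element at $t$. It lies in $L_{2,\mathrm{loc}}(\mathbb{R}^{N+2})$ and so is a regular distribution. That the distribution $v$ belongs to this class means that it is the regular distribution given by such an element, and $v(0,\cdot)$ is the value of this element at $t=0$. *)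

theory Defs
  imports "HOL-Analysis.Analysis"
begin

definition pd :: "'a::euclidean_space \<Rightarrow> ('a \<Rightarrow> complex) \<Rightarrow> 'a \<Rightarrow> complex" where
  "pd e f = (\<lambda>x. frechet_derivative f (at x) e)"

text \<open>Every iterated partial derivative exists and is (totally) differentiable, hence continuous.\<close>

definition smooth :: "('a::euclidean_space \<Rightarrow> complex) \<Rightarrow> bool" where
  "smooth f \<longleftrightarrow> (\<forall>es. set es \<subseteq> Basis \<longrightarrow> (\<forall>x. foldr pd es f differentiable (at x)))"

definition schwartz :: "('a::euclidean_space \<Rightarrow> complex) \<Rightarrow> bool" where
  "schwartz f \<longleftrightarrow> smooth f \<and>
     (\<forall>es k. set es \<subseteq> Basis \<longrightarrow> bounded (range (\<lambda>x. norm x ^ k *\<^sub>R foldr pd es f x)))"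

definition test_function :: "('a::euclidean_space \<Rightarrow> complex) \<Rightarrow> bool" where
  "test_function f \<longleftrightarrow> smooth f \<and> compact (closure {x. f x \<noteq> 0})"

text \<open>These norms increase with \<open>m\<close> and generate the topology of the Schwartz space.\<close>

definition schwartz_norm :: "nat \<Rightarrow> ('a::euclidean_space \<Rightarrow> complex) \<Rightarrow> real" where
  "schwartz_norm m f =
     (SUP (es, x) \<in> {es. set es \<subseteq> Basis \<and> length es \<le> m} \<times> UNIV.
        (1 + norm x) ^ m * norm (foldr pd es f x))"

text \<open>
  A distribution is represented by the functional \<open>\<phi> \<mapsto> \<langle>T, \<phi>\<rangle>\<close> (bilinear pairing). Its
  values off the relevant space of test functions are irrelevant.
\<close>

type_synonym 'a functional = "('a \<Rightarrow> complex) \<Rightarrow> complex"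

definition tempered_distribution :: "('a::euclidean_space) functional \<Rightarrow> bool" where
  "tempered_distribution T \<longleftrightarrow>
     (\<forall>f g. schwartz f \<longrightarrow> schwartz g \<longrightarrow> T (\<lambda>x. f x + g x) = T f + T g) \<and>
     (\<forall>c f. schwartz f \<longrightarrow> T (\<lambda>x. c * f x) = c * T f) \<and>
     (\<exists>C m. \<forall>f. schwartz f \<longrightarrow> norm (T f) \<le> C * schwartz_norm m f)"

definition dist_deriv :: "'a::euclidean_space \<Rightarrow> 'a functional \<Rightarrow> 'a functional" where
  "dist_deriv e T = (\<lambda>\<phi>. - T (pd e \<phi>))"

definition regular_distribution_of ::
  "('a::euclidean_space \<Rightarrow> complex) \<Rightarrow> 'a functional \<Rightarrow> bool" where
  "regular_distribution_of w T \<longleftrightarrow>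
     (\<forall>\<phi>. test_function \<phi> \<longrightarrow> T \<phi> = (LINT z|lebesgue. w z * \<phi> z))"

text \<open>
  The second group of variables enters with the opposite sign. The kernel is symmetric in
  \<open>(x, y)\<close> and \<open>(\<xi>, \<eta>)\<close>, so the operator that acts on test functions in the duality formula
  is given by the same expression.
\<close>

definition fourier ::
  "('a::euclidean_space \<times> 'b::euclidean_space \<Rightarrow> complex) \<Rightarrow> 'a \<times> 'b \<Rightarrow> complex" where
  "fourier f = (\<lambda>(\<xi>, \<eta>). LINT (x, y)|lborel. cis (- (x \<bullet> \<xi> - y \<bullet> \<eta>)) * f (x, y))"

definition fourier_dist ::
  "('a::euclidean_space \<times> 'b::euclidean_space) functional \<Rightarrow> ('a \<times> 'b) functional" where
  "fourier_dist T = (\<lambda>\<Phi>. T (fourier \<Phi>))"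

text \<open>
  The surface measure of \<open>A\<close> is the dimension of the ambient space times the volume of the
  cone over \<open>A\<close>, that is, of the set of points of the punctured unit ball whose radial
  projection \<open>sgn x = x /\<^sub>R norm x\<close> lies in \<open>A\<close>.
\<close>

definition sphere_measure :: "'a::euclidean_space measure" where
  "sphere_measure =
     scale_measure (of_nat DIM('a))
       (distr (restrict_space lborel (ball 0 1 - {0})) (restrict_space borel (sphere 0 1)) sgn)"

lemma space_sphere_measure: "space (sphere_measure :: 'a::euclidean_space measure) = sphere 0 1"
  by (simp add: sphere_measure_def space_restrict_space space_scale_measure)

lemma sets_sphere_measure:
  "sets (sphere_measure :: 'a::euclidean_space measure) = sets (restrict_space borel (sphere 0 1))"
  by (simp add: sphere_measure_def)

lemma emeasure_sphere_measure:
  fixes A :: "'a::euclidean_space set"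
  assumes "A \<in> sets borel" "A \<subseteq> sphere 0 1"
  shows "emeasure sphere_measure A =
    of_nat DIM('a) * emeasure lborel {x \<in> ball 0 1 - {0}. sgn x \<in> A}"
proof -
  have c: "continuous_on (ball 0 1 - {0::'a}) sgn"
    unfolding sgn_div_norm[abs_def] by (intro continuous_intros) auto
  have m: "sgn \<in> restrict_space lborel (ball 0 1 - {0::'a}) \<rightarrow>\<^sub>M restrict_space borel (sphere 0 1)"
  proof (rule measurable_restrict_space2)
    show "sgn \<in> space (restrict_space lborel (ball 0 1 - {0::'a})) \<rightarrow> sphere 0 1"
      by (auto simp: space_restrict_space norm_sgn)
    show "sgn \<in> borel_measurable (restrict_space lborel (ball 0 1 - {0::'a}))"
      using borel_measurable_continuous_on_restrict[OF c]
      by (simp cong: measurable_cong_sets add: sets_restrict_space)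
  qed
  have A: "A \<in> sets (restrict_space borel (sphere 0 1))"
    using assms by (subst sets_restrict_space_iff) auto
  show ?thesis
    unfolding sphere_measure_def using A
    apply (simp add: emeasure_distr[OF m A] space_restrict_space)
    apply (subst emeasure_restrict_space)
    apply (auto intro!: arg_cong2[where f = "(*)"] arg_cong2[where f = emeasure])
    done
qed

lemma emeasure_sphere_measure_total:
  "emeasure sphere_measure (sphere 0 1 :: 'a::euclidean_space set) =
     ennreal (real DIM('a) * unit_ball_vol (real DIM('a)))"
proof -
  have "{x \<in> ball 0 1 - {0::'a}. sgn x \<in> sphere 0 1} = ball 0 1 - {0}"
    by (auto simp: norm_sgn)
  moreover have "emeasure lborel (ball 0 1 - {0::'a}) = emeasure lborel (ball (0::'a) 1)"
    by (subst emeasure_Diff_null_set) auto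
  ultimately show ?thesis
    by (subst emeasure_sphere_measure)
       (auto simp: emeasure_ball ennreal_mult ennreal_of_nat_eq_real_of_nat)
qed

definition L2 :: "('a::euclidean_space \<Rightarrow> complex) set" where
  "L2 = {f \<in> borel_measurable lebesgue. integrable lebesgue (\<lambda>z. (norm (f z))\<^sup>2)}"

definition L2_norm :: "('a::euclidean_space \<Rightarrow> complex) \<Rightarrow> real" where
  "L2_norm f = sqrt (LINT z|lebesgue. (norm (f z))\<^sup>2)"

text \<open>
  Continuous functions of \<open>t\<close> with values in \<open>L2\<close>, represented by jointly Lebesgue measurable
  functions \<open>w\<close>: the value at \<open>t\<close> is the class of \<open>\<lambda>z. w (t, z)\<close>.
\<close>

definition C_L2 :: "(real \<times> 'a::euclidean_space \<Rightarrow> complex) set" where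
  "C_L2 = {w \<in> borel_measurable lebesgue.
     (\<forall>t. (\<lambda>z. w (t, z)) \<in> L2) \<and>
     (\<forall>t. ((\<lambda>t'. L2_norm (\<lambda>z. w (t', z) - w (t, z))) \<longlongrightarrow> 0) (at t))}"

text \<open>
  The cardinalities of the index types \<open>'d\<close> and \<open>'n\<close> are the two dimensions.
  In \<open>xy\<close> the zeroth coordinates are kept with their groups, \<open>((x0, x), (y0, y))\<close>;
  in \<open>tsxy\<close> the points are \<open>(t, s, x, y)\<close>, where \<open>x\<close> and \<open>y\<close> are the remaining coordinates.
\<close>

type_synonym ('d, 'n) xy = "(real \<times> (real ^ 'd)) \<times> (real \<times> (real ^ 'n))"
type_synonym ('d, 'n) sxy = "real \<times> (real ^ 'd) \<times> (real ^ 'n)"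
type_synonym ('d, 'n) tsxy = "real \<times> ('d, 'n) sxy"

definition v0_tilde ::
  "(('d::finite, 'n::finite) sxy \<Rightarrow> complex) \<Rightarrow> real \<Rightarrow> (real ^ 'd) \<Rightarrow> (real ^ 'n) \<Rightarrow> complex" where
  "v0_tilde v\<^sub>0 l \<xi> \<eta> =
     2 * (LINT (s, x, y)|lborel. cis (- (s * l + x \<bullet> \<xi> - y \<bullet> \<eta>)) * v\<^sub>0 (s, x, y))"

definition amplitude ::
  "(('d::finite, 'n::finite) sxy \<Rightarrow> complex) \<Rightarrow> real \<times> (real ^ 'd) \<Rightarrow> real \<times> (real ^ 'n) \<Rightarrow> real \<Rightarrow> complex"
  where
  "amplitude v\<^sub>0 \<zeta> \<sigma> r =
     of_real (2 * pi * r * \<bar>fst \<zeta> + fst \<sigma>\<bar>) *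
     v0_tilde v\<^sub>0 (r * (fst \<zeta> + fst \<sigma>)) (r *\<^sub>R snd \<zeta>) (r *\<^sub>R snd \<sigma>)"

definition cone_functional ::
  "(('d::finite, 'n::finite) sxy \<Rightarrow> complex) \<Rightarrow> (('d, 'n) xy) functional" where
  "cone_functional v\<^sub>0 \<Phi> =
     1 / 2 * (LINT (\<zeta>, \<sigma>, r)|(sphere_measure \<Otimes>\<^sub>M sphere_measure \<Otimes>\<^sub>M restrict_space lborel {0<..}).
       of_real (r ^ (CARD('d) + CARD('n) - 1)) * amplitude v\<^sub>0 \<zeta> \<sigma> r * \<Phi> (r *\<^sub>R \<zeta>, r *\<^sub>R \<sigma>))"

fun to_xy :: "('d::finite, 'n::finite) tsxy \<Rightarrow> ('d, 'n) xy" where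
  "to_xy (t, s, x, y) = ((t + s, x), (t - s, y))"

fun of_xy :: "('d::finite, 'n::finite) xy \<Rightarrow> ('d, 'n) tsxy" where
  "of_xy ((x0, x), (y0, y)) = ((x0 + y0) / 2, (x0 - y0) / 2, x, y)"

lemma of_xy_to_xy [simp]: "of_xy (to_xy z) = z"
  by (cases z) (auto simp: field_simps)

lemma to_xy_of_xy [simp]: "to_xy (of_xy z) = z"
  by (cases z rule: of_xy.cases) (auto simp: field_simps)

text \<open>
  Pullback along \<open>to_xy\<close>; the factor \<open>1 / 2\<close> is the reciprocal of its Jacobian. For functions
  it agrees with composition, see \<open>pullback_function\<close> below.
\<close>

definition pullback ::
  "(('d::finite, 'n::finite) xy) functional \<Rightarrow> (('d, 'n) tsxy) functional" where
  "pullback u = (\<lambda>\<phi>. 1 / 2 * u (\<phi> \<circ> of_xy))"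

lemma to_xy_alt:
  "to_xy = (\<lambda>z. ((fst z + fst (snd z), fst (snd (snd z))), (fst z - fst (snd z), snd (snd (snd z)))))"
  by (auto simp: fun_eq_iff)

lemma of_xy_alt:
  "of_xy = (\<lambda>w. ((fst (fst w) + fst (snd w)) / 2, (fst (fst w) - fst (snd w)) / 2, snd (fst w), snd (snd w)))"
  by (auto simp: fun_eq_iff)

lemma to_xy_measurable [measurable]:
  "to_xy \<in> borel_measurable (borel :: ('d::finite, 'n::finite) tsxy measure)"
  unfolding to_xy_alt by (intro borel_measurable_continuous_onI continuous_intros)

lemma of_xy_measurable [measurable]:
  "of_xy \<in> borel_measurable (borel :: ('d::finite, 'n::finite) xy measure)"
  unfolding of_xy_alt by (intro borel_measurable_continuous_onI continuous_intros) auto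

lemma nn_integral_lborel_pair:
  fixes f :: "'a::euclidean_space \<times> 'b::euclidean_space \<Rightarrow> ennreal"
  assumes "f \<in> borel_measurable borel"
  shows "(\<integral>\<^sup>+z. f z \<partial>lborel) = (\<integral>\<^sup>+x. \<integral>\<^sup>+y. f (x, y) \<partial>lborel \<partial>lborel)"
  using lborel.nn_integral_fst[of f "lborel :: 'a measure"] assms
  by (simp add: lborel_prod)

lemma nn_integral_to_xy:
  fixes g :: "('d::finite, 'n::finite) xy \<Rightarrow> ennreal"
  assumes g [measurable]: "g \<in> borel_measurable borel"
  shows "(\<integral>\<^sup>+z. g z \<partial>lborel) = 2 * (\<integral>\<^sup>+z. g (to_xy z) \<partial>lborel)"
proof -
  define G where "G x0 y0 = (\<integral>\<^sup>+x. \<integral>\<^sup>+y. g ((x0, x), (y0, y)) \<partial>lborel \<partial>lborel)" for x0 y0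
  have [measurable]: "case_prod G \<in> borel_measurable (borel \<Otimes>\<^sub>M borel)"
    unfolding G_def[abs_def] by measurable
  have inner: "(\<integral>\<^sup>+y0. G x0 y0 \<partial>lborel) = 2 * (\<integral>\<^sup>+s. G x0 (x0 - 2 * s) \<partial>lborel)" for x0
    using nn_integral_real_affine[of "G x0" "-2" x0] by simp
  have shift: "(\<integral>\<^sup>+x0. G x0 (x0 - 2 * s) \<partial>lborel) = (\<integral>\<^sup>+t. G (t + s) (t - s) \<partial>lborel)" for s
    using nn_integral_real_affine[of "\<lambda>x0. G x0 (x0 - 2 * s)" 1 s]
    by (simp add: add.commute algebra_simps)
  have "(\<integral>\<^sup>+z. g z \<partial>lborel) =
      (\<integral>\<^sup>+x0. \<integral>\<^sup>+x. \<integral>\<^sup>+y0. \<integral>\<^sup>+y. g ((x0, x), (y0, y)) \<partial>lborel \<partial>lborel \<partial>lborel \<partial>lborel)"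
    by (simp add: nn_integral_lborel_pair)
  also have "\<dots> = (\<integral>\<^sup>+x0. \<integral>\<^sup>+y0. G x0 y0 \<partial>lborel \<partial>lborel)"
    unfolding G_def by (intro nn_integral_cong lborel_pair.Fubini') measurable
  also have "\<dots> = 2 * (\<integral>\<^sup>+x0. \<integral>\<^sup>+s. G x0 (x0 - 2 * s) \<partial>lborel \<partial>lborel)"
    unfolding inner by (intro nn_integral_cmult) measurable
  also have "(\<integral>\<^sup>+x0. \<integral>\<^sup>+s. G x0 (x0 - 2 * s) \<partial>lborel \<partial>lborel) =
      (\<integral>\<^sup>+s. \<integral>\<^sup>+x0. G x0 (x0 - 2 * s) \<partial>lborel \<partial>lborel)"
    by (intro lborel_pair.Fubini') measurable
  also have "\<dots> = (\<integral>\<^sup>+t. \<integral>\<^sup>+s. G (t + s) (t - s) \<partial>lborel \<partial>lborel)"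
    unfolding shift by (intro lborel_pair.Fubini') measurable
  also have "\<dots> = (\<integral>\<^sup>+z. g (to_xy z) \<partial>lborel)"
    unfolding G_def by (simp add: nn_integral_lborel_pair)
  finally show ?thesis .
qed

lemma distr_to_xy:
  "distr lborel borel (to_xy :: ('d::finite, 'n::finite) tsxy \<Rightarrow> _) =
     density lborel (\<lambda>_. ennreal (1 / 2))"
proof (rule measure_eqI)
  fix A :: "('d, 'n) xy set"
  assume "A \<in> sets (distr lborel borel to_xy)"
  then have A [measurable]: "A \<in> sets borel" by simp
  have "emeasure (distr lborel borel to_xy) A = (\<integral>\<^sup>+z. indicator A (to_xy z) \<partial>lborel)"
    by (simp add: nn_integral_distr flip: nn_integral_indicator)
  moreover have "emeasure lborel A = 2 * (\<integral>\<^sup>+z. indicator A (to_xy z) \<partial>lborel)"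
    using nn_integral_to_xy[of "indicator A"] by simp
  moreover have "ennreal (1 / 2) * (2 * c) = c" for c
    using ennreal_mult'[of 2 "1 / 2"] by (simp add: mult.assoc[symmetric] mult.commute[of _ 2])
  ultimately show "emeasure (distr lborel borel to_xy) A =
      emeasure (density lborel (\<lambda>_. ennreal (1 / 2))) A"
    by (simp add: emeasure_density_const)
qed simp

lemma pullback_function:
  fixes f :: "('d::finite, 'n::finite) xy \<Rightarrow> complex"
  assumes [measurable]: "f \<in> borel_measurable borel" "\<phi> \<in> borel_measurable borel"
  shows "pullback (\<lambda>\<psi>. LINT w|lborel. f w * \<psi> w) \<phi> = (LINT z|lborel. f (to_xy z) * \<phi> z)"
proof -
  have "(LINT z|lborel. f (to_xy z) * \<phi> z) =
      (LINT w|distr lborel borel to_xy. f w * \<phi> (of_xy w))"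
    by (subst integral_distr) auto
  also have "\<dots> = 1 / 2 * (LINT w|lborel. f w * \<phi> (of_xy w))"
    unfolding distr_to_xy
    by (subst integral_density) (auto simp: scaleR_conv_of_real)
  finally show ?thesis
    by (simp add: pullback_def)
qed

end

theory Submission
  imports Defs "HOL-Probability.Characteristic_Functions"
begin

text \<open>
  The Fourier transform of \<open>u\<close> lives on the cone \<open>norm \<xi> = norm \<eta>\<close>.
  At a point of the cone the phase \<open>x\<xi> - y\<eta>\<close> is, in the variables \<open>(t, s, x, y)\<close>, the inner
  product with \<open>(m, l, \<xi>', -\<eta>')\<close>, where \<open>l = \<xi>\<^sub>0 + \<eta>\<^sub>0\<close>, \<open>m = \<xi>\<^sub>0 - \<eta>\<^sub>0\<close> and the primes denote
  the remaining coordinates. The equation of the cone reads \<open>m l = (norm \<eta>')\<^sup>2 - (norm \<xi>')\<^sup>2\<close>.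
  Hence, up to a null set, the cone is a graph over the frequencies \<open>q = (l, \<xi>', -\<eta>')\<close> of the
  initial datum (\<open>cone_point\<close>), and \<open>m\<close> is the function \<open>cone_frequency\<close> of \<open>q\<close>.

  The heart of the proof is the Jacobian \<open>dq = r\<^sup>N \<bar>\<zeta>\<^sub>0 + \<sigma>\<^sub>0\<bar> d\<zeta> d\<sigma> dr\<close> of this
  parametrisation (\<open>integral_cone\<close>). The amplitude contains exactly this density, so that the
  functional on the cone is the integral of \<open>2 \<pi> ft v\<^sub>0 q \<Phi> (cone_point q)\<close> over \<open>q\<close>
  (\<open>cone_functional_eq\<close>), and \<open>v\<close> is the function (\<open>wave\<close>) whose value at time \<open>t\<close> is the inverse
  transform of \<open>cis (t m) ft v\<^sub>0\<close> (\<open>regular_distribution_of_wave\<close>). The claims are now visible: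
  at \<open>t = 0\<close> the inversion formula returns \<open>v\<^sub>0\<close>; the bound of the \<open>L2\<close> norm of a transform and
  dominated convergence give the continuity in \<open>t\<close>; and the symbol of the equation vanishes
  because \<open>m l + (norm \<xi>')\<^sup>2 - (norm \<eta>')\<^sup>2 = 0\<close>. Every Schwartz function is the transform of a
  Schwartz function, hence \<open>u\<close> is determined by its transform; and \<open>u\<close> exists because the
  functional on the cone is bounded by the supremum of \<open>\<Phi>\<close>, \<open>ft v\<^sub>0\<close> being integrable.

  The Jacobian is computed by one-dimensional substitutions only. One of the spheres is written as
  a graph (\<open>nn_integral_sphere_graph\<close>), the other one is combined with the radius to the full
  space (\<open>nn_integral_polar\<close>), and what remains is the hyperbola that the cone cuts out of the
  plane of the first coordinates (\<open>nn_integral_hyperbola_substitution\<close>). The inversion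
  formula and the \<open>L2\<close> bound are obtained by inserting a wide Gaussian, whose transform is explicit.
\<close>

section \<open>Schwartz functions\<close>

text \<open>
  Iterated partial derivatives are awkward to compute for transformed functions. It is enough
  to exhibit one family of rapidly decaying differentiable functions that contains \<open>f\<close> and is
  closed under the partial derivatives.
\<close>

lemma schwartz_coinduct:
  fixes f :: "'a::euclidean_space \<Rightarrow> complex"
  assumes f: "f \<in> S"
    and diff: "\<And>g x. g \<in> S \<Longrightarrow> g differentiable (at x)"
    and closed: "\<And>g b. g \<in> S \<Longrightarrow> b \<in> Basis \<Longrightarrow> pd b g \<in> S"
    and decay: "\<And>g k. g \<in> S \<Longrightarrow> bounded (range (\<lambda>x. norm x ^ k *\<^sub>R g x))"
  shows "schwartz f"
proof -
  have "foldr pd es f \<in> S" if "set es \<subseteq> Basis" for es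
    using that by (induction es) (auto simp: f closed)
  then show ?thesis
    unfolding schwartz_def smooth_def using diff decay by blast
qed

lemma schwartz_differentiable: "schwartz f \<Longrightarrow> f differentiable (at x)"
  unfolding schwartz_def smooth_def by (metis empty_set empty_subsetI foldr_Nil id_apply)

lemma schwartz_decay: "schwartz f \<Longrightarrow> bounded (range (\<lambda>x. norm x ^ k *\<^sub>R f x))"
  unfolding schwartz_def by (metis (no_types, lifting) empty_set empty_subsetI foldr_Nil id_apply ext)

lemma smooth_pd: "smooth (f :: 'a::euclidean_space \<Rightarrow> complex) \<Longrightarrow> b \<in> Basis \<Longrightarrow> smooth (pd b f)"
  unfolding smooth_def
proof (intro allI impI)
  fix es :: "'a list" and x
  assume *: "\<forall>es. set es \<subseteq> Basis \<longrightarrow> (\<forall>x. foldr pd es f differentiable at x)"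
    and b: "b \<in> Basis" and es: "set es \<subseteq> Basis"
  have "set (es @ [b]) \<subseteq> Basis" using b es by simp
  with * have "foldr pd (es @ [b]) f differentiable at x" by blast
  then show "foldr pd es (pd b f) differentiable at x" by simp
qed

lemma schwartz_pd:
  fixes f :: "'a::euclidean_space \<Rightarrow> complex"
  assumes "schwartz f" "b \<in> Basis"
  shows "schwartz (pd b f)"
  unfolding schwartz_def
proof (intro conjI allI impI)
  show "smooth (pd b f)" using assms smooth_pd schwartz_def by blast
  fix es :: "'a list" and k
  assume "set es \<subseteq> Basis"
  then have "set (es @ [b]) \<subseteq> Basis" using assms by simp
  then have "bounded (range (\<lambda>x. norm x ^ k *\<^sub>R foldr pd (es @ [b]) f x))"
    using assms unfolding schwartz_def by blast
  then show "bounded (range (\<lambda>x. norm x ^ k *\<^sub>R foldr pd es (pd b f) x))" by simp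
qed

lemma pd_eq: "(f has_derivative D) (at x) \<Longrightarrow> pd e f x = D e"
  unfolding pd_def by (metis frechet_derivative_at)

lemma differentiable_has_derivative_pd:
  "f differentiable (at x) \<Longrightarrow> (f has_derivative (\<lambda>h. pd h f x)) (at x)"
  unfolding pd_def by (simp add: frechet_derivative_works[symmetric] eta_contract_eq)

lemma pd_sum_Basis:
  assumes "f differentiable (at x)"
  shows "pd h f x = (\<Sum>b\<in>Basis. (h \<bullet> b) *\<^sub>R pd b f x)"
proof -
  interpret bounded_linear "\<lambda>h. pd h f x"
    using differentiable_has_derivative_pd[OF assms] by (rule has_derivative_bounded_linear)
  have "pd h f x = pd (\<Sum>b\<in>Basis. (h \<bullet> b) *\<^sub>R b) f x" by (simp add: euclidean_representation)
  also have "\<dots> = (\<Sum>b\<in>Basis. (h \<bullet> b) *\<^sub>R pd b f x)" by (simp add: sum scale)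
  finally show ?thesis .
qed

lemmas schwartz_has_derivative = differentiable_has_derivative_pd[OF schwartz_differentiable]

lemma schwartz_continuous_on: "schwartz f \<Longrightarrow> continuous_on A f"
  by (meson schwartz_differentiable differentiable_imp_continuous_within continuous_at_imp_continuous_on)

lemma schwartz_measurable [measurable_dest]: "schwartz f \<Longrightarrow> f \<in> borel_measurable borel"
  by (intro borel_measurable_continuous_onI schwartz_continuous_on)

lemma bounded_range_iff: "bounded (range f) \<longleftrightarrow> (\<exists>C. \<forall>x. norm (f x) \<le> C)"
  by (auto simp: bounded_iff)

lemma schwartz_add:
  assumes "schwartz f" "schwartz g"
  shows "schwartz (\<lambda>x. f x + g x)"
proof (rule schwartz_coinduct[where S = "{\<lambda>x. f x + g x | f g. schwartz f \<and> schwartz g}"], goal_cases)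
  case 1 then show ?case using assms by blast
next
  case 2 then show ?case by (auto intro: differentiable_add schwartz_differentiable)
next
  case (3 h b)
  then obtain f g where h: "h = (\<lambda>x. f x + g x)" and fg: "schwartz f" "schwartz g" by blast
  have "pd b h = (\<lambda>x. pd b f x + pd b g x)"
    unfolding h by (intro ext pd_eq has_derivative_add schwartz_has_derivative fg)
  with fg 3 show ?case by (auto intro: schwartz_pd)
next
  case (4 h k)
  then obtain f g where h: "h = (\<lambda>x. f x + g x)" and fg: "schwartz f" "schwartz g" by blast
  obtain A B where "\<And>x. norm (norm x ^ k *\<^sub>R f x) \<le> A" "\<And>x. norm (norm x ^ k *\<^sub>R g x) \<le> B"
    using fg[THEN schwartz_decay, of k] unfolding bounded_range_iff by blast
  then have "norm (norm x ^ k *\<^sub>R h x) \<le> A + B" for x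
    unfolding h scaleR_add_right using norm_triangle_mono by blast
  then show ?case unfolding bounded_range_iff by blast
qed

lemma schwartz_cmult:
  assumes "schwartz f"
  shows "schwartz (\<lambda>x. c * f x)"
proof (rule schwartz_coinduct[where S = "{\<lambda>x. c * f x | f. schwartz f}"], goal_cases)
  case 1 then show ?case using assms by blast
next
  case 2 then show ?case by (auto intro: schwartz_differentiable)
next
  case (3 h b)
  then obtain f where h: "h = (\<lambda>x. c * f x)" and f: "schwartz f" by blast
  have "pd b h = (\<lambda>x. c * pd b f x)"
    unfolding h by (intro ext pd_eq has_derivative_mult_right schwartz_has_derivative f)
  with f 3 show ?case by (auto intro: schwartz_pd)
next
  case (4 h k)
  then obtain f where h: "h = (\<lambda>x. c * f x)" and f: "schwartz f" by blast
  obtain A where "\<And>x. norm (norm x ^ k *\<^sub>R f x) \<le> A"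
    using f[THEN schwartz_decay, of k] unfolding bounded_range_iff by blast
  then have "norm (norm x ^ k *\<^sub>R h x) \<le> norm c * A" for x
    unfolding h by (simp add: norm_mult mult.left_commute mult_left_mono)
  then show ?case unfolding bounded_range_iff by blast
qed

lemma schwartz_sum:
  fixes f :: "'a::euclidean_space \<Rightarrow> complex" and g :: "'i \<Rightarrow> 'a \<Rightarrow> complex"
  assumes "schwartz f" "finite I" "\<And>i. i \<in> I \<Longrightarrow> schwartz (g i)"
  shows "schwartz (\<lambda>x. \<Sum>i\<in>I. g i x)"
  using assms(2,3)
proof (induction I rule: finite_induct)
  case empty
  then show ?case using schwartz_cmult[OF assms(1), of 0] by simp
qed (auto intro: schwartz_add)

lemma schwartz_mult_coordinate:
  fixes f :: "'a::euclidean_space \<Rightarrow> complex"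
  assumes "schwartz f"
  shows "schwartz (\<lambda>x. of_real (x \<bullet> e) * f x)"
proof (rule schwartz_coinduct[where S = "{\<lambda>x. of_real (x \<bullet> e) * f x + g x | f g. schwartz f \<and> schwartz g}"],
    goal_cases)
  case 1
  have "(\<lambda>x. of_real (x \<bullet> e) * f x) = (\<lambda>x. of_real (x \<bullet> e) * f x + 0 * f x)" by simp
  then show ?case using assms schwartz_cmult[OF assms, of 0] by (intro CollectI exI conjI)
next
  case (2 h x)
  then obtain f g where h: "h = (\<lambda>x. of_real (x \<bullet> e) * f x + g x)" and fg: "schwartz f" "schwartz g"
    by blast
  have "(\<lambda>x. complex_of_real (x \<bullet> e)) differentiable (at x)"
    by (intro differentiableI[where f' = "\<lambda>h. of_real (h \<bullet> e)"]) (auto intro!: derivative_eq_intros)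
  then show ?case
    unfolding h
    by (intro differentiable_add differentiable_mult schwartz_differentiable[OF fg(1)]
        schwartz_differentiable[OF fg(2)])
next
  case (3 h b)
  then obtain f g where h: "h = (\<lambda>x. of_real (x \<bullet> e) * f x + g x)" and fg: "schwartz f" "schwartz g"
    by blast
  have "(h has_derivative (\<lambda>v. of_real (x \<bullet> e) * pd v f x + of_real (v \<bullet> e) * f x + pd v g x)) (at x)"
    for x
    unfolding h
    by (intro has_derivative_add has_derivative_mult schwartz_has_derivative fg)
       (auto intro!: derivative_eq_intros)
  from pd_eq[OF this, of b]
  have "pd b h = (\<lambda>x. of_real (x \<bullet> e) * pd b f x + (of_real (b \<bullet> e) * f x + pd b g x))"
    by (simp add: fun_eq_iff)
  moreover have "schwartz (\<lambda>x. of_real (b \<bullet> e) * f x + pd b g x)"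
    using fg 3 by (intro schwartz_add schwartz_cmult schwartz_pd)
  ultimately show ?case using schwartz_pd[OF fg(1)] 3(2) by (intro CollectI exI conjI)
next
  case (4 h k)
  then obtain f g where h: "h = (\<lambda>x. of_real (x \<bullet> e) * f x + g x)" and fg: "schwartz f" "schwartz g"
    by blast
  obtain A B where A: "\<And>x. norm (norm x ^ Suc k *\<^sub>R f x) \<le> A" and B: "\<And>x. norm (norm x ^ k *\<^sub>R g x) \<le> B"
    using schwartz_decay[OF fg(1), of "Suc k"] schwartz_decay[OF fg(2), of k]
    unfolding bounded_range_iff by blast
  have "norm (norm x ^ k *\<^sub>R h x) \<le> norm e * A + B" for x
  proof -
    have "norm (norm x ^ k *\<^sub>R h x) \<le> norm x ^ k * (\<bar>x \<bullet> e\<bar> * norm (f x)) + norm (norm x ^ k *\<^sub>R g x)"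
      unfolding h scaleR_add_right by (rule order_trans[OF norm_triangle_ineq]) (simp add: norm_mult)
    also have "\<dots> \<le> norm x ^ k * ((norm x * norm e) * norm (f x)) + B"
      by (intro add_mono mult_left_mono mult_right_mono Cauchy_Schwarz_ineq2 B) auto
    also have "\<dots> = norm e * norm (norm x ^ Suc k *\<^sub>R f x) + B" by simp
    also have "\<dots> \<le> norm e * A + B" by (intro add_mono mult_left_mono A) auto
    finally show ?thesis .
  qed
  then show ?case unfolding bounded_range_iff by blast
qed

text \<open>The chain rule expresses the derivatives of \<open>f \<circ> L\<close> by those of \<open>f\<close>, with constant coefficients.\<close>

lemma schwartz_compose_linear:
  fixes f :: "'a::euclidean_space \<Rightarrow> complex" and L :: "'b::euclidean_space \<Rightarrow> 'a"
  assumes "schwartz f" and L: "bounded_linear L" and C: "\<And>x. norm x \<le> C * norm (L x)" "0 \<le> C"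
  shows "schwartz (\<lambda>x. f (L x))"
proof (rule schwartz_coinduct[where S = "{\<lambda>x. f (L x) | f. schwartz f}"], goal_cases)
  case 1 then show ?case using assms by blast
next
  case (2 h x) 
  then obtain f where h: "h = (\<lambda>x. f (L x))" and f: "schwartz f" by blast
  show ?case unfolding h
    by (rule differentiable_compose[where f = f and g = L])
       (use f L in \<open>auto intro: schwartz_differentiable bounded_linear_imp_differentiable\<close>)
next
  case (3 h b)
  then obtain f where h: "h = (\<lambda>x. f (L x))" and f: "schwartz f" by blast
  have "(h has_derivative (\<lambda>v. pd (L v) f (L x))) (at x)" for x
    unfolding h using has_derivative_compose[OF bounded_linear_imp_has_derivative[OF L]
      schwartz_has_derivative[OF f]] .
  from pd_eq[OF this, of b]
  have "pd b h = (\<lambda>x. \<Sum>c\<in>Basis. (L b \<bullet> c) *\<^sub>R pd c f (L x))"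
    by (simp add: fun_eq_iff pd_sum_Basis[OF schwartz_differentiable[OF f], of "L b"])
  moreover have "schwartz (\<lambda>y. \<Sum>c\<in>Basis. (L b \<bullet> c) *\<^sub>R pd c f y)"
    unfolding scaleR_conv_of_real using f by (intro schwartz_sum schwartz_cmult schwartz_pd) auto
  ultimately show ?case by auto
next
  case (4 h k)
  then obtain f where h: "h = (\<lambda>x. f (L x))" and f: "schwartz f" by blast
  obtain A where A: "\<And>x. norm (norm x ^ k *\<^sub>R f x) \<le> A"
    using f[THEN schwartz_decay, of k] unfolding bounded_range_iff by blast
  have "norm (norm x ^ k *\<^sub>R h x) \<le> C ^ k * A" for x
  proof -
    have "norm (norm x ^ k *\<^sub>R h x) \<le> (C * norm (L x)) ^ k * norm (h x)"
      by (simp add: mult_right_mono power_mono C)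
    also have "\<dots> = C ^ k * norm (norm (L x) ^ k *\<^sub>R f (L x))"
      by (simp add: h power_mult_distrib)
    also have "\<dots> \<le> C ^ k * A" by (intro mult_left_mono A) (use C in auto)
    finally show ?thesis .
  qed
  then show ?case unfolding bounded_range_iff by blast
qed

lemma test_function_pd:
  assumes "test_function f" "b \<in> Basis"
  shows "test_function (pd b f)"
proof -
  have "pd b f x = 0" if "x \<notin> closure {x. f x \<noteq> 0}" for x
  proof -
    have "(f has_derivative (\<lambda>_. 0)) (at x)"
    proof (rule has_derivative_transform_within_open)
      show "((\<lambda>_. 0::complex) has_derivative (\<lambda>_. 0)) (at x)" by simp
      show "open (- closure {x. f x \<noteq> 0})" by auto
      show "x \<in> - closure {x. f x \<noteq> 0}" using that by simp
    qed (use closure_subset[of "{x. f x \<noteq> 0}"] in auto)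
    then show ?thesis by (simp add: pd_eq)
  qed
  then have "closure {x. pd b f x \<noteq> 0} \<subseteq> closure {x. f x \<noteq> 0}"
    by (intro closure_minimal) auto
  moreover have "compact (closure {x. f x \<noteq> 0})" using assms by (simp add: test_function_def)
  ultimately have "compact (closure {x. pd b f x \<noteq> 0})"
    by (metis closed_closure compact_Int_closed inf.absorb_iff2)
  then show ?thesis
    using assms by (simp add: test_function_def smooth_pd)
qed

lemma schwartz_test_function: "test_function f \<Longrightarrow> schwartz f"
proof (rule schwartz_coinduct[where S = "Collect test_function"], goal_cases)
  case (2 g x)
  then have "\<forall>x. foldr pd [] g differentiable (at x)"
    unfolding mem_Collect_eq test_function_def smooth_def by (metis empty_set empty_subsetI)
  then show ?case by simp
next
  case (4 g k)
  then have "\<forall>x. foldr pd [] g differentiable (at x)"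
    unfolding mem_Collect_eq test_function_def smooth_def by (metis empty_set empty_subsetI)
  then have "continuous_on A g" for A
    by (auto intro!: continuous_at_imp_continuous_on differentiable_imp_continuous_within)
  then have "compact ((\<lambda>x. norm x ^ k *\<^sub>R g x) ` closure {x. g x \<noteq> 0})"
    using 4 by (intro compact_continuous_image continuous_intros) (auto simp: test_function_def)
  then have "bounded (insert 0 ((\<lambda>x. norm x ^ k *\<^sub>R g x) ` closure {x. g x \<noteq> 0}))"
    by (simp add: compact_imp_bounded)
  then show ?case
    by (rule bounded_subset) (use closure_subset[of "{x. g x \<noteq> 0}"] in auto)
qed (auto simp: test_function_pd)

section \<open>Integrals of Schwartz functions\<close>

lemma
  fixes f :: "'a::euclidean_space \<Rightarrow> real \<Rightarrow> 'c::{real_normed_field,banach,second_countable_topology}"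
  assumes f: "\<And>b. b \<in> Basis \<Longrightarrow> integrable lborel (f b)"
  shows integrable_prod_Basis: "integrable lborel (\<lambda>x::'a. \<Prod>b\<in>Basis. f b (x \<bullet> b))"
    and integral_prod_Basis:
      "(LINT x|lborel. (\<Prod>b\<in>Basis. f b (x \<bullet> b))) = (\<Prod>b\<in>Basis. (LINT x|lborel. f b x))"
proof -
  interpret product_sigma_finite "\<lambda>_::'a. lborel :: real measure" ..
  let ?M = "\<Pi>\<^sub>M b\<in>(Basis::'a set). (lborel :: real measure)"
  have lb: "(lborel :: 'a measure) = distr ?M borel (\<lambda>x. \<Sum>b\<in>Basis. x b *\<^sub>R b)"
    by (subst (1) lborel_def) (simp add: lborel_eq_real)
  have [measurable]: "f b \<in> borel_measurable borel" if "b \<in> Basis" for b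
    using borel_measurable_integrable[OF f[OF that]] by simp
  have eq: "(\<Prod>b\<in>Basis. f b ((\<Sum>c\<in>Basis. x c *\<^sub>R c) \<bullet> b)) = (\<Prod>b\<in>Basis. f b (x b))" for x
    by (intro prod.cong refl arg_cong2[where f = f]) (simp add: inner_sum_left inner_Basis if_distrib sum.delta cong: if_cong)
  show "integrable lborel (\<lambda>x::'a. \<Prod>b\<in>Basis. f b (x \<bullet> b))"
    unfolding lb by (subst integrable_distr_eq) (auto simp: eq intro!: product_integrable_prod f)
  show "(LINT x|lborel. (\<Prod>b\<in>Basis. f b (x \<bullet> b))) = (\<Prod>b\<in>Basis. (LINT x|lborel. f b x))"
    unfolding lb by (subst integral_distr) (auto simp: eq intro!: product_integral_prod f)
qed

lemma integrable_inverse_1_plus_square: "integrable lborel (\<lambda>x::real. 1 / (1 + x\<^sup>2))"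
proof -
  have "set_integrable lborel (einterval (-\<infinity>) \<infinity>) (\<lambda>x::real. 1 / (1 + x\<^sup>2))"
  proof (rule interval_integral_FTC_nonneg(1)[where F = arctan and A = "- (pi / 2)" and B = "pi / 2"])
    show "((arctan \<circ> real_of_ereal) \<longlongrightarrow> - (pi / 2)) (at_right (- \<infinity>))"
      using tendsto_arctan_at_bot by (simp add: ereal_tendsto_simps)
    show "((arctan \<circ> real_of_ereal) \<longlongrightarrow> pi / 2) (at_left \<infinity>)"
      using tendsto_arctan_at_top by (simp add: ereal_tendsto_simps)
  qed (auto intro!: derivative_eq_intros continuous_intros simp: add_nonneg_eq_0_iff inverse_eq_divide)
  then show ?thesis by (simp add: set_integrable_def)
qed

text \<open>
  The bound \<open>(1 + norm x)\<^sup>2 \<ge> 1 + (x \<bullet> b)\<^sup>2\<close> for each of the coordinates reduces the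
  integrability to that of \<open>1 / (1 + x\<^sup>2)\<close> on the line.
\<close>

lemma integrable_inverse_power_norm:
  "integrable lborel (\<lambda>x::'a::euclidean_space. 1 / (1 + norm x) ^ (2 * DIM('a)))"
proof (rule Bochner_Integration.integrable_bound)
  show "integrable lborel (\<lambda>x::'a. \<Prod>b\<in>Basis. 1 / (1 + (x \<bullet> b)\<^sup>2))"
    using integrable_prod_Basis[where f = "\<lambda>_::'a. \<lambda>x. 1 / (1 + x\<^sup>2)"] integrable_inverse_1_plus_square
    by blast
  have "norm (1 / (1 + norm x) ^ (2 * DIM('a))) \<le> norm (\<Prod>b\<in>Basis. 1 / (1 + (x \<bullet> b)\<^sup>2))" for x :: 'a
  proof -
    have "1 + (x \<bullet> b)\<^sup>2 \<le> (1 + norm x)\<^sup>2" if "b \<in> Basis" for b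
    proof -
      have "(x \<bullet> b)\<^sup>2 \<le> (norm x)\<^sup>2" using Basis_le_norm[OF that, of x] by (simp add: abs_le_square_iff[symmetric])
      moreover have "(1 + norm x)\<^sup>2 = 1 + 2 * norm x + (norm x)\<^sup>2"
        by (simp add: power2_eq_square algebra_simps)
      ultimately show ?thesis using norm_ge_zero[of x] by linarith
    qed
    then have "(\<Prod>b\<in>(Basis::'a set). 1 / (1 + norm x)\<^sup>2) \<le> (\<Prod>b\<in>(Basis::'a set). 1 / (1 + (x \<bullet> b)\<^sup>2))"
      by (intro prod_mono conjI frac_le) (auto intro: add_pos_nonneg)
    moreover have "(\<Prod>b\<in>(Basis::'a set). 1 / (1 + (x \<bullet> b)\<^sup>2)) \<ge> 0" by (intro prod_nonneg) auto
    ultimately show ?thesis by (simp add: power_mult power_one_over)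
  qed
  then show "AE x::'a in lborel. norm (1 / (1 + norm x) ^ (2 * DIM('a))) \<le> norm (\<Prod>b\<in>Basis. 1 / (1 + (x \<bullet> b)\<^sup>2))"
    by simp
qed simp

lemma schwartz_bound:
  assumes "schwartz f"
  obtains C where "\<And>x. (1 + norm x) ^ k * norm (f x) \<le> C" "0 \<le> C"
proof -
  obtain A B where A: "\<And>x. norm (norm x ^ k *\<^sub>R f x) \<le> A" and B: "\<And>x. norm (norm x ^ 0 *\<^sub>R f x) \<le> B"
    using schwartz_decay[OF assms, of k] schwartz_decay[OF assms, of 0]
    unfolding bounded_range_iff by blast
  have le: "(1 + norm x) ^ k * norm (f x) \<le> 2 ^ k * (A + B)" for x
  proof -
    have "(1 + norm x) ^ k \<le> (2 * max 1 (norm x)) ^ k" by (intro power_mono) auto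
    also have "\<dots> \<le> 2 ^ k * (1 + norm x ^ k)"
      by (auto simp: power_mult_distrib max_def)
    finally have "(1 + norm x) ^ k * norm (f x) \<le> 2 ^ k * (1 + norm x ^ k) * norm (f x)"
      by (intro mult_right_mono) auto
    also have "\<dots> = 2 ^ k * (norm (norm x ^ k *\<^sub>R f x) + norm (norm x ^ 0 *\<^sub>R f x))"
      by (simp add: algebra_simps)
    also have "\<dots> \<le> 2 ^ k * (A + B)" by (intro mult_left_mono add_mono A B) auto
    finally show ?thesis .
  qed
  moreover have "0 \<le> 2 ^ k * (A + B)"
    using order_trans[OF _ le[of 0], of 0] by simp
  ultimately show ?thesis using that by blast
qed

lemma schwartz_integrable_moment:
  fixes f :: "'a::euclidean_space \<Rightarrow> complex"
  assumes f: "schwartz f"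
  shows "integrable lborel (\<lambda>x. norm x ^ k * norm (f x))"
proof -
  note [measurable] = schwartz_measurable[OF f]
  obtain C where C: "\<And>x. (1 + norm x) ^ (k + 2 * DIM('a)) * norm (f x) \<le> C" "0 \<le> C"
    using schwartz_bound[OF f, of "k + 2 * DIM('a)"] by blast
  show ?thesis
  proof (rule Bochner_Integration.integrable_bound)
    show "integrable lborel (\<lambda>x::'a. C * (1 / (1 + norm x) ^ (2 * DIM('a))))"
      by (intro integrable_mult_right integrable_inverse_power_norm)
    have "norm (norm x ^ k * norm (f x)) \<le> norm (C * (1 / (1 + norm x) ^ (2 * DIM('a))))" for x
    proof -
      have "norm x ^ k * norm (f x) * (1 + norm x) ^ (2 * DIM('a)) \<le>
          (1 + norm x) ^ k * norm (f x) * (1 + norm x) ^ (2 * DIM('a))"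
        by (intro mult_right_mono power_mono) auto
      also have "\<dots> \<le> C" using C(1)[of x] by (simp add: power_add algebra_simps)
      finally have "norm x ^ k * norm (f x) \<le> C / (1 + norm x) ^ (2 * DIM('a))"
        by (subst pos_le_divide_eq) (auto intro!: zero_less_power add_pos_nonneg)
      then show ?thesis using C(2) by simp
    qed
    then show "AE x in lborel. norm (norm x ^ k * norm (f x)) \<le> norm (C * (1 / (1 + norm x) ^ (2 * DIM('a))))"
      by simp
  qed simp
qed

lemma schwartz_integrable: "schwartz f \<Longrightarrow> integrable lborel f"
  using schwartz_integrable_moment[of f 0]
  by (simp add: integrable_norm_iff schwartz_measurable)

lemma schwartz_norm_bound:
  fixes f :: "'a::euclidean_space \<Rightarrow> complex"
  assumes f: "schwartz f"
  shows "(1 + norm x) ^ m * norm (f x) \<le> schwartz_norm m f"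
proof -
  let ?E = "{es. set es \<subseteq> (Basis :: 'a set) \<and> length es \<le> m}"
  have "\<exists>C. \<forall>x. (1 + norm x) ^ m * norm (foldr pd es f x) \<le> C" if "es \<in> ?E" for es
  proof -
    have "schwartz (foldr pd es f)"
      using that by (induction es) (auto simp: f schwartz_pd)
    then show ?thesis by (metis schwartz_bound)
  qed
  then have "\<forall>es\<in>?E. \<exists>C. \<forall>x. (1 + norm x) ^ m * norm (foldr pd es f x) \<le> C" by blast
  from bchoice[OF this]
  obtain C where C: "\<And>es x. es \<in> ?E \<Longrightarrow> (1 + norm x) ^ m * norm (foldr pd es f x) \<le> C es"
    by blast
  have fin: "finite ?E" by (rule finite_lists_length_le) simp
  have "(\<lambda>(es, x). (1 + norm x) ^ m * norm (foldr pd es f x)) ([], x) \<le> schwartz_norm m f"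
    unfolding schwartz_norm_def
  proof (rule cSUP_upper)
    show "bdd_above ((\<lambda>(es, x). (1 + norm x) ^ m * norm (foldr pd es f x)) ` (?E \<times> UNIV))"
    proof (rule bdd_aboveI2)
      fix p assume "p \<in> ?E \<times> (UNIV :: 'a set)"
      then show "(\<lambda>(es, x). (1 + norm x) ^ m * norm (foldr pd es f x)) p \<le> Max (C ` ?E)"
        using C[of "fst p" "snd p"] Max_ge[OF finite_imageI[OF fin, of C], of "C (fst p)"]
        by (fastforce simp: split_beta)
    qed
  qed simp
  then show ?thesis by simp
qed

lemma schwartz_norm_integral_bound:
  fixes f :: "'a::euclidean_space \<Rightarrow> complex"
  assumes f: "schwartz f"
  shows "(LINT x|lborel. norm (f x)) \<le>
    (LINT x::'a|lborel. 1 / (1 + norm x) ^ (2 * DIM('a))) * schwartz_norm (2 * DIM('a)) f"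
proof -
  have "norm (f x) \<le> 1 / (1 + norm x) ^ (2 * DIM('a)) * schwartz_norm (2 * DIM('a)) f" for x
  proof -
    have "0 < (1 + norm x) ^ (2 * DIM('a))" by (auto intro!: zero_less_power add_pos_nonneg)
    then show ?thesis
      using schwartz_norm_bound[OF f, of x "2 * DIM('a)"] by (simp add: field_simps)
  qed
  then have "(LINT x|lborel. norm (f x)) \<le>
      (LINT x::'a|lborel. 1 / (1 + norm x) ^ (2 * DIM('a)) * schwartz_norm (2 * DIM('a)) f)"
    by (intro integral_mono integrable_mult_left integrable_inverse_power_norm
        integrable_norm schwartz_integrable f)
  then show ?thesis unfolding integral_mult_left_zero .
qed

section \<open>The Fourier transform of Schwartz functions\<close>

text \<open>
  The usual transform, with one sign for all variables. The opposite sign of the second group in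
  \<open>fourier\<close> amounts to a reflection of the argument, see \<open>fourier_eq_ft\<close> below.
\<close>

definition ft :: "('a::euclidean_space \<Rightarrow> complex) \<Rightarrow> 'a \<Rightarrow> complex" where
  "ft f k = (LINT x|lborel. cis (- (x \<bullet> k)) * f x)"

lemma measurable_cis [measurable]: "cis \<in> borel_measurable borel"
  by (intro borel_measurable_continuous_onI continuous_intros)

lemma measurable_cnj [measurable]: "cnj \<in> borel_measurable borel"
  by (intro borel_measurable_continuous_onI continuous_intros)

lemma measurable_pair_projections [measurable]:
  "fst \<in> borel_measurable (borel :: ('a::second_countable_topology \<times> 'b::second_countable_topology) measure)"
  "snd \<in> borel_measurable (borel :: ('a::second_countable_topology \<times> 'b::second_countable_topology) measure)"
  by (intro borel_measurable_continuous_onI continuous_intros)+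

lemma integrable_bounded_mult:
  fixes c f :: "'a \<Rightarrow> complex"
  assumes f: "integrable M f" and [measurable]: "c \<in> borel_measurable M" and c: "\<And>x. norm (c x) \<le> B"
  shows "integrable M (\<lambda>x. c x * f x)"
proof (rule Bochner_Integration.integrable_bound)
  show "integrable M (\<lambda>x. B * norm (f x))" using f by simp
  note [measurable] = borel_measurable_integrable[OF f]
  show "(\<lambda>x. c x * f x) \<in> borel_measurable M" by measurable
  have "norm (c x * f x) \<le> B * norm (f x)" for x
    by (simp add: norm_mult mult_right_mono c)
  then show "AE x in M. norm (c x * f x) \<le> norm (B * norm (f x))"
    by (auto intro: order_trans[OF _ abs_ge_self])
qed

lemma norm_integral_le:
  fixes f :: "'a \<Rightarrow> complex"
  assumes "integrable M f" "integrable M g" "\<And>x. norm (f x) \<le> g x"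
  shows "norm (integral\<^sup>L M f) \<le> integral\<^sup>L M g"
  by (rule order_trans[OF integral_norm_bound integral_mono]) (use assms in auto)

lemma integrable_ft: "integrable lborel f \<Longrightarrow> integrable lborel (\<lambda>x. cis (- (x \<bullet> k)) * f x)"
  by (rule integrable_bounded_mult[where B = 1]) auto

lemma measurable_ft [measurable]:
  assumes [measurable]: "f \<in> borel_measurable borel"
  shows "ft f \<in> borel_measurable borel"
  unfolding ft_def by measurable

lemma ft_add:
  "integrable lborel f \<Longrightarrow> integrable lborel g \<Longrightarrow> ft (\<lambda>x. f x + g x) k = ft f k + ft g k"
  by (simp add: ft_def distrib_left integrable_ft)

lemma ft_cmult: "ft (\<lambda>x. c * f x) k = c * ft f k"
  by (simp add: ft_def mult.left_commute[of _ c])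

lemma norm_ft_le: "norm (ft f k) \<le> (LINT x|lborel. norm (f x))"
  unfolding ft_def by (rule order_trans[OF integral_norm_bound]) (simp add: norm_mult)

lemma norm_cis_minus_linear: "norm (cis t - 1 - \<i> * of_real t) \<le> t\<^sup>2"
proof -
  have "norm (cis t - 1 - \<i> * of_real t) \<le> \<bar>t\<bar> ^ Suc 1 / fact (Suc 1)"
    using iexp_approx1[of t 1] by (simp add: cis_conv_exp algebra_simps)
  also have "\<dots> \<le> t\<^sup>2" by (simp add: power2_eq_square)
  finally show ?thesis .
qed

text \<open>The remainder of the linear approximation of \<open>cis\<close> is quadratic, so two moments of \<open>f\<close> suffice.\<close>

lemma ft_has_derivative:
  fixes f :: "'a::euclidean_space \<Rightarrow> complex"
  assumes f: "schwartz f"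
  shows "(ft f has_derivative (\<lambda>h. ft (\<lambda>x. - \<i> * (of_real (x \<bullet> h) * f x)) k)) (at k)"
proof -
  let ?D = "\<lambda>h. ft (\<lambda>x. - \<i> * (of_real (x \<bullet> h) * f x)) k"
  let ?M = "\<lambda>j. LINT x|lborel. norm x ^ j * norm (f x)"
  note [measurable] = schwartz_measurable[OF f]
  have int: "integrable lborel (\<lambda>x. - \<i> * (of_real (x \<bullet> h) * f x))" for h
    by (intro integrable_mult_right schwartz_integrable schwartz_mult_coordinate f)
  have lin: "bounded_linear ?D"
  proof (rule bounded_linear_intro[where K = "?M 1"])
    fix g h
    show "?D (g + h) = ?D g + ?D h"
      using ft_add[OF int[of g] int[of h], of k] by (simp add: inner_add_right algebra_simps)
  next
    fix r :: real and h
    show "?D (r *\<^sub>R h) = r *\<^sub>R ?D h"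
      using ft_cmult[of "of_real r" "\<lambda>x. - \<i> * (of_real (x \<bullet> h) * f x)" k]
      by (simp add: scaleR_conv_of_real algebra_simps)
  next
    fix h
    have "norm (?D h) \<le> (LINT x|lborel. norm (- \<i> * (of_real (x \<bullet> h) * f x)))"
      by (rule norm_ft_le)
    also have "\<dots> \<le> (LINT x|lborel. (norm x ^ 1 * norm (f x)) * norm h)"
    proof (intro integral_mono integrable_norm int integrable_mult_left schwartz_integrable_moment f)
      fix x
      show "norm (- \<i> * (of_real (x \<bullet> h) * f x)) \<le> norm x ^ 1 * norm (f x) * norm h"
        using mult_right_mono[OF Cauchy_Schwarz_ineq2[of x h], of "norm (f x)"]
        by (simp add: norm_mult algebra_simps)
    qed
    finally show "norm (?D h) \<le> norm h * ?M 1" by (simp add: mult.commute)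
  qed
  show ?thesis
  proof (rule has_derivativeI_sandwich[where e = 1 and H = "\<lambda>y. norm (y - k) * ?M 2"])
    fix y assume "y \<noteq> k"
    have "ft f y - ft f k - ?D (y - k) =
        (LINT x|lborel. cis (- (x \<bullet> k)) * (cis (- (x \<bullet> (y - k))) - 1 - \<i> * of_real (- (x \<bullet> (y - k)))) * f x)"
      unfolding ft_def
      apply (subst Bochner_Integration.integral_diff[symmetric])
        apply (intro integrable_ft schwartz_integrable f)+
      apply (subst Bochner_Integration.integral_diff[symmetric])
        apply (intro Bochner_Integration.integrable_diff integrable_ft schwartz_integrable f)
       apply (rule integrable_ft, rule int)
      apply (intro Bochner_Integration.integral_cong refl)
      apply (simp add: algebra_simps cis_mult inner_diff_right)
      done
    also have "norm \<dots> \<le> (LINT x|lborel. (norm x ^ 2 * norm (f x)) * (norm (y - k))\<^sup>2)"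
    proof (rule norm_integral_le)
      fix x
      let ?t = "- (x \<bullet> (y - k))"
      have "?t\<^sup>2 \<le> (norm x * norm (y - k))\<^sup>2"
        using Cauchy_Schwarz_ineq2[of x "y - k"] by (simp add: abs_le_square_iff[symmetric])
      then have "norm (cis ?t - 1 - \<i> * of_real ?t) * norm (f x) \<le> (norm x * norm (y - k))\<^sup>2 * norm (f x)"
        by (intro mult_right_mono order_trans[OF norm_cis_minus_linear]) auto
      then show "norm (cis (- (x \<bullet> k)) * (cis ?t - 1 - \<i> * of_real ?t) * f x) \<le>
          (norm x ^ 2 * norm (f x)) * (norm (y - k))\<^sup>2"
        by (simp only: norm_mult norm_cis mult_1_left power_mult_distrib mult_ac)
      show "integrable lborel (\<lambda>x. (norm x ^ 2 * norm (f x)) * (norm (y - k))\<^sup>2)"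
        by (intro integrable_mult_left schwartz_integrable_moment f)
    next
      have *: "(\<lambda>x. cis (- (x \<bullet> k)) * (cis (- (x \<bullet> (y - k))) - 1 - \<i> * of_real (- (x \<bullet> (y - k)))) * f x) =
        (\<lambda>x. cis (- (x \<bullet> y)) * f x - cis (- (x \<bullet> k)) * f x - cis (- (x \<bullet> k)) * (- \<i> * (of_real (x \<bullet> (y - k)) * f x)))"
        by (simp add: fun_eq_iff algebra_simps cis_mult inner_diff_right)
      show "integrable lborel (\<lambda>x. cis (- (x \<bullet> k)) * (cis (- (x \<bullet> (y - k))) - 1 - \<i> * of_real (- (x \<bullet> (y - k)))) * f x)"
        unfolding * by (intro Bochner_Integration.integrable_diff integrable_ft schwartz_integrable f int)
    qed
    also have "\<dots> = norm (y - k) * ?M 2 * norm (y - k)"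
      by (simp add: power2_eq_square[of "norm (y - k)"])
    finally show "norm (ft f y - ft f k - ?D (y - k)) / norm (y - k) \<le> norm (y - k) * ?M 2"
      by (rule pos_divide_le_eq[THEN iffD2, rotated]) (use \<open>y \<noteq> k\<close> in simp)
  next
    show "((\<lambda>y. norm (y - k) * ?M 2) \<longlongrightarrow> 0) (at k)"
      by (rule tendsto_eq_intros | simp)+
  qed (use lin in auto)
qed

lemma norm_difference_quotient_le:
  fixes f :: "'a::euclidean_space \<Rightarrow> complex"
  assumes f: "\<And>x. f differentiable (at x)" and h: "0 < h"
    and B: "\<And>s. 0 \<le> s \<Longrightarrow> s \<le> h \<Longrightarrow> norm (pd b f (x + s *\<^sub>R b)) \<le> B"
  shows "norm ((f (x + h *\<^sub>R b) - f x) /\<^sub>R h) \<le> B"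
proof -
  let ?g = "\<lambda>s. f (x + s *\<^sub>R b)"
  have "norm (?g h - ?g 0) \<le> B * norm (h - 0)"
  proof (rule differentiable_bound)
    fix s :: real assume s: "s \<in> {0..h}"
    have line: "((\<lambda>s. x + s *\<^sub>R b) has_derivative (\<lambda>t. t *\<^sub>R b)) (at s within {0..h})"
      by (auto intro!: derivative_eq_intros)
    have "(?g has_derivative (\<lambda>t. pd (t *\<^sub>R b) f (x + s *\<^sub>R b))) (at s within {0..h})"
      using has_derivative_compose[OF line differentiable_has_derivative_pd[OF f]] .
    moreover have "pd (t *\<^sub>R b) f y = t *\<^sub>R pd b f y" for t y
      using linear_scale[OF has_derivative_linear[OF differentiable_has_derivative_pd[OF f]]] .
    ultimately show "(?g has_derivative (\<lambda>t. t *\<^sub>R pd b f (x + s *\<^sub>R b))) (at s within {0..h})"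
      by simp
    show "onorm (\<lambda>t. t *\<^sub>R pd b f (x + s *\<^sub>R b)) \<le> B"
    proof (rule onorm_bound)
      show "0 \<le> B" using order_trans[OF norm_ge_zero B[of s]] s by simp
      show "norm (t *\<^sub>R pd b f (x + s *\<^sub>R b)) \<le> B * norm t" for t
        using mult_right_mono[OF B[of s], of "\<bar>t\<bar>"] s by (simp add: mult.commute)
    qed
  qed (use h in auto)
  moreover have "norm ((f (x + h *\<^sub>R b) - f x) /\<^sub>R h) = norm (f (x + h *\<^sub>R b) - f x) / h"
    using h by (simp add: divide_inverse mult.commute)
  ultimately show ?thesis using h by (simp add: pos_divide_le_eq)
qed

text \<open>
  Translation by \<open>h b\<close> multiplies the transform by \<open>cis (h (b \<bullet> k))\<close>; the derivative in \<open>h\<close> of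
  this relation at \<open>h = 0\<close> replaces an integration by parts.
\<close>

lemma ft_pd:
  fixes f :: "'a::euclidean_space \<Rightarrow> complex"
  assumes f: "schwartz f" and b: "b \<in> Basis"
  shows "ft (pd b f) k = \<i> * of_real (k \<bullet> b) * ft f k"
proof -
  define h where "h n = inverse (real (Suc n))" for n
  have h: "0 < h n" "h n \<le> 1" for n by (auto simp: h_def field_simps)
  have h0: "h \<longlonglongrightarrow> 0" unfolding h_def by (rule LIMSEQ_inverse_real_of_nat)
  have h0': "filterlim h (at 0) sequentially"
    using h0 h by (auto simp: filterlim_at intro!: always_eventually less_imp_neq[symmetric])
  note [measurable] = schwartz_measurable[OF f]
  let ?q = "\<lambda>n x. (f (x + h n *\<^sub>R b) - f x) /\<^sub>R h n"
  let ?m = "2 * DIM('a)"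
  obtain C where C: "\<And>x. (1 + norm x) ^ ?m * norm (pd b f x) \<le> C" "0 \<le> C"
    using schwartz_bound[OF schwartz_pd[OF f b], of ?m] by blast
  let ?w = "\<lambda>x::'a. 2 ^ ?m * C * (1 / (1 + norm x) ^ ?m)"
  have bound: "norm (?q n x) \<le> ?w x" for n x
  proof (rule norm_difference_quotient_le)
    fix s assume s: "0 \<le> s" "s \<le> h n"
    then have "s \<le> 1" using h[of n] by linarith
    let ?y = "x + s *\<^sub>R b"
    have "norm x \<le> norm ?y + norm (s *\<^sub>R b)" by (metis add_diff_cancel_right' norm_triangle_ineq4)
    moreover have "norm (s *\<^sub>R b) \<le> 1" using s \<open>s \<le> 1\<close> b by simp
    moreover have "1 + p \<le> 2 * (1 + q)" if "p \<le> q + r" "r \<le> 1" "0 \<le> q" for p q r :: real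
      using that by simp
    ultimately have "1 + norm x \<le> 2 * (1 + norm ?y)" using norm_ge_zero by blast
    then have "(1 + norm x) ^ ?m \<le> (2 * (1 + norm ?y)) ^ ?m" by (intro power_mono) auto
    then have "(1 + norm x) ^ ?m * norm (pd b f ?y) \<le> 2 ^ ?m * ((1 + norm ?y) ^ ?m * norm (pd b f ?y))"
      unfolding mult.assoc[symmetric] power_mult_distrib[symmetric] by (intro mult_right_mono) auto
    also have "\<dots> \<le> 2 ^ ?m * C" by (intro mult_left_mono C) auto
    finally show "norm (pd b f ?y) \<le> ?w x"
      by (simp add: field_simps) (subst pos_le_divide_eq, auto intro!: zero_less_power add_pos_nonneg simp: field_simps)
  qed (use h schwartz_differentiable[OF f] in auto)
  have "(\<lambda>n. ft (?q n) k) \<longlonglongrightarrow> ft (pd b f) k"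
    unfolding ft_def
  proof (rule integral_dominated_convergence[where w = ?w])
    show "integrable lborel ?w" by (intro integrable_mult_right integrable_inverse_power_norm)
    show "AE x in lborel. norm (cis (- (x \<bullet> k)) * ?q n x) \<le> ?w x" for n
      using bound by (simp add: norm_mult)
    show "AE x in lborel. (\<lambda>n. cis (- (x \<bullet> k)) * ?q n x) \<longlonglongrightarrow> cis (- (x \<bullet> k)) * pd b f x"
    proof (intro always_eventually allI tendsto_mult tendsto_const)
      fix x
      have "((\<lambda>s. f (x + s *\<^sub>R b)) has_derivative (\<lambda>t. pd (t *\<^sub>R b) f (x + 0 *\<^sub>R b))) (at 0)"
        by (rule has_derivative_compose[OF _ schwartz_has_derivative[OF f]])
           (auto intro!: derivative_eq_intros)
      moreover have "pd (t *\<^sub>R b) f y = t *\<^sub>R pd b f y" for t y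
        using linear_scale[OF has_derivative_linear[OF schwartz_has_derivative[OF f]]] .
      ultimately have "((\<lambda>s. norm (f (x + (0 + s) *\<^sub>R b) - f (x + 0 *\<^sub>R b) - s *\<^sub>R pd b f x) / norm s) \<longlongrightarrow> 0) (at 0)"
        by (simp add: has_derivative_at)
      from filterlim_compose[OF this h0']
      have "(\<lambda>n. norm (f (x + h n *\<^sub>R b) - f x - h n *\<^sub>R pd b f x) / norm (h n)) \<longlonglongrightarrow> 0" by simp
      moreover have "norm (f (x + h n *\<^sub>R b) - f x - h n *\<^sub>R pd b f x) / norm (h n) = norm (?q n x - pd b f x)" for n
      proof -
        have "?q n x - pd b f x = (f (x + h n *\<^sub>R b) - f x - h n *\<^sub>R pd b f x) /\<^sub>R h n"
          using h(1)[of n] by (simp add: scaleR_diff_right)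
        then show ?thesis using h(1)[of n] by (simp add: divide_inverse mult.commute)
      qed
      ultimately have "(\<lambda>n. norm (?q n x - pd b f x)) \<longlonglongrightarrow> 0" by simp
      then show "(\<lambda>n. ?q n x) \<longlonglongrightarrow> pd b f x"
        by (rule LIM_zero_cancel[OF tendsto_norm_zero_cancel])
    qed
  qed (use schwartz_measurable[OF schwartz_pd[OF f b]] in measurable)
  moreover have "ft (?q n) k = (cis (h n * (k \<bullet> b)) - 1) /\<^sub>R h n * ft f k" for n
  proof -
    have int: "integrable lborel f" using f by (rule schwartz_integrable)
    let ?G = "\<lambda>x. cis (h n * (k \<bullet> b)) * (cis (- (x \<bullet> k)) * f x)"
    have "(LINT x|lborel. ?G x) = (LINT x|distr lborel borel ((+) (h n *\<^sub>R b)). ?G x)"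
      by (simp add: lborel_distr_plus)
    also have "\<dots> = (LINT x|lborel. ?G (h n *\<^sub>R b + x))"
      by (rule integral_distr) auto
    also have "\<dots> = (LINT x|lborel. cis (- (x \<bullet> k)) * f (x + h n *\<^sub>R b))"
      by (simp add: mult.assoc[symmetric] cis_mult inner_add_left inner_commute[of b k] add.commute[of "h n *\<^sub>R b"])
    finally have shift: "ft (\<lambda>x. f (x + h n *\<^sub>R b)) k = cis (h n * (k \<bullet> b)) * ft f k"
      by (simp add: ft_def)
    have "integrable (distr lborel borel ((+) (h n *\<^sub>R b))) f"
      using int by (simp add: lborel_distr_plus)
    then have "integrable lborel (\<lambda>x. f (x + h n *\<^sub>R b))"
      by (subst (asm) integrable_distr_eq) (auto simp: add.commute)
    then have "ft (\<lambda>x. f (x + h n *\<^sub>R b) + (- 1) * f x) k =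
        ft (\<lambda>x. f (x + h n *\<^sub>R b)) k + ft (\<lambda>x. (- 1) * f x) k"
      by (intro ft_add integrable_mult_right int)
    also have "\<dots> = (cis (h n * (k \<bullet> b)) - 1) * ft f k"
      unfolding shift ft_cmult by (simp add: left_diff_distrib)
    finally have "ft (\<lambda>x. f (x + h n *\<^sub>R b) + (- 1) * f x) k = (cis (h n * (k \<bullet> b)) - 1) * ft f k" .
    then show ?thesis
      using ft_cmult[of "of_real (inverse (h n))" "\<lambda>x. f (x + h n *\<^sub>R b) + (- 1) * f x" k]
      by (simp add: scaleR_conv_of_real)
  qed
  moreover have "(\<lambda>n. (cis (h n * (k \<bullet> b)) - 1) /\<^sub>R h n * ft f k) \<longlonglongrightarrow> \<i> * of_real (k \<bullet> b) * ft f k"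
  proof (intro tendsto_mult tendsto_const)
    let ?t = "k \<bullet> b"
    have "norm ((cis (h n * ?t) - 1) /\<^sub>R h n - \<i> * of_real ?t) \<le> h n * ?t\<^sup>2" for n
    proof -
      have "(cis (h n * ?t) - 1) /\<^sub>R h n - \<i> * of_real ?t = (cis (h n * ?t) - 1 - \<i> * of_real (h n * ?t)) /\<^sub>R h n"
        using h[of n] by (simp add: scaleR_conv_of_real field_simps)
      also have "norm \<dots> = norm (cis (h n * ?t) - 1 - \<i> * of_real (h n * ?t)) / h n"
        using h(1)[of n] by (simp only: norm_scaleR abs_inverse divide_inverse mult.commute abs_of_pos)
      also have "\<dots> \<le> (h n * ?t)\<^sup>2 / h n"
        using h(1)[of n] by (intro divide_right_mono norm_cis_minus_linear) simp
      finally show ?thesis using h(1)[of n] by (simp add: power2_eq_square mult_ac)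
    qed
    then have "(\<lambda>n. (cis (h n * ?t) - 1) /\<^sub>R h n - \<i> * of_real ?t) \<longlonglongrightarrow> 0"
      by (intro Lim_null_comparison[OF always_eventually[OF allI] tendsto_mult_left_zero[OF h0]])
    then show "(\<lambda>n. (cis (h n * ?t) - 1) /\<^sub>R h n) \<longlonglongrightarrow> \<i> * of_real ?t"
      by (rule LIM_zero_cancel)
  qed
  ultimately show ?thesis using LIMSEQ_unique by auto
qed

text \<open>Each factor \<open>k \<bullet> b\<close> is absorbed into a derivative of \<open>f\<close>, and transforms are bounded.\<close>

lemma ft_rapid_decay:
  fixes f :: "'a::euclidean_space \<Rightarrow> complex"
  assumes "schwartz f"
  shows "\<exists>C. \<forall>k. norm k ^ j * norm (ft f k) \<le> C"
  using assms
proof (induction j arbitrary: f)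
  case 0
  then show ?case using norm_ft_le by auto
next
  case (Suc j)
  then have "\<exists>C. \<forall>k. norm k ^ j * norm (ft (pd b f) k) \<le> C" if "b \<in> Basis" for b
    using that schwartz_pd by blast
  then obtain C where C: "\<And>b k. b \<in> Basis \<Longrightarrow> norm k ^ j * norm (ft (pd b f) k) \<le> C b"
    by metis
  have "norm k ^ Suc j * norm (ft f k) \<le> (\<Sum>b\<in>Basis. C b)" for k
  proof -
    have "norm k ^ Suc j * norm (ft f k) \<le> (\<Sum>b\<in>Basis. \<bar>k \<bullet> b\<bar>) * (norm k ^ j * norm (ft f k))"
      using mult_right_mono[OF norm_le_l1[of k], of "norm k ^ j * norm (ft f k)"] by (simp add: mult.assoc)
    also have "\<dots> = (\<Sum>b\<in>Basis. norm k ^ j * norm (ft (pd b f) k))"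
      unfolding sum_distrib_right
      by (intro sum.cong) (auto simp: ft_pd[OF Suc.prems] norm_mult)
    also have "\<dots> \<le> (\<Sum>b\<in>Basis. C b)" by (intro sum_mono C)
    finally show ?thesis .
  qed
  then show ?case by blast
qed

lemma schwartz_ft:
  fixes f :: "'a::euclidean_space \<Rightarrow> complex"
  assumes "schwartz f"
  shows "schwartz (ft f)"
proof (rule schwartz_coinduct[where S = "{ft f | f. schwartz f}"], goal_cases)
  case 1 then show ?case using assms by blast
next
  case 2 then show ?case using ft_has_derivative differentiableI by blast
next
  case (3 h b)
  then obtain f where h: "h = ft f" and f: "schwartz f" by blast
  have "pd b h = ft (\<lambda>x. - \<i> * (of_real (x \<bullet> b) * f x))"
    unfolding h by (intro ext) (rule pd_eq[OF ft_has_derivative[OF f]])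
  moreover have "schwartz (\<lambda>x. - \<i> * (of_real (x \<bullet> b) * f x))"
    by (intro schwartz_cmult schwartz_mult_coordinate f)
  ultimately show ?case by blast
next
  case (4 h k)
  then obtain f where h: "h = ft f" and f: "schwartz f" by blast
  show ?case using ft_rapid_decay[OF f, of k] unfolding bounded_range_iff h by simp
qed

section \<open>Gaussian regularisation: inversion and the bound in the mean square\<close>

definition gauss :: "'a::euclidean_space \<Rightarrow> real" where
  "gauss x = exp (- ((norm x)\<^sup>2 / 2))"

lemma measurable_gauss [measurable]: "gauss \<in> borel_measurable borel"
  unfolding gauss_def[abs_def] by measurable

lemma gauss_pos: "0 < gauss x" and gauss_le_1: "gauss x \<le> 1"
  by (auto simp: gauss_def)

lemma ft_gauss_real:
  "integrable lborel (\<lambda>x::real. cis (- (x * t)) * of_real (exp (- (x\<^sup>2 / 2))))"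
  "(LINT x::real|lborel. cis (- (x * t)) * of_real (exp (- (x\<^sup>2 / 2)))) = of_real (sqrt (2 * pi) * exp (- (t\<^sup>2 / 2)))"
proof -
  have eq: "cis (- (x * t)) * of_real (exp (- (x\<^sup>2 / 2))) =
      of_real (sqrt (2 * pi)) * (std_normal_density x *\<^sub>R cis (- t * x))" for x
    by (simp add: std_normal_density_def scaleR_conv_of_real algebra_simps)
  have "integrable lborel (\<lambda>x. cis (- t * x) * complex_of_real (std_normal_density x))"
    by (rule integrable_bounded_mult[where B = 1]) auto
  then have i: "integrable lborel (\<lambda>x. std_normal_density x *\<^sub>R cis (- t * x))"
    by (simp add: scaleR_conv_of_real mult.commute)
  then show "integrable lborel (\<lambda>x::real. cis (- (x * t)) * of_real (exp (- (x\<^sup>2 / 2))))"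
    unfolding eq by (rule integrable_mult_right)
  have "(LINT x|lborel. std_normal_density x *\<^sub>R cis (- t * x)) = char std_normal_distribution (- t)"
    unfolding char_def by (subst integral_density) (auto simp: cis_conv_exp)
  then show "(LINT x::real|lborel. cis (- (x * t)) * of_real (exp (- (x\<^sup>2 / 2)))) = of_real (sqrt (2 * pi) * exp (- (t\<^sup>2 / 2)))"
    unfolding eq integral_mult_right_zero by (simp add: char_std_normal_distribution)
qed

lemma cis_sum: "finite A \<Longrightarrow> cis (\<Sum>i\<in>A. f i) = (\<Prod>i\<in>A. cis (f i))"
  by (induction A rule: finite_induct) (simp_all add: cis_mult[symmetric])

lemma
  fixes w :: "'a::euclidean_space"
  shows integrable_cis_gauss: "integrable lborel (\<lambda>x. cis (- (x \<bullet> w)) * of_real (gauss x))"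
    and ft_gauss: "ft (\<lambda>x. of_real (gauss x)) w = of_real (sqrt (2 * pi) ^ DIM('a) * gauss w)"
proof -
  have sq: "(norm x)\<^sup>2 / 2 = (\<Sum>b\<in>Basis. (x \<bullet> b)\<^sup>2 / 2)" for x :: 'a
    unfolding power2_norm_eq_inner
    by (subst euclidean_inner) (simp only: power2_eq_square sum_divide_distrib)
  have g: "gauss x = (\<Prod>b\<in>Basis. exp (- ((x \<bullet> b)\<^sup>2 / 2)))" for x :: 'a
    unfolding gauss_def sq sum_negf[symmetric] by (simp add: exp_sum)
  have eq: "cis (- (x \<bullet> w)) * of_real (gauss x) =
      (\<Prod>b\<in>Basis. cis (- ((x \<bullet> b) * (w \<bullet> b))) * of_real (exp (- ((x \<bullet> b)\<^sup>2 / 2))))" for x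
    unfolding prod.distrib g of_real_prod
    by (subst euclidean_inner) (simp add: cis_sum[symmetric] sum_negf)
  show "integrable lborel (\<lambda>x. cis (- (x \<bullet> w)) * of_real (gauss x))"
    unfolding eq by (rule integrable_prod_Basis[where f = "\<lambda>b x. cis (- (x * (w \<bullet> b))) * of_real (exp (- (x\<^sup>2 / 2)))"])
      (rule ft_gauss_real)
  show "ft (\<lambda>x. of_real (gauss x)) w = of_real (sqrt (2 * pi) ^ DIM('a) * gauss w)"
    unfolding ft_def eq
    by (subst integral_prod_Basis[where f = "\<lambda>b x. cis (- (x * (w \<bullet> b))) * of_real (exp (- (x\<^sup>2 / 2)))"])
       (simp_all only: ft_gauss_real g of_real_prod[symmetric] prod.distrib prod_constant)
qed

lemma integrable_gauss: "integrable lborel (\<lambda>x::'a::euclidean_space. gauss x)"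
  using integrable_norm[OF integrable_cis_gauss[of "0::'a"]] by (simp add: less_imp_le[OF gauss_pos])

lemma
  fixes f :: "'a::euclidean_space \<Rightarrow> 'b::{banach, second_countable_topology}"
  assumes [measurable]: "f \<in> borel_measurable borel" and c: "c \<noteq> 0"
  shows integral_lborel_scaleR: "(LINT x|lborel. f x) = \<bar>c\<bar> ^ DIM('a) *\<^sub>R (LINT x|lborel. f (c *\<^sub>R x))"
    and integrable_lborel_scaleR: "integrable lborel f \<Longrightarrow> integrable lborel (\<lambda>x. f (c *\<^sub>R x))"
proof -
  have lb: "(lborel :: 'a measure) = density (distr lborel borel (\<lambda>x. c *\<^sub>R x)) (\<lambda>_. ennreal (\<bar>c\<bar> ^ DIM('a)))"
    using lborel_affine[OF c, of "0::'a"] by simp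
  show "(LINT x|lborel. f x) = \<bar>c\<bar> ^ DIM('a) *\<^sub>R (LINT x|lborel. f (c *\<^sub>R x))"
    by (subst lb) (subst integral_density; simp add: integral_distr)
  assume f: "integrable lborel f"
  let ?k = "\<bar>c\<bar> ^ DIM('a)"
  have "integrable (density (distr lborel borel (\<lambda>x. c *\<^sub>R x)) (\<lambda>_. ennreal ?k)) f"
    by (subst lb[symmetric]) (rule f)
  then have "integrable lborel (\<lambda>x. ?k *\<^sub>R f (c *\<^sub>R x))"
    by (subst (asm) integrable_density) (auto simp: integrable_distr_eq)
  then have "integrable lborel (\<lambda>x. inverse ?k *\<^sub>R (?k *\<^sub>R f (c *\<^sub>R x)))"
    by (rule integrable_scaleR_right)
  then show "integrable lborel (\<lambda>x. f (c *\<^sub>R x))" using c by simp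
qed

lemma integrable_gauss_scaled:
  assumes "0 < e"
  shows "integrable lborel (\<lambda>k::'a::euclidean_space. complex_of_real (gauss (e *\<^sub>R k)))"
  unfolding complex_of_real_integrable_eq
  by (rule integrable_lborel_scaleR[OF measurable_gauss _ integrable_gauss]) (use assms in simp)

text \<open>
  The transform of the wide Gaussian \<open>gauss (e k)\<close>. As \<open>e\<close> tends to zero it concentrates at the
  origin, with total mass \<open>(2 \<pi>)\<close> to the dimension.
\<close>

definition mollifier :: "real \<Rightarrow> 'a::euclidean_space \<Rightarrow> real" where
  "mollifier e w = (sqrt (2 * pi) / e) ^ DIM('a) * gauss (w /\<^sub>R e)"

lemma measurable_mollifier [measurable]: "mollifier e \<in> borel_measurable borel"
  unfolding mollifier_def[abs_def] by measurable

lemma mollifier_nonneg: "0 < e \<Longrightarrow> 0 \<le> mollifier e w"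
  using gauss_pos[of "w /\<^sub>R e"] by (simp add: mollifier_def)

lemma integral_cis_gauss_scaled:
  fixes w :: "'a::euclidean_space"
  assumes e: "0 < e"
  shows "(LINT k|lborel. cis (w \<bullet> k) * of_real (gauss (e *\<^sub>R k))) = of_real (mollifier e w)"
proof -
  have "ft (\<lambda>x. of_real (gauss x)) (- w /\<^sub>R e) =
      e ^ DIM('a) *\<^sub>R (LINT k|lborel. cis (w \<bullet> k) * of_real (gauss (e *\<^sub>R k)))"
    unfolding ft_def
    by (subst integral_lborel_scaleR[of _ e]) (use e in \<open>auto simp: inner_commute mult.assoc[symmetric]\<close>)
  then have "(LINT k|lborel. cis (w \<bullet> k) * of_real (gauss (e *\<^sub>R k))) =
      of_real (sqrt (2 * pi) ^ DIM('a) * gauss (- w /\<^sub>R e)) /\<^sub>R e ^ DIM('a)"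
    using e by (simp add: ft_gauss)
  then show ?thesis
    using e by (simp add: mollifier_def gauss_def scaleR_conv_of_real power_divide field_simps)
qed

lemma integral_gauss: "(LINT x::'a::euclidean_space|lborel. gauss x) = sqrt (2 * pi) ^ DIM('a)"
proof -
  have "complex_of_real (LINT x::'a|lborel. gauss x) = of_real (sqrt (2 * pi) ^ DIM('a))"
    using ft_gauss[of "0::'a"] by (simp add: ft_def gauss_def[of "0::'a"] del: of_real_power)
  then show ?thesis by (simp only: of_real_eq_iff)
qed

lemma nn_integral_mollifier:
  assumes e: "0 < e"
  shows "(\<integral>\<^sup>+w. ennreal (mollifier e (w - a :: 'a::euclidean_space)) \<partial>lborel) = ennreal ((2 * pi) ^ DIM('a))"
proof -
  have "(\<integral>\<^sup>+w. ennreal (mollifier e (w - a)) \<partial>lborel) =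
      (\<integral>\<^sup>+w. ennreal (mollifier e w) \<partial>distr lborel borel ((+) (- a)))"
    by (subst nn_integral_distr) auto
  also have "\<dots> = (\<integral>\<^sup>+w. ennreal (mollifier e (w :: 'a)) \<partial>(density (distr lborel borel (\<lambda>x. 0 + e *\<^sub>R x)) (\<lambda>_. ennreal (\<bar>e\<bar> ^ DIM('a)))))"
    unfolding lborel_distr_plus by (subst lborel_affine[of e 0]) (use e in auto)
  also have "\<dots> = ennreal (e ^ DIM('a)) * (\<integral>\<^sup>+w. ennreal ((sqrt (2 * pi) / e) ^ DIM('a)) * ennreal (gauss (w :: 'a)) \<partial>lborel)"
    using e by (simp add: nn_integral_density nn_integral_distr nn_integral_cmult mollifier_def ennreal_mult' less_imp_le[OF gauss_pos] mult_ac)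
  also have "\<dots> = ennreal (e ^ DIM('a)) * (ennreal ((sqrt (2 * pi) / e) ^ DIM('a)) * ennreal (sqrt (2 * pi) ^ DIM('a)))"
    by (simp add: nn_integral_cmult nn_integral_eq_integral[OF integrable_gauss] integral_gauss less_imp_le[OF gauss_pos])
  also have "\<dots> = ennreal (e ^ DIM('a) * ((sqrt (2 * pi) / e) ^ DIM('a) * sqrt (2 * pi) ^ DIM('a)))"
    using e by (simp add: ennreal_mult')
  also have "e ^ DIM('a) * ((sqrt (2 * pi) / e) ^ DIM('a) * sqrt (2 * pi) ^ DIM('a)) = (2 * pi) ^ DIM('a)"
  proof -
    have "e * (sqrt (2 * pi) / e * sqrt (2 * pi)) = 2 * pi" using e by simp
    then show ?thesis by (simp only: power_mult_distrib[symmetric])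
  qed
  finally show ?thesis .
qed

text \<open>The kernels \<open>c\<close> of interest are plane waves; the integrability of \<open>f x * g y\<close> justifies the exchange.\<close>

lemma Fubini_bounded_kernel:
  fixes f :: "'a::euclidean_space \<Rightarrow> complex" and g :: "'b::euclidean_space \<Rightarrow> complex"
  assumes f: "integrable lborel f" and g: "integrable lborel g"
    and c [measurable]: "c \<in> borel_measurable borel" and c1: "\<And>p. norm (c p) \<le> 1"
  shows "(LINT x|lborel. f x * (LINT y|lborel. c (x, y) * g y)) =
    (LINT y|lborel. g y * (LINT x|lborel. c (x, y) * f x))"
proof -
  note [measurable] = borel_measurable_integrable[OF f] borel_measurable_integrable[OF g]
  have [measurable]: "c \<in> borel_measurable (lborel \<Otimes>\<^sub>M lborel)"
    using c by (simp add: lborel_prod)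
  have "integrable (lborel \<Otimes>\<^sub>M lborel) (\<lambda>(x, y). norm (f x) * norm (g y))"
    by (rule lborel_pair.Fubini_integrable) (use f g in auto)
  then have int: "integrable (lborel \<Otimes>\<^sub>M lborel) (\<lambda>(x, y). f x * (c (x, y) * g y))"
  proof (rule Bochner_Integration.integrable_bound)
    have "norm (f x * (c (x, y) * g y)) \<le> norm (f x) * norm (g y)" for x y
      using mult_left_mono[OF mult_right_mono[OF c1[of "(x, y)"], of "norm (g y)"], of "norm (f x)"]
      by (simp add: norm_mult)
    then show "AE p in lborel \<Otimes>\<^sub>M lborel. norm (case p of (x, y) \<Rightarrow> f x * (c (x, y) * g y)) \<le>
        norm (case p of (x, y) \<Rightarrow> norm (f x) * norm (g y))"
      by auto
  qed measurable
  have "(LINT x|lborel. f x * (LINT y|lborel. c (x, y) * g y)) = (LINT x|lborel. (LINT y|lborel. f x * (c (x, y) * g y)))"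
    by simp
  also have "\<dots> = (LINT y|lborel. (LINT x|lborel. f x * (c (x, y) * g y)))"
    using lborel_pair.Fubini_integral[of "\<lambda>x y. f x * (c (x, y) * g y)"] int by simp
  also have "\<dots> = (LINT y|lborel. (LINT x|lborel. g y * (c (x, y) * f x)))"
    by (simp add: mult_ac)
  finally show ?thesis by simp
qed

lemma gauss_scaled_tendsto_1: "(\<lambda>n. gauss (inverse (real (Suc n)) *\<^sub>R k)) \<longlonglongrightarrow> 1"
proof -
  have "isCont (\<lambda>e. gauss (e *\<^sub>R k)) 0" unfolding gauss_def by (intro continuous_intros) auto
  then have "(\<lambda>n. gauss (inverse (real (Suc n)) *\<^sub>R k)) \<longlonglongrightarrow> gauss (0 *\<^sub>R k)"
    by (rule isCont_tendsto_compose[OF _ LIMSEQ_inverse_real_of_nat])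
  then show ?thesis by (simp add: gauss_def)
qed

text \<open>
  After insertion of \<open>gauss (e k)\<close> the inversion integral is the mean of \<open>f\<close> around \<open>x\<close> with the
  weight \<open>mollifier e\<close>; then \<open>e\<close> tends to zero on both sides.
\<close>

theorem ft_inversion:
  fixes f :: "'a::euclidean_space \<Rightarrow> complex"
  assumes f: "schwartz f"
  shows "(LINT k|lborel. cis (x \<bullet> k) * ft f k) = (2 * pi) ^ DIM('a) * f x"
proof -
  note [measurable] = schwartz_measurable[OF f]
  define e where "e n = inverse (real (Suc n))" for n
  have e: "0 < e n" for n by (simp add: e_def)
  have int_ft: "integrable lborel (ft f)" by (intro schwartz_integrable schwartz_ft f)
  let ?A = "\<lambda>n. LINT k|lborel. (cis (x \<bullet> k) * ft f k) * of_real (gauss (e n *\<^sub>R k))"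
  have "?A \<longlonglongrightarrow> (LINT k|lborel. (cis (x \<bullet> k) * ft f k) * of_real 1)"
  proof (rule integral_dominated_convergence[where w = "\<lambda>k. norm (ft f k)"])
    show "AE k in lborel. (\<lambda>n. (cis (x \<bullet> k) * ft f k) * of_real (gauss (e n *\<^sub>R k))) \<longlonglongrightarrow>
        (cis (x \<bullet> k) * ft f k) * of_real 1"
      unfolding e_def by (intro always_eventually allI tendsto_intros gauss_scaled_tendsto_1)
    show "AE k in lborel. norm ((cis (x \<bullet> k) * ft f k) * of_real (gauss (e n *\<^sub>R k))) \<le> norm (ft f k)" for n
      by (intro always_eventually allI) (simp add: norm_mult abs_of_pos gauss_pos mult_left_le gauss_le_1)
  qed (use int_ft in auto)
  moreover have "?A n = sqrt (2 * pi) ^ DIM('a) * (LINT z|lborel. of_real (gauss z) * f (x + e n *\<^sub>R z))" for n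
  proof -
    have ig: "integrable lborel (\<lambda>k::'a. complex_of_real (gauss (e n *\<^sub>R k)))"
      using e by (rule integrable_gauss_scaled)
    have "?A n = (LINT k|lborel. of_real (gauss (e n *\<^sub>R k)) * (LINT y|lborel. cis ((x - y) \<bullet> k) * f y))"
      unfolding ft_def
      by (intro Bochner_Integration.integral_cong refl, subst integral_mult_right_zero[symmetric])
         (simp add: mult_ac cis_mult inner_diff_left mult.assoc[symmetric])
    also have "\<dots> = (LINT y|lborel. f y * (LINT k|lborel. cis ((x - y) \<bullet> k) * of_real (gauss (e n *\<^sub>R k))))"
      by (rule Fubini_bounded_kernel[where c = "\<lambda>p. cis ((x - fst p) \<bullet> snd p)", symmetric, simplified])
         (use ig f schwartz_integrable in auto)
    also have "\<dots> = (LINT y|lborel. f y * of_real (mollifier (e n) (x - y)))"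
      by (simp add: integral_cis_gauss_scaled[OF e])
    also have "\<dots> = (LINT y|distr lborel borel ((+) x). f y * of_real (mollifier (e n) (x - y)))"
      by (simp add: lborel_distr_plus)
    also have "\<dots> = (LINT y|lborel. f (x + y) * of_real (mollifier (e n) y))"
      by (subst integral_distr) (auto simp: mollifier_def gauss_def)
    also have "\<dots> = e n ^ DIM('a) *\<^sub>R (LINT z|lborel. f (x + e n *\<^sub>R z) * of_real (mollifier (e n) (e n *\<^sub>R z)))"
      by (subst integral_lborel_scaleR[of _ "e n"]) (use e[of n] in auto)
    also have "\<dots> = (LINT z|lborel. sqrt (2 * pi) ^ DIM('a) * (of_real (gauss z) * f (x + e n *\<^sub>R z)))"
      unfolding integral_scaleR_right[symmetric]
      by (intro Bochner_Integration.integral_cong refl) (use e[of n] in \<open>simp add: mollifier_def scaleR_conv_of_real power_divide\<close>)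
    finally show ?thesis by simp
  qed
  moreover have "(\<lambda>n. LINT z|lborel. of_real (gauss z) * f (x + e n *\<^sub>R z)) \<longlonglongrightarrow>
      (LINT z::'a|lborel. of_real (gauss z) * f x)"
  proof -
    obtain B where B: "\<And>x. norm (f x) \<le> B"
      using schwartz_bound[OF f, of 0] by auto
    show ?thesis
    proof (rule integral_dominated_convergence[where w = "\<lambda>z. gauss z * B"])
      show "integrable lborel (\<lambda>z::'a. gauss z * B)" by (intro integrable_mult_left integrable_gauss)
      show "AE z in lborel. norm (of_real (gauss z) * f (x + e n *\<^sub>R z)) \<le> gauss z * B" for n
        by (intro always_eventually allI)
           (simp add: norm_mult abs_of_pos gauss_pos mult_left_mono B less_imp_le)
      show "AE z in lborel. (\<lambda>n. of_real (gauss z) * f (x + e n *\<^sub>R z)) \<longlonglongrightarrow> of_real (gauss z) * f x"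
      proof (intro always_eventually allI tendsto_mult tendsto_const)
        fix z
        have "isCont f (x + 0 *\<^sub>R z)"
          using schwartz_differentiable[OF f] by (rule differentiable_imp_continuous_within)
        moreover have "(\<lambda>n. x + e n *\<^sub>R z) \<longlonglongrightarrow> x + 0 *\<^sub>R z"
          unfolding e_def by (intro tendsto_intros LIMSEQ_inverse_real_of_nat)
        ultimately have "(\<lambda>n. f (x + e n *\<^sub>R z)) \<longlonglongrightarrow> f (x + 0 *\<^sub>R z)"
          by (rule isCont_tendsto_compose)
        then show "(\<lambda>n. f (x + e n *\<^sub>R z)) \<longlonglongrightarrow> f x" by simp
      qed
    qed auto
  qed
  ultimately have "(LINT k|lborel. (cis (x \<bullet> k) * ft f k) * of_real 1) =
      sqrt (2 * pi) ^ DIM('a) * (LINT z::'a|lborel. of_real (gauss z) * f x)"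
    using LIMSEQ_unique[OF _ tendsto_mult[OF tendsto_const]] by (simp add: LIMSEQ_unique)
  also have "(LINT z::'a|lborel. of_real (gauss z) * f x) = of_real (sqrt (2 * pi) ^ DIM('a)) * f x"
    by (simp add: integral_gauss[symmetric] del: of_real_power)
  also have "of_real (sqrt (2 * pi) ^ DIM('a)) * (of_real (sqrt (2 * pi) ^ DIM('a)) * f x) = of_real ((2 * pi) ^ DIM('a)) * f x"
  proof -
    have "sqrt (2 * pi) ^ DIM('a) * sqrt (2 * pi) ^ DIM('a) = (2 * pi) ^ DIM('a)"
      by (simp only: power_mult_distrib[symmetric] real_sqrt_mult_self) simp
    then show ?thesis by (simp only: mult.assoc[symmetric] of_real_mult[symmetric])
  qed
  finally show ?thesis by simp
qed

lemma norm_integral_le_nn_integral: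
  fixes f :: "'a \<Rightarrow> complex"
  shows "ennreal (norm (integral\<^sup>L M f)) \<le> (\<integral>\<^sup>+x. ennreal (norm (f x)) \<partial>M)"
  by (cases "integrable M f") (auto simp: integral_norm_bound_ennreal not_integrable_integral_eq)

text \<open>
  The inequality half of the Plancherel theorem. With the weight \<open>gauss (e k)\<close> the left side is a
  double integral of \<open>h x * cnj (h y)\<close> against \<open>mollifier e (y - x)\<close>, of total mass
  \<open>(2 \<pi>)\<close> to the dimension in either variable.
\<close>

lemma ft_L2_bound_regularised:
  fixes h :: "'a::euclidean_space \<Rightarrow> complex"
  assumes h: "integrable lborel h" and e: "0 < e"
  shows "(\<integral>\<^sup>+k. ennreal (gauss (e *\<^sub>R k) * (norm (ft h k))\<^sup>2) \<partial>lborel) \<le>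
    ennreal ((2 * pi) ^ DIM('a)) * (\<integral>\<^sup>+x. ennreal ((norm (h x))\<^sup>2) \<partial>lborel)"
proof -
  let ?C = "ennreal ((2 * pi) ^ DIM('a))"
  let ?g = "\<lambda>k::'a. complex_of_real (gauss (e *\<^sub>R k))"
  let ?m = "\<lambda>y x. mollifier e (y - x :: 'a)"
  note [measurable] = borel_measurable_integrable[OF h, simplified]
  have ig: "integrable lborel ?g" using e by (rule integrable_gauss_scaled)
  have ifg: "integrable lborel (\<lambda>k. cnj (ft h k) * ?g k)"
    using norm_ft_le[of h] by (intro integrable_bounded_mult[OF ig]) auto
  have "integrable lborel (\<lambda>k. ft h k * (cnj (ft h k) * ?g k))"
    using norm_ft_le[of h] by (intro integrable_bounded_mult[OF ifg]) auto
  also have "(\<lambda>k. ft h k * (cnj (ft h k) * ?g k)) = (\<lambda>k. complex_of_real (gauss (e *\<^sub>R k) * (norm (ft h k))\<^sup>2))"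
    by (simp only: of_real_mult complex_norm_square mult_ac)
  finally have int: "integrable lborel (\<lambda>k. gauss (e *\<^sub>R k) * (norm (ft h k))\<^sup>2)"
    by (simp only: complex_of_real_integrable_eq)
  have inner: "(LINT k|lborel. cis (- (x \<bullet> k)) * (cnj (ft h k) * ?g k)) =
      (LINT y|lborel. cnj (h y) * of_real (?m y x))" for x
  proof -
    have "(LINT k|lborel. cis (- (x \<bullet> k)) * (cnj (ft h k) * ?g k)) =
        (LINT k|lborel. ?g k * (LINT y|lborel. cis ((y - x) \<bullet> k) * cnj (h y)))"
    proof (intro Bochner_Integration.integral_cong refl)
      fix k
      have "cnj (ft h k) = (LINT y|lborel. cis (y \<bullet> k) * cnj (h y))"
        unfolding ft_def by (subst Bochner_Integration.integral_cnj[symmetric]) (simp add: cis_cnj)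
      then have "cis (- (x \<bullet> k)) * cnj (ft h k) = (LINT y|lborel. cis (- (x \<bullet> k)) * (cis (y \<bullet> k) * cnj (h y)))"
        by simp
      also have "\<dots> = (LINT y|lborel. cis ((y - x) \<bullet> k) * cnj (h y))"
        by (intro Bochner_Integration.integral_cong refl)
           (simp add: mult.assoc[symmetric] cis_mult inner_diff_left)
      finally show "cis (- (x \<bullet> k)) * (cnj (ft h k) * ?g k) =
          ?g k * (LINT y|lborel. cis ((y - x) \<bullet> k) * cnj (h y))"
        by (simp add: mult_ac)
    qed
    also have "\<dots> = (LINT y|lborel. cnj (h y) * (LINT k|lborel. cis ((y - x) \<bullet> k) * ?g k))"
      by (rule Fubini_bounded_kernel[where c = "\<lambda>p. cis ((fst p - x) \<bullet> snd p)", symmetric, simplified])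
         (use ig h in auto)
    finally show ?thesis by (simp add: integral_cis_gauss_scaled[OF e])
  qed
  have "complex_of_real (LINT k|lborel. gauss (e *\<^sub>R k) * (norm (ft h k))\<^sup>2) =
      (LINT k|lborel. complex_of_real (gauss (e *\<^sub>R k) * (norm (ft h k))\<^sup>2))"
    by (rule integral_complex_of_real[symmetric])
  also have "\<dots> = (LINT k|lborel. (cnj (ft h k) * ?g k) * (LINT x|lborel. cis (- (x \<bullet> k)) * h x))"
    unfolding ft_def[symmetric] by (simp only: of_real_mult complex_norm_square mult_ac)
  also have "\<dots> = (LINT x|lborel. h x * (LINT k|lborel. cis (- (x \<bullet> k)) * (cnj (ft h k) * ?g k)))"
    by (rule Fubini_bounded_kernel[where c = "\<lambda>p. cis (- (fst p \<bullet> snd p))", symmetric, simplified])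
       (use ifg h in auto)
  finally have J: "complex_of_real (LINT k|lborel. gauss (e *\<^sub>R k) * (norm (ft h k))\<^sup>2) =
      (LINT x|lborel. h x * (LINT y|lborel. cnj (h y) * of_real (?m y x)))"
    unfolding inner .
  let ?A = "\<integral>\<^sup>+x. ennreal ((norm (h x))\<^sup>2 / 2) \<partial>lborel"
  have "(\<integral>\<^sup>+k. ennreal (gauss (e *\<^sub>R k) * (norm (ft h k))\<^sup>2) \<partial>lborel) =
      ennreal (LINT k|lborel. gauss (e *\<^sub>R k) * (norm (ft h k))\<^sup>2)"
    by (rule nn_integral_eq_integral[OF int]) (simp add: less_imp_le[OF gauss_pos])
  also have "\<dots> \<le> ennreal (norm (complex_of_real (LINT k|lborel. gauss (e *\<^sub>R k) * (norm (ft h k))\<^sup>2)))"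
    unfolding norm_of_real by (intro ennreal_leI) simp
  also have "\<dots> \<le> (\<integral>\<^sup>+x. ennreal (norm (h x * (LINT y|lborel. cnj (h y) * of_real (?m y x)))) \<partial>lborel)"
    unfolding J by (rule norm_integral_le_nn_integral)
  also have "\<dots> \<le> (\<integral>\<^sup>+x. \<integral>\<^sup>+y. ennreal ((norm (h x))\<^sup>2 / 2) * ennreal (?m y x) +
      ennreal ((norm (h y))\<^sup>2 / 2) * ennreal (?m y x) \<partial>lborel \<partial>lborel)"
  proof (intro nn_integral_mono)
    fix x
    have "ennreal (norm (h x * (LINT y|lborel. cnj (h y) * of_real (?m y x)))) \<le>
        ennreal (norm (h x)) * (\<integral>\<^sup>+y. ennreal (norm (cnj (h y) * of_real (?m y x))) \<partial>lborel)"
      unfolding norm_mult[of "h x"] ennreal_mult[OF norm_ge_zero norm_ge_zero]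
      by (intro mult_left_mono norm_integral_le_nn_integral) simp
    also have "\<dots> = (\<integral>\<^sup>+y. ennreal (norm (h x)) * ennreal (norm (cnj (h y) * of_real (?m y x))) \<partial>lborel)"
      by (subst nn_integral_cmult) auto
    also have "\<dots> \<le> (\<integral>\<^sup>+y. ennreal ((norm (h x))\<^sup>2 / 2) * ennreal (?m y x) +
      ennreal ((norm (h y))\<^sup>2 / 2) * ennreal (?m y x) \<partial>lborel)"
    proof (intro nn_integral_mono)
      fix y
      have m: "0 \<le> ?m y x" using mollifier_nonneg[OF e] .
      have "2 * (norm (h x) * norm (h y)) \<le> (norm (h x))\<^sup>2 + (norm (h y))\<^sup>2"
        using sum_squares_bound[of "norm (h x)" "norm (h y)"] by (simp add: mult.assoc)
      then have "norm (h x) * norm (h y) \<le> (norm (h x))\<^sup>2 / 2 + (norm (h y))\<^sup>2 / 2"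
        by simp
      then have "norm (h x) * norm (h y) * ?m y x \<le> ((norm (h x))\<^sup>2 / 2 + (norm (h y))\<^sup>2 / 2) * ?m y x"
        using m by (rule mult_right_mono)
      then show "ennreal (norm (h x)) * ennreal (norm (cnj (h y) * of_real (?m y x))) \<le>
          ennreal ((norm (h x))\<^sup>2 / 2) * ennreal (?m y x) + ennreal ((norm (h y))\<^sup>2 / 2) * ennreal (?m y x)"
        using m by (simp add: norm_mult ennreal_mult[symmetric] ennreal_plus[symmetric] algebra_simps
            del: ennreal_plus)
    qed
    finally show "ennreal (norm (h x * (LINT y|lborel. cnj (h y) * of_real (?m y x)))) \<le>
      (\<integral>\<^sup>+y. ennreal ((norm (h x))\<^sup>2 / 2) * ennreal (?m y x) +
        ennreal ((norm (h y))\<^sup>2 / 2) * ennreal (?m y x) \<partial>lborel)" .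
  qed
  also have "\<dots> = (\<integral>\<^sup>+x. \<integral>\<^sup>+y. ennreal ((norm (h x))\<^sup>2 / 2) * ennreal (?m y x) \<partial>lborel \<partial>lborel) +
      (\<integral>\<^sup>+x. \<integral>\<^sup>+y. ennreal ((norm (h y))\<^sup>2 / 2) * ennreal (?m y x) \<partial>lborel \<partial>lborel)"
    by (simp add: nn_integral_add)
  also have "(\<integral>\<^sup>+x. \<integral>\<^sup>+y. ennreal ((norm (h x))\<^sup>2 / 2) * ennreal (?m y x) \<partial>lborel \<partial>lborel) = ?A * ?C"
    by (simp add: nn_integral_cmult nn_integral_mollifier[OF e] nn_integral_multc del: ennreal_power)
  also have "(\<integral>\<^sup>+x. \<integral>\<^sup>+y. ennreal ((norm (h y))\<^sup>2 / 2) * ennreal (?m y x) \<partial>lborel \<partial>lborel) =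
      (\<integral>\<^sup>+y. \<integral>\<^sup>+x. ennreal ((norm (h y))\<^sup>2 / 2) * ennreal (?m y x) \<partial>lborel \<partial>lborel)"
    by (rule lborel_pair.Fubini') measurable
  also have "\<dots> = (\<integral>\<^sup>+y. \<integral>\<^sup>+x. ennreal ((norm (h y))\<^sup>2 / 2) * ennreal (?m x y) \<partial>lborel \<partial>lborel)"
    by (simp add: mollifier_def gauss_def norm_minus_commute)
  also have "\<dots> = ?A * ?C"
    by (simp add: nn_integral_cmult nn_integral_mollifier[OF e] nn_integral_multc del: ennreal_power)
  also have "?A * ?C + ?A * ?C = ?C * (\<integral>\<^sup>+x. ennreal ((norm (h x))\<^sup>2 / 2) + ennreal ((norm (h x))\<^sup>2 / 2) \<partial>lborel)"
    by (simp add: nn_integral_add distrib_left mult.commute)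
  also have "\<dots> = ?C * (\<integral>\<^sup>+x. ennreal ((norm (h x))\<^sup>2) \<partial>lborel)"
    by (simp add: ennreal_plus[symmetric] del: ennreal_plus)
  finally show ?thesis .
qed

lemma nn_integral_ft_L2_bound:
  fixes h :: "'a::euclidean_space \<Rightarrow> complex"
  assumes h: "integrable lborel h"
  shows "(\<integral>\<^sup>+k. ennreal ((norm (ft h k))\<^sup>2) \<partial>lborel) \<le>
    ennreal ((2 * pi) ^ DIM('a)) * (\<integral>\<^sup>+x. ennreal ((norm (h x))\<^sup>2) \<partial>lborel)" (is "_ \<le> ?R")
proof -
  note [measurable] = borel_measurable_integrable[OF h, simplified]
  define u where "u n k = ennreal (gauss (inverse (real (Suc n)) *\<^sub>R k) * (norm (ft h k))\<^sup>2)" for n k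
  have "(\<lambda>n. u n k) \<longlonglongrightarrow> ennreal (1 * (norm (ft h k))\<^sup>2)" for k
    unfolding u_def by (intro tendsto_ennrealI tendsto_mult tendsto_const gauss_scaled_tendsto_1)
  then have "liminf (\<lambda>n. u n k) = ennreal ((norm (ft h k))\<^sup>2)" for k
    using lim_imp_Liminf[OF sequentially_bot] by fastforce
  then have "(\<integral>\<^sup>+k. ennreal ((norm (ft h k))\<^sup>2) \<partial>lborel) = (\<integral>\<^sup>+k. liminf (\<lambda>n. u n k) \<partial>lborel)"
    by simp
  also have "\<dots> \<le> liminf (\<lambda>n. \<integral>\<^sup>+k. u n k \<partial>lborel)"
    by (rule nn_integral_liminf) (simp add: u_def)
  also have "\<dots> \<le> liminf (\<lambda>n. ?R)"
    unfolding u_def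
    by (intro Liminf_mono always_eventually allI ft_L2_bound_regularised h) simp
  also have "\<dots> = ?R" by (simp add: Liminf_const)
  finally show ?thesis .
qed

lemma
  fixes h :: "'a::euclidean_space \<Rightarrow> complex"
  assumes h: "integrable lborel h" and h2: "integrable lborel (\<lambda>x. (norm (h x))\<^sup>2)"
  shows ft_square_integrable: "integrable lborel (\<lambda>k. (norm (ft h k))\<^sup>2)"
    and ft_L2_bound: "(LINT k|lborel. (norm (ft h k))\<^sup>2) \<le> (2 * pi) ^ DIM('a) * (LINT x|lborel. (norm (h x))\<^sup>2)"
proof -
  note [measurable] = borel_measurable_integrable[OF h, simplified]
  have le: "(\<integral>\<^sup>+k. ennreal ((norm (ft h k))\<^sup>2) \<partial>lborel) \<le>
      ennreal ((2 * pi) ^ DIM('a) * (LINT x|lborel. (norm (h x))\<^sup>2))"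
    using nn_integral_ft_L2_bound[OF h] nn_integral_eq_integral[OF h2]
    by (simp add: ennreal_mult' del: ennreal_power)
  show int: "integrable lborel (\<lambda>k. (norm (ft h k))\<^sup>2)"
    by (rule integrableI_bounded) (use le in \<open>auto intro: le_less_trans\<close>)
  have "ennreal (LINT k|lborel. (norm (ft h k))\<^sup>2) \<le> ennreal ((2 * pi) ^ DIM('a) * (LINT x|lborel. (norm (h x))\<^sup>2))"
    using le nn_integral_eq_integral[OF int] by simp
  then show "(LINT k|lborel. (norm (ft h k))\<^sup>2) \<le> (2 * pi) ^ DIM('a) * (LINT x|lborel. (norm (h x))\<^sup>2)"
    by (subst (asm) ennreal_le_iff) auto
qed

section \<open>One-dimensional substitutions\<close>

lemma absolutely_integrable_on_iff_nn_integral: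
  fixes h :: "real \<Rightarrow> real"
  assumes [measurable]: "h \<in> borel_measurable borel" "S \<in> sets borel"
    and nonneg: "\<And>x. 0 \<le> h x" and b: "0 \<le> b"
  shows "h absolutely_integrable_on S \<and> integral S h = b \<longleftrightarrow>
    (\<integral>\<^sup>+x. ennreal (indicator S x * h x) \<partial>lborel) = ennreal b"
proof -
  have "h absolutely_integrable_on S \<and> integral S h = b \<longleftrightarrow>
      h absolutely_integrable_on S \<and> (LINT x:S|lebesgue. h x) = b"
    by (auto simp: set_lebesgue_integral_eq_integral(2))
  also have "\<dots> \<longleftrightarrow> integrable lborel (\<lambda>x. indicator S x * h x) \<and> (LINT x|lborel. indicator S x * h x) = b"
    by (simp add: set_integrable_def set_lebesgue_integral_def integrable_completion integral_completion)
  also have "\<dots> \<longleftrightarrow> (\<integral>\<^sup>+x. ennreal (indicator S x * h x) \<partial>lborel) = ennreal b"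
    by (rule nn_integral_eq_integrable[symmetric]) (use nonneg b in auto)
  finally show ?thesis .
qed

lemma nn_integral_change_of_variables_real:
  fixes f :: "real \<Rightarrow> ennreal" and g g' :: "real \<Rightarrow> real"
  assumes [measurable]: "f \<in> borel_measurable borel" "g \<in> borel_measurable borel"
      "g' \<in> borel_measurable borel" "S \<in> sets borel" "g ` S \<in> sets borel"
    and der: "\<And>x. x \<in> S \<Longrightarrow> (g has_field_derivative g' x) (at x within S)"
    and inj: "inj_on g S"
  shows "(\<integral>\<^sup>+x. indicator (g ` S) x * f x \<partial>lborel) =
    (\<integral>\<^sup>+x. indicator S x * (ennreal \<bar>g' x\<bar> * f (g x)) \<partial>lborel)"
proof -
  \<comment> \<open>It suffices to compare measures of sets; the finite values of both sides agree by the change of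
    variables for absolutely integrable functions, hence the infinite ones agree, too.\<close>
  have "density lborel (indicator (g ` S)) =
      distr (density lborel (\<lambda>x. indicator S x * ennreal \<bar>g' x\<bar>)) borel g" (is "?M = ?N")
  proof (rule measure_eqI)
    fix A assume "A \<in> sets ?M"
    then have A [measurable]: "A \<in> sets borel" by simp
    let ?X = "\<integral>\<^sup>+x. ennreal (indicator S x * (\<bar>g' x\<bar> * indicator A (g x))) \<partial>lborel"
    let ?Y = "\<integral>\<^sup>+x. ennreal (indicator (g ` S) x * indicator A x) \<partial>lborel"
    have *: "?X = ennreal b \<longleftrightarrow> ?Y = ennreal b" if "0 \<le> b" for b
      using has_absolute_integral_change_of_variables_1'[of S g g' "indicator A" b, OF _ der inj]
      by (subst (1 2) absolutely_integrable_on_iff_nn_integral[symmetric]) (auto simp: that)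
    have "?X = ?Y"
      by (cases ?X rule: ennreal_cases; cases ?Y rule: ennreal_cases) (use * in auto)
    moreover have "emeasure ?N A = ?X"
      by (subst emeasure_distr, simp_all, subst emeasure_density)
         (auto intro!: nn_integral_cong measurable_sets_borel[of g borel] simp: indicator_def)
    moreover have "emeasure ?M A = ?Y"
      by (subst emeasure_density) (auto intro!: nn_integral_cong simp: indicator_def)
    ultimately show "emeasure ?M A = emeasure ?N A" by simp
  qed simp
  then have "(\<integral>\<^sup>+x. f x \<partial>?M) = (\<integral>\<^sup>+x. f x \<partial>?N)" by simp
  then show ?thesis
    by (simp add: nn_integral_density nn_integral_distr mult.assoc)
qed

lemma nn_integral_lborel_scaleR:
  fixes f :: "'a::euclidean_space \<Rightarrow> ennreal"
  assumes [measurable]: "f \<in> borel_measurable borel" and c: "c \<noteq> 0"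
  shows "(\<integral>\<^sup>+x. f x \<partial>lborel) = ennreal (\<bar>c\<bar> ^ DIM('a)) * (\<integral>\<^sup>+x. f (c *\<^sub>R x) \<partial>lborel)"
  by (subst lborel_affine[OF c, of 0])
     (simp add: nn_integral_density nn_integral_distr nn_integral_cmult)

lemma nn_integral_lborel_uminus:
  fixes f :: "'a::euclidean_space \<Rightarrow> ennreal"
  assumes [measurable]: "f \<in> borel_measurable borel"
  shows "(\<integral>\<^sup>+x. f (- x) \<partial>lborel) = (\<integral>\<^sup>+x. f x \<partial>lborel)"
  using nn_integral_lborel_scaleR[OF assms, of "-1"] by simp

lemma pred_mem_greaterThan [measurable]:
  fixes h k :: "'a \<Rightarrow> real"
  assumes [measurable]: "h \<in> borel_measurable M" "k \<in> borel_measurable M"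
  shows "Measurable.pred M (\<lambda>x. h x \<in> {k x<..})"
  unfolding greaterThan_iff by measurable

text \<open>Integration over the line by the distance \<open>r\<close> of the points \<open>(\<plusminus>sqrt (r\<^sup>2 - a\<^sup>2), a)\<close> to the origin.\<close>

lemma nn_integral_radius_substitution:
  fixes h :: "real \<Rightarrow> ennreal"
  assumes [measurable]: "h \<in> borel_measurable borel" and a: "0 \<le> a"
  shows "(\<integral>\<^sup>+r. indicator {a<..} r *
      (ennreal (r / sqrt (r\<^sup>2 - a\<^sup>2)) * (h (sqrt (r\<^sup>2 - a\<^sup>2)) + h (- sqrt (r\<^sup>2 - a\<^sup>2)))) \<partial>lborel) =
    (\<integral>\<^sup>+x. h x \<partial>lborel)" (is "?L = _")
proof -
  let ?g = "\<lambda>r. sqrt (r\<^sup>2 - a\<^sup>2)"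
  have pos: "0 < r\<^sup>2 - a\<^sup>2" if "a < r" for r
    using a that by (simp add: power_strict_mono)
  have im: "?g ` {a<..} = {0<..}"
  proof safe
    fix x :: real assume "0 < x"
    then have "a < sqrt (x\<^sup>2 + a\<^sup>2)" using a by (intro real_less_rsqrt) auto
    moreover have "x = ?g (sqrt (x\<^sup>2 + a\<^sup>2))" using \<open>0 < x\<close> by simp
    ultimately show "x \<in> ?g ` {a<..}" by blast
  qed (use pos in auto)
  have subst: "(\<integral>\<^sup>+x. indicator {0<..} x * k x \<partial>lborel) =
      (\<integral>\<^sup>+r. indicator {a<..} r * (ennreal (r / ?g r) * k (?g r)) \<partial>lborel)"
    if [measurable]: "k \<in> borel_measurable borel" for k :: "real \<Rightarrow> ennreal"
  proof -
    have "(\<integral>\<^sup>+x. indicator (?g ` {a<..}) x * k x \<partial>lborel) =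
        (\<integral>\<^sup>+r. indicator {a<..} r * (ennreal \<bar>r / ?g r\<bar> * k (?g r)) \<partial>lborel)"
    proof (rule nn_integral_change_of_variables_real)
      show "(?g has_field_derivative r / ?g r) (at r within {a<..})" if "r \<in> {a<..}" for r
        using pos[of r] that by (auto intro!: derivative_eq_intros simp: field_simps)
      show "inj_on ?g {a<..}"
        using a by (auto intro!: inj_onI simp: power2_eq_iff_nonneg)
    qed (auto simp: im)
    then show ?thesis
      unfolding im by (simp, intro nn_integral_cong) (use a pos in \<open>auto simp: indicator_def\<close>)
  qed
  have "?L = (\<integral>\<^sup>+x. indicator {0<..} x * (h x + h (- x)) \<partial>lborel)"
    by (subst subst) auto
  also have "\<dots> = (\<integral>\<^sup>+x. indicator {0<..} x * h x \<partial>lborel) + (\<integral>\<^sup>+x. indicator {0<..} x * h (- x) \<partial>lborel)"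
    by (simp add: distrib_left nn_integral_add)
  also have "(\<integral>\<^sup>+x. indicator {0<..} x * h (- x) \<partial>lborel) = (\<integral>\<^sup>+x. indicator {..<0} x * h x \<partial>lborel)"
    by (subst nn_integral_lborel_uminus[symmetric]) (auto intro!: nn_integral_cong simp: indicator_def)
  also have "(\<integral>\<^sup>+x. indicator {0<..} x * h x \<partial>lborel) + \<dots> =
      (\<integral>\<^sup>+x. indicator {0<..} x * h x + indicator {..<0} x * h x \<partial>lborel)"
    by (simp add: nn_integral_add)
  also have "\<dots> = (\<integral>\<^sup>+x. h x \<partial>lborel)"
    by (rule nn_integral_cong_AE, rule AE_mp[OF AE_lborel_singleton[of 0]])
       (auto simp: indicator_def)
  finally show ?thesis .
qed

text \<open>
  The two branches \<open>s = \<plusminus>sqrt (x\<^sup>2 + c)\<close> of the hyperbola \<open>s\<^sup>2 - x\<^sup>2 = c\<close> are parametrised together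
  by \<open>l = s + x \<noteq> 0\<close>, because \<open>s - x = c / l\<close>.
\<close>

lemma nn_integral_hyperbola_substitution:
  fixes h :: "real \<times> real \<Rightarrow> ennreal"
  assumes [measurable]: "h \<in> borel_measurable borel" and c: "c \<noteq> 0"
  shows "(\<integral>\<^sup>+x. indicator {x. 0 < x\<^sup>2 + c} x * (ennreal (1 / sqrt (x\<^sup>2 + c)) *
      (ennreal \<bar>x + sqrt (x\<^sup>2 + c)\<bar> * h (x, sqrt (x\<^sup>2 + c)) +
       ennreal \<bar>x - sqrt (x\<^sup>2 + c)\<bar> * h (x, - sqrt (x\<^sup>2 + c)))) \<partial>lborel) =
    (\<integral>\<^sup>+l. h ((l - c / l) / 2, (l + c / l) / 2) \<partial>lborel)" (is "?L = _")
proof -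
  define S where "S = {x::real. 0 < x\<^sup>2 + c}"
  have [measurable]: "S \<in> sets borel" unfolding S_def by measurable
  have branch: "(\<integral>\<^sup>+x. indicator S x * (ennreal (\<bar>x + e * sqrt (x\<^sup>2 + c)\<bar> / sqrt (x\<^sup>2 + c)) *
        h (x, e * sqrt (x\<^sup>2 + c))) \<partial>lborel) =
      (\<integral>\<^sup>+l. indicator {l. l \<noteq> 0 \<and> 0 < e * (l + c / l)} l * h ((l - c / l) / 2, (l + c / l) / 2) \<partial>lborel)"
    if e: "e = 1 \<or> e = - 1" for e :: real
  proof -
    let ?s = "\<lambda>x. sqrt (x\<^sup>2 + c)"
    let ?g = "\<lambda>x. x + e * ?s x"
    have ee: "e * e = 1" using e by auto
    have s: "0 < ?s x" "?s x * ?s x = x\<^sup>2 + c" if "x \<in> S" for x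
      using that by (auto simp: S_def)
    have prod: "?g x * (e * ?s x - x) = c" if "x \<in> S" for x
    proof -
      have "?g x * (e * ?s x - x) = (e * e) * (?s x * ?s x) - x * x" by (simp add: algebra_simps)
      then show ?thesis using s[OF that] ee by (simp add: power2_eq_square)
    qed
    have g0: "?g x \<noteq> 0" if "x \<in> S" for x
      using prod[OF that] c by auto
    have cg: "c / ?g x = e * ?s x - x" if "x \<in> S" for x
      using prod[OF that] g0[OF that] by (metis nonzero_mult_div_cancel_left)
    have im: "?g ` S = {l. l \<noteq> 0 \<and> 0 < e * (l + c / l)}"
    proof (intro equalityI subsetI)
      fix l assume "l \<in> ?g ` S"
      then obtain x where x: "x \<in> S" "l = ?g x" by blast
      have "e * (l + c / l) = 2 * (e * e) * ?s x"
        unfolding x cg[OF x(1)] by (simp add: algebra_simps)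
      then show "l \<in> {l. l \<noteq> 0 \<and> 0 < e * (l + c / l)}" using s x g0 ee by auto
    next
      fix l assume l: "l \<in> {l. l \<noteq> 0 \<and> 0 < e * (l + c / l)}"
      define x where "x = (l - c / l) / 2"
      have sq: "x\<^sup>2 + c = (e * (l + c / l) / 2)\<^sup>2"
        using l e unfolding x_def by (auto simp: field_simps power2_eq_square)
      then have sx: "?s x = e * (l + c / l) / 2" using l by simp
      have "x \<in> S" unfolding S_def using l by (auto simp: sq)
      moreover have "l = ?g x"
        unfolding sx using e by (auto simp: x_def field_simps)
      ultimately show "l \<in> ?g ` S" by blast
    qed
    have "(\<integral>\<^sup>+l. indicator (?g ` S) l * h ((l - c / l) / 2, (l + c / l) / 2) \<partial>lborel) =
        (\<integral>\<^sup>+x. indicator S x * (ennreal \<bar>1 + e * (x / ?s x)\<bar> *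
          h ((?g x - c / ?g x) / 2, (?g x + c / ?g x) / 2)) \<partial>lborel)"
    proof (rule nn_integral_change_of_variables_real)
      show "(?g has_field_derivative 1 + e * (x / ?s x)) (at x within S)" if "x \<in> S" for x
        using that by (auto intro!: derivative_eq_intros simp: S_def field_simps)
      show "inj_on ?g S"
      proof (rule inj_onI)
        fix x y assume "x \<in> S" "y \<in> S" "?g x = ?g y"
        then show "x = y" using cg[of x] cg[of y] by simp
      qed
    qed (auto simp: im)
    also have "\<dots> = (\<integral>\<^sup>+x. indicator S x * (ennreal (\<bar>x + e * ?s x\<bar> / ?s x) * h (x, e * ?s x)) \<partial>lborel)"
    proof (rule nn_integral_cong)
      fix x :: real
      have "\<bar>1 + e * (x / ?s x)\<bar> = \<bar>x + e * ?s x\<bar> / ?s x" if "x \<in> S"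
      proof -
        have "1 + e * (x / ?s x) = e * ((x + e * ?s x) / ?s x)"
          using s(1)[OF that] by (simp add: distrib_left add_divide_distrib mult.assoc[symmetric] ee)
        then show ?thesis using e s(1)[OF that] by (auto simp: abs_mult)
      qed
      then show "indicator S x * (ennreal \<bar>1 + e * (x / ?s x)\<bar> *
            h ((?g x - c / ?g x) / 2, (?g x + c / ?g x) / 2)) =
          indicator S x * (ennreal (\<bar>x + e * ?s x\<bar> / ?s x) * h (x, e * ?s x))"
        by (cases "x \<in> S") (auto simp: cg)
    qed
    finally show ?thesis unfolding im ..
  qed
  have "?L = (\<integral>\<^sup>+x. indicator S x * (ennreal (\<bar>x + 1 * sqrt (x\<^sup>2 + c)\<bar> / sqrt (x\<^sup>2 + c)) * h (x, 1 * sqrt (x\<^sup>2 + c))) +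
      indicator S x * (ennreal (\<bar>x + (- 1) * sqrt (x\<^sup>2 + c)\<bar> / sqrt (x\<^sup>2 + c)) * h (x, (- 1) * sqrt (x\<^sup>2 + c))) \<partial>lborel)"
  proof (rule nn_integral_cong)
    fix x
    have *: "ennreal (1 / s) * (ennreal \<bar>p\<bar> * A + ennreal \<bar>q\<bar> * B) = ennreal (\<bar>p\<bar> / s) * A + ennreal (\<bar>q\<bar> / s) * B"
      if "0 < s" for s p q :: real and A B
      using that by (simp add: distrib_left mult.assoc[symmetric] ennreal_mult'[symmetric])
    show "indicator {x. 0 < x\<^sup>2 + c} x * (ennreal (1 / sqrt (x\<^sup>2 + c)) *
      (ennreal \<bar>x + sqrt (x\<^sup>2 + c)\<bar> * h (x, sqrt (x\<^sup>2 + c)) +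
       ennreal \<bar>x - sqrt (x\<^sup>2 + c)\<bar> * h (x, - sqrt (x\<^sup>2 + c)))) =
      indicator S x * (ennreal (\<bar>x + 1 * sqrt (x\<^sup>2 + c)\<bar> / sqrt (x\<^sup>2 + c)) * h (x, 1 * sqrt (x\<^sup>2 + c))) +
      indicator S x * (ennreal (\<bar>x + (- 1) * sqrt (x\<^sup>2 + c)\<bar> / sqrt (x\<^sup>2 + c)) * h (x, (- 1) * sqrt (x\<^sup>2 + c)))"
      by (cases "x \<in> S") (auto simp: S_def *)
  qed
  also have "\<dots> = (\<integral>\<^sup>+l. indicator {l. l \<noteq> 0 \<and> 0 < 1 * (l + c / l)} l * h ((l - c / l) / 2, (l + c / l) / 2) \<partial>lborel) +
      (\<integral>\<^sup>+l. indicator {l. l \<noteq> 0 \<and> 0 < (- 1) * (l + c / l)} l * h ((l - c / l) / 2, (l + c / l) / 2) \<partial>lborel)"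
    by (subst branch[symmetric], simp, subst branch[symmetric], simp, subst nn_integral_add) auto
  also have "\<dots> = (\<integral>\<^sup>+l. indicator {l. l \<noteq> 0 \<and> 0 < 1 * (l + c / l)} l * h ((l - c / l) / 2, (l + c / l) / 2) +
      indicator {l. l \<noteq> 0 \<and> 0 < (- 1) * (l + c / l)} l * h ((l - c / l) / 2, (l + c / l) / 2) \<partial>lborel)"
    by (subst nn_integral_add) auto
  also have "\<dots> = (\<integral>\<^sup>+l. h ((l - c / l) / 2, (l + c / l) / 2) \<partial>lborel)"
  proof (rule nn_integral_cong_AE)
    have "finite {0, sqrt (- c), - sqrt (- c)}" by simp
    then have "AE l in lborel. l \<notin> {0, sqrt (- c), - sqrt (- c)}"
      by (intro AE_not_in finite_imp_null_set_lborel)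
    then show "AE l in lborel. indicator {l. l \<noteq> 0 \<and> 0 < 1 * (l + c / l)} l * h ((l - c / l) / 2, (l + c / l) / 2) +
      indicator {l. l \<noteq> 0 \<and> 0 < (- 1) * (l + c / l)} l * h ((l - c / l) / 2, (l + c / l) / 2) =
      h ((l - c / l) / 2, (l + c / l) / 2)"
    proof eventually_elim
      case (elim l)
      have "l + c / l \<noteq> 0"
      proof
        assume "l + c / l = 0"
        then have "l * l = - c" using elim by (simp add: field_simps eq_neg_iff_add_eq_0)
        then have "\<bar>l\<bar> = sqrt (- c)" by (metis real_sqrt_abs2)
        then show False using elim by (auto simp: abs_if split: if_splits)
      qed
      then show ?case using elim by (auto simp: indicator_def not_less)
    qed
  qed
  finally show ?thesis .
qed

section \<open>The surface measure in graph coordinates\<close>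

lemma measurable_sphere_measure_ident: "(\<lambda>x. x) \<in> borel_measurable sphere_measure"
  by (subst measurable_cong_sets[OF sets_sphere_measure refl])
     (auto intro: measurable_restrict_space1)

lemma measurable_sphere_measure:
  "f \<in> borel \<rightarrow>\<^sub>M N \<Longrightarrow> f \<in> sphere_measure \<rightarrow>\<^sub>M N"
  by (rule measurable_compose[OF measurable_sphere_measure_ident])

lemma measurable_snd_sphere_measure [measurable]: "snd \<in> M \<Otimes>\<^sub>M sphere_measure \<rightarrow>\<^sub>M borel"
  by (rule measurable_compose[OF measurable_snd measurable_sphere_measure_ident])

lemma finite_measure_sphere_measure: "finite_measure (sphere_measure :: 'a::euclidean_space measure)"
  by (rule finite_measureI)
     (simp add: space_sphere_measure emeasure_sphere_measure_total del: ennreal_mult_eq_top_iff)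

lemma nn_integral_sphere_measure:
  fixes f :: "'a::euclidean_space \<Rightarrow> ennreal"
  assumes [measurable]: "f \<in> borel_measurable borel"
  shows "(\<integral>\<^sup>+z. f z \<partial>sphere_measure) =
    of_nat DIM('a) * (\<integral>\<^sup>+x. indicator (ball 0 1 - {0}) x * f (sgn x) \<partial>lborel)"
proof -
  have c: "continuous_on (ball 0 1 - {0::'a}) sgn"
    unfolding sgn_div_norm[abs_def] by (intro continuous_intros) auto
  have m: "sgn \<in> restrict_space lborel (ball 0 1 - {0::'a}) \<rightarrow>\<^sub>M restrict_space borel (sphere 0 1)"
  proof (rule measurable_restrict_space2)
    show "sgn \<in> space (restrict_space lborel (ball 0 1 - {0::'a})) \<rightarrow> sphere 0 1"
      by (auto simp: space_restrict_space norm_sgn)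
    show "sgn \<in> borel_measurable (restrict_space lborel (ball 0 1 - {0::'a}))"
      using borel_measurable_continuous_on_restrict[OF c]
      by (simp cong: measurable_cong_sets add: sets_restrict_space)
  qed
  show ?thesis
    unfolding sphere_measure_def
    by (subst nn_integral_scale_measure)
       (auto simp: nn_integral_distr[OF m] measurable_restrict_space1 nn_integral_restrict_space
         mult.commute[of "indicator _ _"])
qed

text \<open>
  The density, with respect to \<open>x\<close>, of the integral of \<open>g\<close> over the sphere of radius \<open>r\<close>, with
  one term for each hemisphere; \<open>r / sqrt (r\<^sup>2 - (norm x)\<^sup>2)\<close> is the area factor of the graph.
\<close>

definition sphere_graph :: "(real \<times> 'v::euclidean_space \<Rightarrow> ennreal) \<Rightarrow> real \<Rightarrow> 'v \<Rightarrow> ennreal" where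
  "sphere_graph g r x =
     (if norm x < r then ennreal (r / sqrt (r\<^sup>2 - (norm x)\<^sup>2)) *
        (g (sqrt (r\<^sup>2 - (norm x)\<^sup>2), x) + g (- sqrt (r\<^sup>2 - (norm x)\<^sup>2), x)) else 0)"

lemma measurable_sphere_graph [measurable]:
  assumes [measurable]: "g \<in> borel_measurable borel"
    and [measurable]: "h \<in> borel_measurable M" "k \<in> borel_measurable M"
  shows "(\<lambda>p. sphere_graph g (h p) (k p)) \<in> borel_measurable M"
  unfolding sphere_graph_def by measurable

lemma sphere_graph_homogeneous:
  assumes r: "0 < r"
  shows "sphere_graph g r (r *\<^sub>R y) = sphere_graph (\<lambda>z. g (r *\<^sub>R z)) 1 y"
proof -
  have "sqrt (r\<^sup>2 - (r * norm y)\<^sup>2) = r * sqrt (1 - (norm y)\<^sup>2)"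
  proof -
    have "r\<^sup>2 - (r * norm y)\<^sup>2 = r\<^sup>2 * (1 - (norm y)\<^sup>2)" by (simp add: power_mult_distrib algebra_simps)
    then show ?thesis using r by (simp add: real_sqrt_mult)
  qed
  then show ?thesis using r by (simp add: sphere_graph_def)
qed

text \<open>
  Both sides are compared after integration over the ball: on the vertical line through \<open>x\<close> the
  distance to the origin is a new variable, and homogeneity splits off the radial integral.
\<close>

lemma nn_integral_unit_sphere_graph:
  fixes f :: "real \<times> 'v::euclidean_space \<Rightarrow> ennreal"
  assumes [measurable]: "f \<in> borel_measurable borel"
  shows "(\<integral>\<^sup>+z. f z \<partial>sphere_measure) = (\<integral>\<^sup>+x. sphere_graph f 1 x \<partial>lborel)"
proof -
  let ?n = "DIM('v)"
  define F where "F z = indicator (ball 0 1 - {0}) z * f (sgn z)" for z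
  have [measurable]: "F \<in> borel_measurable borel"
  proof -
    have [measurable]: "(sgn :: real \<times> 'v \<Rightarrow> _) \<in> borel_measurable borel"
      unfolding sgn_div_norm[abs_def]
      by (intro borel_measurable_scaleR borel_measurable_inverse borel_measurable_norm) auto
    have [measurable]: "ball 0 1 - {0 :: real \<times> 'v} \<in> sets borel" by auto
    show ?thesis unfolding F_def[abs_def] by measurable
  qed
  have polar: "indicator {norm x<..} r * (ennreal (r / sqrt (r\<^sup>2 - (norm x)\<^sup>2)) *
        (F (sqrt (r\<^sup>2 - (norm x)\<^sup>2), x) + F (- sqrt (r\<^sup>2 - (norm x)\<^sup>2), x))) =
      indicator {0<..<1} r * sphere_graph f 1 (x /\<^sub>R r)" for r and x :: 'v
  proof (cases "norm x < r")
    case True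
    then have r: "0 < r" using norm_ge_zero[of x] by linarith
    let ?s = "sqrt (r\<^sup>2 - (norm x)\<^sup>2)"
    have "(norm x)\<^sup>2 < r\<^sup>2" using True by (simp add: power_strict_mono)
    then have "?s\<^sup>2 = r\<^sup>2 - (norm x)\<^sup>2" by simp
    then have n: "norm (?s, x) = r" "norm (- ?s, x) = r" using r by (simp_all add: norm_Pair)
    have "?s = r * sqrt (1 - (norm (x /\<^sub>R r))\<^sup>2)"
    proof -
      have "r\<^sup>2 - (norm x)\<^sup>2 = r\<^sup>2 * (1 - (norm (x /\<^sub>R r))\<^sup>2)"
        using r by (simp add: power_mult_distrib field_simps)
      then show ?thesis using r by (simp add: real_sqrt_mult)
    qed
    then have "?s / r = sqrt (1 - (norm (x /\<^sub>R r))\<^sup>2)" "r / ?s = 1 / sqrt (1 - (norm (x /\<^sub>R r))\<^sup>2)"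
      using r by auto
    moreover have "sgn (?s, x) = (?s / r, x /\<^sub>R r)" "sgn (- ?s, x) = (- (?s / r), x /\<^sub>R r)"
      unfolding sgn_div_norm n by (auto simp: divide_inverse mult.commute)
    moreover have "(?s, x) \<noteq> 0" "(- ?s, x) \<noteq> 0" using n r by (metis norm_zero less_irrefl)+
    moreover have "norm (x /\<^sub>R r) < 1" using True r by (simp add: field_simps)
    ultimately show ?thesis
      using True r n by (simp add: F_def sphere_graph_def indicator_def)
  next
    case False
    then have "r > 0 \<Longrightarrow> \<not> norm (x /\<^sub>R r) < 1" by (simp add: field_simps)
    with False show ?thesis by (auto simp: sphere_graph_def indicator_def)
  qed
  have scale: "(\<integral>\<^sup>+x. sphere_graph f 1 (x /\<^sub>R r) \<partial>lborel) =
      ennreal (r ^ ?n) * (\<integral>\<^sup>+x. sphere_graph f 1 x \<partial>lborel)" if "0 < r" for r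
    using that by (subst nn_integral_lborel_scaleR[of _ r]) auto
  have radial: "(\<integral>\<^sup>+r. indicator {0<..<1::real} r * ennreal (r ^ ?n) \<partial>lborel) = ennreal (1 / Suc ?n)"
  proof -
    have "(\<integral>\<^sup>+r. indicator {0<..<1::real} r * ennreal (r ^ ?n) \<partial>lborel) =
        (\<integral>\<^sup>+r. ennreal (r ^ ?n) * indicator {0..1} r \<partial>lborel)"
      by (rule nn_integral_cong_AE, rule AE_mp[OF AE_lborel_singleton[of 0]], rule AE_mp[OF AE_lborel_singleton[of 1]])
         (auto simp: indicator_def)
    also have "\<dots> = ennreal (1 ^ Suc ?n / Suc ?n - 0 ^ Suc ?n / Suc ?n)"
    proof (rule nn_integral_FTC_Icc)
      show "((\<lambda>r. r ^ Suc ?n / Suc ?n) has_real_derivative r ^ ?n) (at r)" for r :: real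
        using DERIV_cdivide[OF DERIV_pow[of "Suc ?n" r], of "Suc ?n"] by simp
    qed auto
    finally show ?thesis by simp
  qed
  have "(\<integral>\<^sup>+z. F z \<partial>lborel) = (\<integral>\<^sup>+a. \<integral>\<^sup>+x. F (a, x) \<partial>lborel \<partial>lborel)"
    by (rule nn_integral_lborel_pair) simp
  also have "\<dots> = (\<integral>\<^sup>+x. \<integral>\<^sup>+a. F (a, x) \<partial>lborel \<partial>lborel)"
    by (intro lborel_pair.Fubini') measurable
  also have "\<dots> = (\<integral>\<^sup>+x. \<integral>\<^sup>+r. indicator {0<..<1} r * sphere_graph f 1 (x /\<^sub>R r) \<partial>lborel \<partial>lborel)"
  proof (rule nn_integral_cong)
    fix x :: 'v
    show "(\<integral>\<^sup>+a. F (a, x) \<partial>lborel) = (\<integral>\<^sup>+r. indicator {0<..<1} r * sphere_graph f 1 (x /\<^sub>R r) \<partial>lborel)"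
      using nn_integral_radius_substitution[of "\<lambda>a. F (a, x)" "norm x"] by (simp add: polar)
  qed
  also have "\<dots> = (\<integral>\<^sup>+r. \<integral>\<^sup>+x. indicator {0<..<1} r * sphere_graph f 1 (x /\<^sub>R r) \<partial>lborel \<partial>lborel)"
    by (intro lborel_pair.Fubini') measurable
  also have "\<dots> = (\<integral>\<^sup>+r. (indicator {0<..<1} r * ennreal (r ^ ?n)) * (\<integral>\<^sup>+x. sphere_graph f 1 x \<partial>lborel) \<partial>lborel)"
    by (intro nn_integral_cong) (auto simp: nn_integral_cmult scale indicator_def)
  also have "\<dots> = ennreal (1 / Suc ?n) * (\<integral>\<^sup>+x. sphere_graph f 1 x \<partial>lborel)"
    by (subst nn_integral_multc) (auto simp: radial)
  finally have "(\<integral>\<^sup>+z. f z \<partial>sphere_measure) =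
      (of_nat (Suc ?n) * ennreal (1 / Suc ?n)) * (\<integral>\<^sup>+x. sphere_graph f 1 x \<partial>lborel)"
    by (simp add: nn_integral_sphere_measure F_def mult.assoc)
  also have "of_nat (Suc ?n) * ennreal (1 / Suc ?n) = ennreal (real (Suc ?n) * (1 / Suc ?n))"
    by (subst ennreal_mult) (auto simp: ennreal_of_nat_eq_real_of_nat)
  finally show ?thesis by simp
qed

lemma nn_integral_sphere_graph:
  fixes g :: "real \<times> 'v::euclidean_space \<Rightarrow> ennreal"
  assumes [measurable]: "g \<in> borel_measurable borel" and r: "0 < r"
  shows "ennreal (r ^ DIM('v)) * (\<integral>\<^sup>+z. g (r *\<^sub>R z) \<partial>sphere_measure) =
    (\<integral>\<^sup>+x. sphere_graph g r x \<partial>lborel)"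
proof -
  have "(\<integral>\<^sup>+x. sphere_graph g r x \<partial>lborel) =
      ennreal (r ^ DIM('v)) * (\<integral>\<^sup>+x. sphere_graph g r (r *\<^sub>R x) \<partial>lborel)"
    by (subst nn_integral_lborel_scaleR[of _ r]) (use r in auto)
  then show ?thesis
    using r by (simp add: sphere_graph_homogeneous nn_integral_unit_sphere_graph)
qed

text \<open>
  Polar coordinates follow from the graph coordinates: on each line parallel to the first axis,
  the radius is again the new variable.
\<close>

lemma nn_integral_polar:
  fixes g :: "real \<times> 'v::euclidean_space \<Rightarrow> ennreal"
  assumes [measurable]: "g \<in> borel_measurable borel"
  shows "(\<integral>\<^sup>+z. \<integral>\<^sup>+r. indicator {0<..} r * (ennreal (r ^ DIM('v)) * g (r *\<^sub>R z)) \<partial>lborel \<partial>sphere_measure) =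
    (\<integral>\<^sup>+z. g z \<partial>lborel)"
proof -
  interpret S: finite_measure "sphere_measure :: (real \<times> 'v) measure" by (rule finite_measure_sphere_measure)
  interpret P: pair_sigma_finite lborel "sphere_measure :: (real \<times> 'v) measure" ..
  have "(\<integral>\<^sup>+z. \<integral>\<^sup>+r. indicator {0<..} r * (ennreal (r ^ DIM('v)) * g (r *\<^sub>R z)) \<partial>lborel \<partial>sphere_measure) =
      (\<integral>\<^sup>+r. \<integral>\<^sup>+z. indicator {0<..} r * (ennreal (r ^ DIM('v)) * g (r *\<^sub>R z)) \<partial>sphere_measure \<partial>lborel)"
    by (rule P.Fubini') (simp add: split_beta)
  also have "\<dots> = (\<integral>\<^sup>+r. indicator {0<..} r * (\<integral>\<^sup>+x. sphere_graph g r x \<partial>lborel) \<partial>lborel)"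
  proof (rule nn_integral_cong)
    fix r :: real
    have [measurable]: "(\<lambda>z. g (r *\<^sub>R z)) \<in> borel_measurable sphere_measure"
      by (rule measurable_sphere_measure) measurable
    show "(\<integral>\<^sup>+z. indicator {0<..} r * (ennreal (r ^ DIM('v)) * g (r *\<^sub>R z)) \<partial>sphere_measure) =
        indicator {0<..} r * (\<integral>\<^sup>+x. sphere_graph g r x \<partial>lborel)"
      by (cases "0 < r") (simp_all add: nn_integral_cmult nn_integral_sphere_graph[symmetric])
  qed
  also have "\<dots> = (\<integral>\<^sup>+r. \<integral>\<^sup>+x. indicator {norm x<..} r * (ennreal (r / sqrt (r\<^sup>2 - (norm x)\<^sup>2)) *
      (g (sqrt (r\<^sup>2 - (norm x)\<^sup>2), x) + g (- sqrt (r\<^sup>2 - (norm x)\<^sup>2), x))) \<partial>lborel \<partial>lborel)"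
  proof (rule nn_integral_cong)
    fix r :: real
    have "\<not> norm x < r" if "r \<le> 0" for x :: 'v using that norm_ge_zero[of x] by linarith
    then show "indicator {0<..} r * (\<integral>\<^sup>+x. sphere_graph g r x \<partial>lborel) =
      (\<integral>\<^sup>+x. indicator {norm x<..} r * (ennreal (r / sqrt (r\<^sup>2 - (norm x)\<^sup>2)) *
        (g (sqrt (r\<^sup>2 - (norm x)\<^sup>2), x) + g (- sqrt (r\<^sup>2 - (norm x)\<^sup>2), x))) \<partial>lborel)"
      by (cases "0 < r") (auto simp: sphere_graph_def intro!: nn_integral_cong)
  qed
  also have "\<dots> = (\<integral>\<^sup>+x. \<integral>\<^sup>+r. indicator {norm x<..} r * (ennreal (r / sqrt (r\<^sup>2 - (norm x)\<^sup>2)) *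
      (g (sqrt (r\<^sup>2 - (norm x)\<^sup>2), x) + g (- sqrt (r\<^sup>2 - (norm x)\<^sup>2), x))) \<partial>lborel \<partial>lborel)"
    by (intro lborel_pair.Fubini') measurable
  also have "\<dots> = (\<integral>\<^sup>+x. \<integral>\<^sup>+a. g (a, x) \<partial>lborel \<partial>lborel)"
    by (intro nn_integral_cong nn_integral_radius_substitution) auto
  also have "\<dots> = (\<integral>\<^sup>+a. \<integral>\<^sup>+x. g (a, x) \<partial>lborel \<partial>lborel)"
    by (intro lborel_pair.Fubini') measurable
  also have "\<dots> = (\<integral>\<^sup>+z. g z \<partial>lborel)"
    by (rule nn_integral_lborel_pair[symmetric]) simp
  finally show ?thesis .
qed

section \<open>The measure on the cone\<close>

text \<open>The frequency dual to time at the point of the cone whose other frequencies are \<open>l\<close> (dual to \<open>s\<close>), \<open>x\<close> and \<open>y\<close>.\<close>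

definition cone_frequency :: "real \<times> 'v::euclidean_space \<times> 'w::euclidean_space \<Rightarrow> real" where
  "cone_frequency = (\<lambda>(l, x, y). ((norm y)\<^sup>2 - (norm x)\<^sup>2) / l)"

text \<open>
  The inverse of \<open>(\<xi>, \<eta>) \<mapsto> (\<xi>\<^sub>0 + \<eta>\<^sub>0, \<xi>', -\<eta>')\<close> on the part \<open>l \<noteq> 0\<close> of the cone
  \<open>norm \<xi> = norm \<eta>\<close>, the primes denoting the remaining coordinates.
\<close>

definition cone_point ::
  "real \<times> 'v::euclidean_space \<times> 'w::euclidean_space \<Rightarrow> (real \<times> 'v) \<times> (real \<times> 'w)" where
  "cone_point = (\<lambda>q. (((fst q + cone_frequency q) / 2, fst (snd q)), ((fst q - cone_frequency q) / 2, - snd (snd q))))"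

lemma measurable_cone_frequency [measurable]: "cone_frequency \<in> borel_measurable borel"
  unfolding cone_frequency_def split_beta by measurable

lemma measurable_cone_point [measurable]: "cone_point \<in> borel_measurable borel"
  unfolding cone_point_def by measurable

lemma nn_integral_lborel_rotate:
  fixes f :: "real \<Rightarrow> 'v::euclidean_space \<Rightarrow> 'w::euclidean_space \<Rightarrow> ennreal"
  assumes [measurable]: "(\<lambda>(a, x, y). f a x y) \<in> borel_measurable borel"
  shows "(\<integral>\<^sup>+a. \<integral>\<^sup>+x. \<integral>\<^sup>+y. f a x y \<partial>lborel \<partial>lborel \<partial>lborel) =
    (\<integral>\<^sup>+x. \<integral>\<^sup>+y. \<integral>\<^sup>+a. f a x y \<partial>lborel \<partial>lborel \<partial>lborel)"
proof -
  have [measurable]: "(\<lambda>p. f (fst p) (fst (snd p)) (snd (snd p))) \<in> borel_measurable borel"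
  proof -
    have "(\<lambda>p. f (fst p) (fst (snd p)) (snd (snd p))) = (\<lambda>(a, x, y). f a x y)"
      by (simp add: fun_eq_iff)
    with assms show ?thesis by simp
  qed
  have [measurable]: "(\<lambda>p. f (g p) (h p) (k p)) \<in> borel_measurable M"
    if [measurable]: "g \<in> borel_measurable M" "h \<in> borel_measurable M" "k \<in> borel_measurable M" for g h k and M :: "'m measure"
  proof -
    have "(\<lambda>p. (g p, h p, k p)) \<in> M \<rightarrow>\<^sub>M borel" by measurable
    from measurable_compose[OF this assms] show ?thesis by simp
  qed
  have "(\<integral>\<^sup>+a. \<integral>\<^sup>+x. \<integral>\<^sup>+y. f a x y \<partial>lborel \<partial>lborel \<partial>lborel) =
      (\<integral>\<^sup>+x. \<integral>\<^sup>+a. \<integral>\<^sup>+y. f a x y \<partial>lborel \<partial>lborel \<partial>lborel)"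
    by (intro lborel_pair.Fubini') measurable
  also have "\<dots> = (\<integral>\<^sup>+x. \<integral>\<^sup>+y. \<integral>\<^sup>+a. f a x y \<partial>lborel \<partial>lborel \<partial>lborel)"
    by (intro nn_integral_cong lborel_pair.Fubini') measurable
  finally show ?thesis .
qed

lemma AE_norm_neq: "AE y::'w::euclidean_space in lborel. norm y \<noteq> a"
proof -
  have "sphere (0::'w) a \<in> null_sets lebesgue"
    using negligible_sphere[of "0::'w" a] by (simp add: negligible_iff_null_sets)
  then have "sphere (0::'w) a \<in> null_sets lborel"
    by (subst (asm) null_sets_completion_iff) auto
  then show ?thesis by (rule AE_I') auto
qed

text \<open>
  For fixed \<open>x\<close> and \<open>y\<close> the cone \<open>norm (a, x) = norm (b, y)\<close> is the hyperbola
  \<open>b\<^sup>2 - a\<^sup>2 = (norm x)\<^sup>2 - (norm y)\<^sup>2\<close>, parametrised by \<open>l = a + b\<close>. Polar coordinates turn one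
  sphere and the radius into \<open>(a, x)\<close>, the graph coordinates turn the other sphere into \<open>y\<close>.
\<close>

lemma nn_integral_cone:
  fixes F :: "(real \<times> 'v::euclidean_space) \<times> (real \<times> 'w::euclidean_space) \<Rightarrow> ennreal"
  assumes [measurable]: "F \<in> borel_measurable borel"
  shows "(\<integral>\<^sup>+z. \<integral>\<^sup>+s. \<integral>\<^sup>+r. indicator {0<..} r *
      (ennreal (r ^ (DIM('v) + DIM('w)) * \<bar>fst z + fst s\<bar>) * F (r *\<^sub>R z, r *\<^sub>R s))
      \<partial>lborel \<partial>sphere_measure \<partial>sphere_measure) =
    (\<integral>\<^sup>+q. F (cone_point q) \<partial>lborel)"
proof -
  let ?d = "DIM('v)" and ?n = "DIM('w)"
  interpret S: finite_measure "sphere_measure :: (real \<times> 'w) measure" by (rule finite_measure_sphere_measure)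
  interpret P: pair_sigma_finite lborel "sphere_measure :: (real \<times> 'w) measure" ..
  define F' where "F' p = ennreal \<bar>fst (fst p) + fst (snd p)\<bar> * F p" for p
  have [measurable]: "F' \<in> borel_measurable borel"
    unfolding F'_def[abs_def] by measurable
  \<comment> \<open>\<open>G\<close> is the integral over the sphere of \<open>\<eta>\<close> of radius \<open>norm \<xi>\<close>, and \<open>H\<close> its density in graph
    coordinates. As \<open>\<bar>\<zeta>\<^sub>0 + \<sigma>\<^sub>0\<bar> = \<bar>\<xi>\<^sub>0 + \<eta>\<^sub>0\<bar> / r\<close>, there is a factor \<open>1 / norm \<xi>\<close>, which cancels the
    radius in the area factor of the graph.\<close>
  define G where "G \<xi> = ennreal (1 / norm \<xi>) *
    (ennreal (norm \<xi> ^ ?n) * (\<integral>\<^sup>+s. F' (\<xi>, norm \<xi> *\<^sub>R s) \<partial>sphere_measure))" for \<xi>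
  define H where "H \<xi> y = (if norm y < norm \<xi> then ennreal (1 / sqrt ((norm \<xi>)\<^sup>2 - (norm y)\<^sup>2)) *
      (F' (\<xi>, (sqrt ((norm \<xi>)\<^sup>2 - (norm y)\<^sup>2), y)) + F' (\<xi>, (- sqrt ((norm \<xi>)\<^sup>2 - (norm y)\<^sup>2), y))) else 0)"
    for \<xi> :: "real \<times> 'v" and y :: 'w
  have H_meas: "(\<lambda>p. H (fst p) (snd p)) \<in> borel_measurable borel"
    unfolding H_def by measurable
  have [measurable]: "G \<in> borel_measurable borel"
    unfolding G_def[abs_def]
    by (intro borel_measurable_times_ennreal S.borel_measurable_nn_integral) (simp_all add: split_beta)
  have radius: "(\<integral>\<^sup>+s. \<integral>\<^sup>+r. indicator {0<..} r *
      (ennreal (r ^ (?d + ?n) * \<bar>fst z + fst s\<bar>) * F (r *\<^sub>R z, r *\<^sub>R s)) \<partial>lborel \<partial>sphere_measure) =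
    (\<integral>\<^sup>+r. indicator {0<..} r * (ennreal (r ^ ?d) * G (r *\<^sub>R z)) \<partial>lborel)"
    if z: "norm z = 1" for z :: "real \<times> 'v"
  proof -
    have "(\<integral>\<^sup>+s. \<integral>\<^sup>+r. indicator {0<..} r *
        (ennreal (r ^ (?d + ?n) * \<bar>fst z + fst s\<bar>) * F (r *\<^sub>R z, r *\<^sub>R s)) \<partial>lborel \<partial>sphere_measure) =
      (\<integral>\<^sup>+r. \<integral>\<^sup>+s. indicator {0<..} r *
        (ennreal (r ^ (?d + ?n) * \<bar>fst z + fst s\<bar>) * F (r *\<^sub>R z, r *\<^sub>R s)) \<partial>sphere_measure \<partial>lborel)"
      by (rule P.Fubini') (simp add: split_beta)
    also have "\<dots> = (\<integral>\<^sup>+r. \<integral>\<^sup>+s. indicator {0<..} r * (ennreal (r ^ ?d) * (ennreal (1 / r) *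
        (ennreal (r ^ ?n) * F' (r *\<^sub>R z, r *\<^sub>R s)))) \<partial>sphere_measure \<partial>lborel)"
    proof (intro nn_integral_cong)
      fix r :: real and s :: "real \<times> 'w"
      have "r ^ (?d + ?n) * \<bar>fst z + fst s\<bar> = r ^ ?d * (1 / r * (r ^ ?n * \<bar>r * fst z + r * fst s\<bar>))"
        if "0 < r"
        using that by (simp add: power_add distrib_left[symmetric] abs_mult)
      then show "indicator {0<..} r * (ennreal (r ^ (?d + ?n) * \<bar>fst z + fst s\<bar>) * F (r *\<^sub>R z, r *\<^sub>R s)) =
          indicator {0<..} r * (ennreal (r ^ ?d) * (ennreal (1 / r) * (ennreal (r ^ ?n) * F' (r *\<^sub>R z, r *\<^sub>R s))))"
        by (cases "0 < r") (auto simp: F'_def mult.assoc[symmetric] ennreal_mult'[symmetric])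
    qed
    also have "\<dots> = (\<integral>\<^sup>+r. indicator {0<..} r * (ennreal (r ^ ?d) * G (r *\<^sub>R z)) \<partial>lborel)"
    proof (rule nn_integral_cong)
      fix r :: real
      have [measurable]: "(\<lambda>s. F' (r *\<^sub>R z, r *\<^sub>R s)) \<in> borel_measurable sphere_measure"
        by (rule measurable_sphere_measure) measurable
      show "(\<integral>\<^sup>+s. indicator {0<..} r * (ennreal (r ^ ?d) * (ennreal (1 / r) *
          (ennreal (r ^ ?n) * F' (r *\<^sub>R z, r *\<^sub>R s)))) \<partial>sphere_measure) =
          indicator {0<..} r * (ennreal (r ^ ?d) * G (r *\<^sub>R z))"
        by (cases "0 < r") (simp_all add: G_def z nn_integral_cmult)
    qed
    finally show ?thesis .
  qed
  have graph: "G \<xi> = (\<integral>\<^sup>+y. H \<xi> y \<partial>lborel)" for \<xi> :: "real \<times> 'v"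
  proof (cases "\<xi> = 0")
    case False
    then have "G \<xi> = ennreal (1 / norm \<xi>) * (\<integral>\<^sup>+y. sphere_graph (\<lambda>\<eta>. F' (\<xi>, \<eta>)) (norm \<xi>) y \<partial>lborel)"
      unfolding G_def by (subst nn_integral_sphere_graph) auto
    also have "\<dots> = (\<integral>\<^sup>+y. ennreal (1 / norm \<xi>) * sphere_graph (\<lambda>\<eta>. F' (\<xi>, \<eta>)) (norm \<xi>) y \<partial>lborel)"
      by (subst nn_integral_cmult) auto
    also have "\<dots> = (\<integral>\<^sup>+y. H \<xi> y \<partial>lborel)"
      using False
      by (intro nn_integral_cong) (auto simp: sphere_graph_def H_def mult.assoc[symmetric] ennreal_mult'[symmetric])
    finally show ?thesis .
  qed (simp add: G_def H_def)
  have hyperbola: "(\<integral>\<^sup>+a. H (a, x) y \<partial>lborel) = (\<integral>\<^sup>+l. F (cone_point (l, x, - y)) \<partial>lborel)"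
    if "norm y \<noteq> norm x" for x y
  proof -
    let ?c = "(norm x)\<^sup>2 - (norm y)\<^sup>2"
    have iff: "norm y < norm (a, x) \<longleftrightarrow> 0 < a\<^sup>2 + ?c" for a :: real
      using power_mono_iff[of "norm (a, x)" "norm y" 2] by (auto simp: norm_Pair not_le[symmetric])
    have sq: "(norm (a, x))\<^sup>2 - (norm y)\<^sup>2 = a\<^sup>2 + ?c" for a :: real
      by (simp add: norm_Pair)
    have "(\<integral>\<^sup>+a. H (a, x) y \<partial>lborel) = (\<integral>\<^sup>+a. indicator {a. 0 < a\<^sup>2 + ?c} a * (ennreal (1 / sqrt (a\<^sup>2 + ?c)) *
        (ennreal \<bar>a + sqrt (a\<^sup>2 + ?c)\<bar> * F ((a, x), (sqrt (a\<^sup>2 + ?c), y)) +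
         ennreal \<bar>a - sqrt (a\<^sup>2 + ?c)\<bar> * F ((a, x), (- sqrt (a\<^sup>2 + ?c), y)))) \<partial>lborel)"
      by (intro nn_integral_cong) (simp add: H_def F'_def iff sq indicator_def)
    also have "\<dots> = (\<integral>\<^sup>+l. F (((l - ?c / l) / 2, x), ((l + ?c / l) / 2, y)) \<partial>lborel)"
      using nn_integral_hyperbola_substitution[of "\<lambda>(a, b). F ((a, x), (b, y))" ?c] that
      by simp
    also have "\<dots> = (\<integral>\<^sup>+l. F (cone_point (l, x, - y)) \<partial>lborel)"
    proof (intro nn_integral_cong arg_cong[where f = F])
      fix l :: real
      have "cone_frequency (l, x, - y) = - (?c / l)"
        by (simp add: cone_frequency_def minus_divide_left)
      then show "(((l - ?c / l) / 2, x), ((l + ?c / l) / 2, y)) = cone_point (l, x, - y)"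
        by (simp add: cone_point_def)
    qed
    finally show ?thesis .
  qed
  have "(\<integral>\<^sup>+z. \<integral>\<^sup>+s. \<integral>\<^sup>+r. indicator {0<..} r *
      (ennreal (r ^ (?d + ?n) * \<bar>fst z + fst s\<bar>) * F (r *\<^sub>R z, r *\<^sub>R s))
      \<partial>lborel \<partial>sphere_measure \<partial>sphere_measure) =
    (\<integral>\<^sup>+z. \<integral>\<^sup>+r. indicator {0<..} r * (ennreal (r ^ ?d) * G (r *\<^sub>R z)) \<partial>lborel \<partial>sphere_measure)"
    by (intro nn_integral_cong radius) (simp add: space_sphere_measure)
  also have "\<dots> = (\<integral>\<^sup>+\<xi>. \<integral>\<^sup>+y. H \<xi> y \<partial>lborel \<partial>lborel)"
    by (subst nn_integral_polar) (simp_all add: graph[symmetric])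
  also have "\<dots> = (\<integral>\<^sup>+a. \<integral>\<^sup>+x. \<integral>\<^sup>+y. H (a, x) y \<partial>lborel \<partial>lborel \<partial>lborel)"
    by (rule nn_integral_lborel_pair) (simp add: graph[symmetric])
  also have "\<dots> = (\<integral>\<^sup>+x. \<integral>\<^sup>+y. \<integral>\<^sup>+a. H (a, x) y \<partial>lborel \<partial>lborel \<partial>lborel)"
  proof (rule nn_integral_lborel_rotate)
    have "(\<lambda>q :: real \<times> 'v \<times> 'w. ((fst q, fst (snd q)), snd (snd q))) \<in> borel_measurable borel"
      by measurable
    from measurable_compose[OF this H_meas]
    show "(\<lambda>(a, x, y). H (a, x) y) \<in> borel_measurable borel"
      by (simp add: split_beta)
  qed
  also have "\<dots> = (\<integral>\<^sup>+x. \<integral>\<^sup>+y. \<integral>\<^sup>+l. F (cone_point (l, x, - y)) \<partial>lborel \<partial>lborel \<partial>lborel)"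
  proof (rule nn_integral_cong)
    fix x :: 'v
    have "AE y::'w in lborel. norm y \<noteq> norm x" by (rule AE_norm_neq)
    then have "AE y in lborel. (\<integral>\<^sup>+a. H (a, x) y \<partial>lborel) = (\<integral>\<^sup>+l. F (cone_point (l, x, - y)) \<partial>lborel)"
      by eventually_elim (rule hyperbola)
    then show "(\<integral>\<^sup>+y. \<integral>\<^sup>+a. H (a, x) y \<partial>lborel \<partial>lborel) =
        (\<integral>\<^sup>+y. \<integral>\<^sup>+l. F (cone_point (l, x, - y)) \<partial>lborel \<partial>lborel)"
      by (rule nn_integral_cong_AE)
  qed
  also have "\<dots> = (\<integral>\<^sup>+x. \<integral>\<^sup>+y. \<integral>\<^sup>+l. F (cone_point (l, x, y)) \<partial>lborel \<partial>lborel \<partial>lborel)"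
    by (intro nn_integral_cong nn_integral_lborel_uminus) simp
  also have "\<dots> = (\<integral>\<^sup>+l. \<integral>\<^sup>+x. \<integral>\<^sup>+y. F (cone_point (l, x, y)) \<partial>lborel \<partial>lborel \<partial>lborel)"
    by (rule nn_integral_lborel_rotate[symmetric]) simp
  also have "\<dots> = (\<integral>\<^sup>+q. F (cone_point q) \<partial>lborel)"
    by (simp add: nn_integral_lborel_pair)
  finally show ?thesis .
qed

text \<open>The same Jacobian for complex integrands, by the equality of two image measures.\<close>

theorem integral_cone:
  fixes G :: "(real \<times> 'v::euclidean_space) \<times> (real \<times> 'w::euclidean_space) \<Rightarrow> complex"
  assumes [measurable]: "G \<in> borel_measurable borel"
  shows "(LINT (z, s, r)|(sphere_measure \<Otimes>\<^sub>M sphere_measure \<Otimes>\<^sub>M restrict_space lborel {0<..}).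
      of_real (r ^ (DIM('v) + DIM('w)) * \<bar>fst z + fst s\<bar>) * G (r *\<^sub>R z, r *\<^sub>R s)) =
    (LINT q|lborel. G (cone_point q))"
proof -
  let ?S = "sphere_measure :: (real \<times> 'v) measure" and ?T = "sphere_measure :: (real \<times> 'w) measure"
  let ?R = "restrict_space lborel {0<..} :: real measure"
  let ?P = "?S \<Otimes>\<^sub>M ?T \<Otimes>\<^sub>M ?R"
  let ?w = "\<lambda>p. snd (snd p) ^ (DIM('v) + DIM('w)) * \<bar>fst (fst p) + fst (fst (snd p))\<bar>"
  let ?c = "\<lambda>p. (snd (snd p) *\<^sub>R fst p, snd (snd p) *\<^sub>R fst (snd p))"
  interpret S: finite_measure ?S by (rule finite_measure_sphere_measure)
  interpret T: finite_measure ?T by (rule finite_measure_sphere_measure)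
  have R: "sigma_finite_measure ?R"
    by (rule sigma_finite_measure_restrict_space) (auto intro: sigma_finite_lborel)
  interpret R: sigma_finite_measure ?R by (rule R)
  interpret TR: pair_sigma_finite ?T ?R ..
  have Q: "sigma_finite_measure (?T \<Otimes>\<^sub>M ?R)" by unfold_locales
  have Rid: "(\<lambda>r. r) \<in> ?R \<rightarrow>\<^sub>M borel" by (rule measurable_restrict_space1) simp
  have [measurable]: "(\<lambda>p. fst p) \<in> ?P \<rightarrow>\<^sub>M borel"
    by (rule measurable_compose[OF measurable_fst measurable_sphere_measure_ident])
  have [measurable]: "(\<lambda>p. fst (snd p)) \<in> ?P \<rightarrow>\<^sub>M borel"
    by (rule measurable_compose[OF measurable_compose[OF measurable_snd measurable_fst] measurable_sphere_measure_ident])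
  have [measurable]: "(\<lambda>p. snd (snd p)) \<in> ?P \<rightarrow>\<^sub>M borel"
    by (rule measurable_compose[OF measurable_compose[OF measurable_snd measurable_snd] Rid])
  have [measurable]: "?w \<in> borel_measurable ?P" "?c \<in> ?P \<rightarrow>\<^sub>M borel"
    by measurable
  have pos: "AE p in ?P. 0 \<le> ?w p"
    by (rule AE_I2) (auto simp: space_pair_measure space_restrict_space)
  have "distr (density ?P (\<lambda>p. ennreal (?w p))) borel ?c = distr lborel borel cone_point" (is "?L = ?Q")
  proof (rule measure_eqI)
    fix A assume "A \<in> sets ?L"
    then have A [measurable]: "A \<in> sets borel" by simp
    have "emeasure ?L A = (\<integral>\<^sup>+p. ennreal (?w p) * indicator A (?c p) \<partial>?P)"
      using A by (simp add: nn_integral_indicator[symmetric] nn_integral_distr nn_integral_density del: nn_integral_indicator)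
    also have "\<dots> = (\<integral>\<^sup>+z. \<integral>\<^sup>+q. ennreal (?w (z, q)) * indicator A (?c (z, q)) \<partial>(?T \<Otimes>\<^sub>M ?R) \<partial>?S)"
      by (rule sigma_finite_measure.nn_integral_fst[OF Q, symmetric]) measurable
    also have "\<dots> = (\<integral>\<^sup>+z. \<integral>\<^sup>+s. \<integral>\<^sup>+r. ennreal (?w (z, s, r)) * indicator A (?c (z, s, r)) \<partial>?R \<partial>?T \<partial>?S)"
      by (intro nn_integral_cong R.nn_integral_fst[symmetric]) measurable
    also have "\<dots> = (\<integral>\<^sup>+z. \<integral>\<^sup>+s. \<integral>\<^sup>+r. indicator {0<..} r *
      (ennreal (r ^ (DIM('v) + DIM('w)) * \<bar>fst z + fst s\<bar>) * indicator A (r *\<^sub>R z, r *\<^sub>R s)) \<partial>lborel \<partial>?T \<partial>?S)"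
      by (simp add: nn_integral_restrict_space mult.commute[of _ "indicator {0<..} _"])
    also have "\<dots> = (\<integral>\<^sup>+q. indicator A (cone_point q) \<partial>lborel)"
      by (rule nn_integral_cone) simp
    also have "\<dots> = emeasure ?Q A"
      using A by (simp add: nn_integral_indicator[symmetric] nn_integral_distr del: nn_integral_indicator)
    finally show "emeasure ?L A = emeasure ?Q A" .
  qed simp
  then have "(LINT p|?L. G p) = (LINT p|?Q. G p)" by simp
  then have "(LINT p|?P. ?w p *\<^sub>R G (?c p)) = (LINT q|lborel. G (cone_point q))"
    using pos by (simp add: integral_distr integral_density)
  moreover have "(\<lambda>p. ?w p *\<^sub>R G (?c p)) = (\<lambda>(z, s, r).
      of_real (r ^ (DIM('v) + DIM('w)) * \<bar>fst z + fst s\<bar>) * G (r *\<^sub>R z, r *\<^sub>R s))"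
    by (simp add: fun_eq_iff scaleR_conv_of_real)
  ultimately show ?thesis by simp
qed

section \<open>The transform with opposite signs\<close>

definition reflect :: "'a::real_normed_vector \<times> 'b::real_normed_vector \<Rightarrow> 'a \<times> 'b" where
  "reflect p = (fst p, - snd p)"

lemma reflect_reflect [simp]: "reflect (reflect p) = p"
  by (simp add: reflect_def)

lemma inner_reflect: "reflect p \<bullet> q = p \<bullet> reflect q"
  by (simp add: reflect_def inner_prod_def)

lemma measurable_reflect [measurable]:
  "reflect \<in> borel_measurable (borel :: ('a::euclidean_space \<times> 'b::euclidean_space) measure)"
  unfolding reflect_def[abs_def] borel_prod[symmetric] by measurable

lemma integral_lborel_reflect:
  fixes f :: "'a::euclidean_space \<times> 'b::euclidean_space \<Rightarrow> complex"
  assumes [measurable]: "f \<in> borel_measurable borel"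
  shows "(LINT p|lborel. f (reflect p)) = (LINT p|lborel. f p)"
proof -
  have "distr lborel borel reflect = (lborel :: ('a \<times> 'b) measure)"
  proof (rule measure_eqI)
    fix A :: "('a \<times> 'b) set"
    assume "A \<in> sets (distr lborel borel reflect)"
    then have A [measurable]: "A \<in> sets borel" by simp
    have "emeasure (distr lborel borel reflect) A = (\<integral>\<^sup>+p. indicator A (reflect p) \<partial>lborel)"
      by (simp add: nn_integral_distr flip: nn_integral_indicator)
    also have "\<dots> = (\<integral>\<^sup>+x. \<integral>\<^sup>+y. indicator A (x, - y) \<partial>lborel \<partial>lborel)"
      by (subst nn_integral_lborel_pair) (auto simp: reflect_def)
    also have "\<dots> = (\<integral>\<^sup>+x. \<integral>\<^sup>+y. indicator A (x, y) \<partial>lborel \<partial>lborel)"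
      by (intro nn_integral_cong nn_integral_lborel_uminus) simp
    also have "\<dots> = emeasure lborel A"
      by (simp add: nn_integral_lborel_pair[symmetric])
    finally show "emeasure (distr lborel borel reflect) A = emeasure lborel A" .
  qed simp
  then have "(LINT p|lborel. f p) = (LINT p|distr lborel borel reflect. f p)" by simp
  also have "\<dots> = (LINT p|lborel. f (reflect p))" by (rule integral_distr) auto
  finally show ?thesis ..
qed

lemma integral_lborel_uminus:
  fixes f :: "'a::euclidean_space \<Rightarrow> 'b::{banach, second_countable_topology}"
  assumes "f \<in> borel_measurable borel"
  shows "(LINT x|lborel. f (- x)) = (LINT x|lborel. f x)"
  using integral_lborel_scaleR[OF assms, of "-1"] by simp

lemma ft_uminus: "ft f (- k) = (LINT x|lborel. cis (x \<bullet> k) * f x)"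
  by (simp add: ft_def)

lemma fourier_eq_ft: "fourier f p = ft f (reflect p)"
  by (cases p) (simp add: fourier_def ft_def reflect_def case_prod_unfold inner_prod_def)

definition inverse_fourier ::
  "('a::euclidean_space \<times> 'b::euclidean_space \<Rightarrow> complex) \<Rightarrow> 'a \<times> 'b \<Rightarrow> complex" where
  "inverse_fourier f p = 1 / (2 * pi) ^ DIM('a \<times> 'b) * ft f (- reflect p)"

lemma schwartz_compose_reflect:
  fixes f :: "'a::euclidean_space \<times> 'b::euclidean_space \<Rightarrow> complex"
  assumes "schwartz f"
  shows "schwartz (\<lambda>p. f (reflect p))" "schwartz (\<lambda>p. f (- reflect p))"
proof -
  have n: "norm (reflect p) = norm p" for p :: "'a \<times> 'b"
    by (simp add: reflect_def norm_prod_def)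
  have l: "bounded_linear (reflect :: 'a \<times> 'b \<Rightarrow> _)"
    by (rule bounded_linear_intro[where K = 1]) (auto simp: n, auto simp: reflect_def)
  show "schwartz (\<lambda>p. f (reflect p))"
    by (rule schwartz_compose_linear[where C = 1, OF assms l]) (auto simp: n)
  show "schwartz (\<lambda>p. f (- reflect p))"
    by (rule schwartz_compose_linear[where C = 1, OF assms bounded_linear_minus[OF l]]) (auto simp: n)
qed

lemma schwartz_inverse_fourier: "schwartz f \<Longrightarrow> schwartz (inverse_fourier f)"
  unfolding inverse_fourier_def[abs_def]
  by (intro schwartz_cmult schwartz_compose_reflect schwartz_ft)

lemma fourier_inverse_fourier:
  fixes f :: "'a::euclidean_space \<times> 'b::euclidean_space \<Rightarrow> complex"
  assumes f: "schwartz f"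
  shows "fourier (inverse_fourier f) = f"
proof
  fix p
  let ?c = "1 / (2 * complex_of_real pi) ^ DIM('a \<times> 'b)"
  note [measurable] = schwartz_measurable[OF f]
  have "fourier (inverse_fourier f) p = (LINT q|lborel. cis (- (q \<bullet> reflect p)) * (?c * ft f (- reflect q)))"
    by (simp add: fourier_eq_ft ft_def inverse_fourier_def)
  also have "\<dots> = (LINT q|lborel. cis (- (reflect q \<bullet> p)) * (?c * ft f (- reflect q)))"
    by (simp add: inner_reflect)
  also have "\<dots> = (LINT q|lborel. cis (- (q \<bullet> p)) * (?c * ft f (- q)))"
    by (rule integral_lborel_reflect[where f = "\<lambda>q. cis (- (q \<bullet> p)) * (?c * ft f (- q))"]) simp
  also have "\<dots> = (LINT q|lborel. cis (q \<bullet> p) * (?c * ft f q))"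
    using integral_lborel_uminus[of "\<lambda>q. cis (q \<bullet> p) * (?c * ft f q)"] by simp
  also have "\<dots> = ?c * (LINT q|lborel. cis (p \<bullet> q) * ft f q)"
    by (simp add: inner_commute mult.left_commute[of _ ?c])
  also have "\<dots> = f p" unfolding ft_inversion[OF f] by simp
  finally show "fourier (inverse_fourier f) p = f p" .
qed

lemma inverse_fourier_fourier:
  fixes f :: "'a::euclidean_space \<times> 'b::euclidean_space \<Rightarrow> complex"
  assumes f: "schwartz f"
  shows "inverse_fourier (fourier f) = f"
proof
  fix p
  let ?c = "1 / (2 * complex_of_real pi) ^ DIM('a \<times> 'b)"
  note [measurable] = schwartz_measurable[OF f]
  have "inverse_fourier (fourier f) p = ?c * (LINT q|lborel. cis (q \<bullet> reflect p) * ft f (reflect q))"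
    by (simp add: fourier_eq_ft[abs_def] ft_def[of "\<lambda>p. ft f (reflect p)"] inverse_fourier_def)
  also have "\<dots> = ?c * (LINT q|lborel. cis (reflect q \<bullet> p) * ft f (reflect q))"
    by (simp add: inner_reflect)
  also have "\<dots> = ?c * (LINT q|lborel. cis (q \<bullet> p) * ft f q)"
    by (subst integral_lborel_reflect[where f = "\<lambda>q. cis (q \<bullet> p) * ft f q"]) auto
  also have "\<dots> = f p" unfolding inner_commute[of _ p] ft_inversion[OF f] by simp
  finally show "inverse_fourier (fourier f) p = f p" .
qed

section \<open>The cone functional in the coordinates \<open>(l, x, y)\<close>\<close>

text \<open>
  The factor \<open>r \<bar>\<zeta>\<^sub>0 + \<sigma>\<^sub>0\<bar>\<close> of the amplitude completes \<open>r\<close> to the power \<open>N - 1\<close> to the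
  Jacobian of the coordinates \<open>q\<close>.
\<close>

lemma cone_functional_eq:
  fixes v\<^sub>0 :: "('d::finite, 'n::finite) sxy \<Rightarrow> complex"
  assumes v0: "schwartz v\<^sub>0" and [measurable]: "\<Phi> \<in> borel_measurable borel"
  shows "cone_functional v\<^sub>0 \<Phi> = 2 * pi * (LINT q|lborel. ft v\<^sub>0 q * \<Phi> (cone_point q))"
proof -
  note [measurable] = schwartz_measurable[OF v0]
  let ?g = "\<lambda>p :: ('d, 'n) xy. (fst (fst p) + fst (snd p), snd (fst p), - snd (snd p))"
  let ?G = "\<lambda>p. 4 * pi * (ft v\<^sub>0 (?g p) * \<Phi> p)"
  have [measurable]: "?g \<in> borel \<rightarrow>\<^sub>M borel"
    unfolding borel_prod[symmetric] by measurable
  have amplitude: "of_real (r ^ (CARD('d) + CARD('n) - 1)) * amplitude v\<^sub>0 \<zeta> \<sigma> r * \<Phi> (r *\<^sub>R \<zeta>, r *\<^sub>R \<sigma>) =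
      of_real (r ^ (DIM(real ^ 'd) + DIM(real ^ 'n)) * \<bar>fst \<zeta> + fst \<sigma>\<bar>) * ?G (r *\<^sub>R \<zeta>, r *\<^sub>R \<sigma>)" for \<zeta> \<sigma> r
  proof -
    have "v0_tilde v\<^sub>0 (r * (fst \<zeta> + fst \<sigma>)) (r *\<^sub>R snd \<zeta>) (r *\<^sub>R snd \<sigma>) = 2 * ft v\<^sub>0 (?g (r *\<^sub>R \<zeta>, r *\<^sub>R \<sigma>))"
      by (simp add: v0_tilde_def ft_def case_prod_unfold inner_prod_def algebra_simps)
    moreover have "r ^ (CARD('d) + CARD('n)) = r ^ (CARD('d) + CARD('n) - 1) * r"
      by (metis Suc_pred' add_gr_0 power_Suc2 zero_less_card_finite)
    ultimately show ?thesis by (simp add: amplitude_def mult_ac)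
  qed
  have "cone_functional v\<^sub>0 \<Phi> = 1 / 2 * (LINT q|lborel. ?G (cone_point q))"
    unfolding cone_functional_def amplitude by (subst integral_cone) auto
  also have "\<dots> = 1 / 2 * (LINT q|lborel. 4 * pi * (ft v\<^sub>0 q * \<Phi> (cone_point q)))"
  proof -
    have "?g (cone_point q) = q" for q :: "('d, 'n) sxy"
      by (cases q) (simp add: cone_point_def add_divide_distrib[symmetric])
    then show ?thesis by simp
  qed
  finally show ?thesis by simp
qed

lemma integral_to_xy:
  fixes g :: "('d::finite, 'n::finite) xy \<Rightarrow> complex"
  assumes [measurable]: "g \<in> borel_measurable borel"
  shows "(LINT w|lborel. g w) = 2 * (LINT z|lborel. g (to_xy z))"
proof -
  have "(LINT z|lborel. g (to_xy z)) = (LINT w|distr lborel borel to_xy. g w)"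
    by (subst integral_distr) auto
  also have "\<dots> = 1 / 2 * (LINT w|lborel. g w)"
    unfolding distr_to_xy by (subst integral_density) (auto simp: scaleR_conv_of_real)
  finally show ?thesis by (simp add: mult.commute)
qed

lemma schwartz_compose_of_xy:
  fixes \<phi> :: "('d::finite, 'n::finite) tsxy \<Rightarrow> complex"
  assumes "schwartz \<phi>"
  shows "schwartz (\<phi> \<circ> of_xy)"
proof -
  have to: "bounded_linear (to_xy :: ('d, 'n) tsxy \<Rightarrow> _)"
    unfolding to_xy_alt by (intro linear_conv_bounded_linear[THEN iffD1] linearI) (auto simp: algebra_simps)
  have "linear (of_xy :: ('d, 'n) xy \<Rightarrow> _)"
    unfolding of_xy_alt by (intro linearI) (auto simp: algebra_simps add_divide_distrib diff_divide_distrib)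
  then have of: "bounded_linear (of_xy :: ('d, 'n) xy \<Rightarrow> _)"
    by (simp add: linear_conv_bounded_linear)
  obtain K where K: "\<And>z :: ('d, 'n) tsxy. norm (to_xy z) \<le> norm z * K" "0 \<le> K"
    using bounded_linear.nonneg_bounded[OF to] by blast
  have "norm x \<le> K * norm (of_xy x)" for x :: "('d, 'n) xy"
    using K(1)[of "of_xy x"] by (simp add: mult.commute)
  with schwartz_compose_linear[OF assms of this K(2)] show ?thesis by (simp add: comp_def)
qed

text \<open>In the variables \<open>(t, s, x, y)\<close> the frequency at \<open>cone_point q\<close> is \<open>(cone_frequency q, q)\<close>.\<close>

lemma inverse_fourier_cone_point:
  fixes \<phi> :: "('d::finite, 'n::finite) tsxy \<Rightarrow> complex"
  assumes \<phi>: "schwartz \<phi>"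
  shows "inverse_fourier (\<phi> \<circ> of_xy) (cone_point q) =
    2 / (2 * pi) ^ (CARD('d) + CARD('n) + 2) * ft \<phi> (- (cone_frequency q, q))"
proof -
  note [measurable] = schwartz_measurable[OF \<phi>]
  have phase: "to_xy z \<bullet> reflect (cone_point q) = z \<bullet> (cone_frequency q, q)" for z :: "('d, 'n) tsxy"
  proof -
    obtain t s x y where z: "z = (t, s, x, y)" by (cases z)
    obtain l a b where q: "q = (l, a, b)" by (cases q)
    show ?thesis
      unfolding z q by (simp add: reflect_def cone_point_def inner_prod_def field_simps)
  qed
  have "ft (\<phi> \<circ> of_xy) (- reflect (cone_point q)) =
      2 * (LINT z|lborel. cis (to_xy z \<bullet> reflect (cone_point q)) * \<phi> z)"
    unfolding ft_def by (subst integral_to_xy) auto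
  also have "\<dots> = 2 * ft \<phi> (- (cone_frequency q, q))"
    unfolding ft_uminus phase ..
  finally show ?thesis by (simp add: inverse_fourier_def)
qed

text \<open>
  A distribution with the prescribed transform is evaluated at \<open>\<phi> \<circ> of_xy\<close>, which is itself the
  transform of a Schwartz function.
\<close>

lemma pullback_eq_of_fourier_dist:
  fixes v\<^sub>0 :: "('d::finite, 'n::finite) sxy \<Rightarrow> complex"
  assumes v0: "schwartz v\<^sub>0"
    and u: "\<And>\<Phi>. schwartz \<Phi> \<Longrightarrow> fourier_dist u \<Phi> = cone_functional v\<^sub>0 \<Phi>"
    and \<phi>: "schwartz \<phi>"
  shows "pullback u \<phi> = 1 / (2 * pi) ^ (CARD('d) + CARD('n) + 1) *
    (LINT q|lborel. ft v\<^sub>0 q * ft \<phi> (- (cone_frequency q, q)))"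
proof -
  let ?\<Phi> = "inverse_fourier (\<phi> \<circ> of_xy)"
  let ?I = "LINT q|lborel. ft v\<^sub>0 q * ft \<phi> (- (cone_frequency q, q))"
  have \<Phi>: "schwartz ?\<Phi>" by (intro schwartz_inverse_fourier schwartz_compose_of_xy \<phi>)
  have "pullback u \<phi> = 1 / 2 * fourier_dist u ?\<Phi>"
    by (simp add: pullback_def fourier_dist_def fourier_inverse_fourier schwartz_compose_of_xy \<phi>)
  also have "\<dots> = pi * (LINT q|lborel. ft v\<^sub>0 q * ?\<Phi> (cone_point q))"
    by (simp add: u \<Phi> cone_functional_eq[OF v0] schwartz_measurable)
  also have "\<dots> = pi * (2 / (2 * pi) ^ (CARD('d) + CARD('n) + 2) * ?I)"
    by (simp add: inverse_fourier_cone_point[OF \<phi>] mult.left_commute[of "ft v\<^sub>0 _"])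
  finally show ?thesis by (simp add: mult.assoc)
qed

section \<open>Existence of the distribution\<close>

lemma integrable_ft_mult_bounded:
  fixes v\<^sub>0 :: "'a::euclidean_space \<Rightarrow> complex"
  assumes v0: "schwartz v\<^sub>0" and [measurable]: "g \<in> borel_measurable borel" and B: "\<And>q. norm (g q) \<le> B"
  shows "integrable lborel (\<lambda>q. ft v\<^sub>0 q * g q)"
  using integrable_bounded_mult[OF schwartz_integrable[OF schwartz_ft[OF v0]], of g B] B
  by (simp add: mult.commute)

lemma norm_inverse_fourier_le:
  fixes f :: "'a::euclidean_space \<times> 'b::euclidean_space \<Rightarrow> complex"
  shows "norm (inverse_fourier f p) \<le> 1 / (2 * pi) ^ DIM('a \<times> 'b) * (LINT x|lborel. norm (f x))"
  unfolding inverse_fourier_def norm_mult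
  by (rule mult_mono) (auto simp: norm_ft_le norm_divide norm_power norm_mult)

text \<open>
  The functional on the cone is bounded by the supremum of its argument, since \<open>ft v\<^sub>0\<close> is
  integrable; a supremum of \<open>inverse_fourier f\<close> is bounded by the \<open>L1\<close> norm, hence by a Schwartz
  norm, of \<open>f\<close>.
\<close>

lemma tempered_distribution_cone_functional:
  fixes v\<^sub>0 :: "('d::finite, 'n::finite) sxy \<Rightarrow> complex"
  assumes v0: "schwartz v\<^sub>0"
  shows "tempered_distribution (\<lambda>f. cone_functional v\<^sub>0 (inverse_fourier f))"
proof -
  let ?u = "\<lambda>f. cone_functional v\<^sub>0 (inverse_fourier f)"
  let ?c = "1 / (2 * pi) ^ DIM(('d, 'n) xy)"
  let ?I = "LINT q|lborel. norm (ft v\<^sub>0 q)"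
  let ?J = "LINT p :: ('d, 'n) xy|lborel. 1 / (1 + norm p) ^ (2 * DIM(('d, 'n) xy))"
  have [measurable]: "inverse_fourier f \<in> borel_measurable borel" if "schwartz f" for f :: "('d, 'n) xy \<Rightarrow> complex"
    using that by (intro schwartz_measurable schwartz_inverse_fourier)
  have eq: "?u f = 2 * pi * (LINT q|lborel. ft v\<^sub>0 q * inverse_fourier f (cone_point q))"
    if "schwartz f" for f
    using that by (intro cone_functional_eq v0) measurable
  have int: "integrable lborel (\<lambda>q. ft v\<^sub>0 q * inverse_fourier f (cone_point q))" if "schwartz f" for f
    using that norm_inverse_fourier_le[of f] by (intro integrable_ft_mult_bounded[OF v0]) measurable
  have "?u (\<lambda>x. f x + g x) = ?u f + ?u g" if f: "schwartz f" and g: "schwartz g" for f g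
  proof -
    have inv: "inverse_fourier (\<lambda>x. f x + g x) = (\<lambda>p. inverse_fourier f p + inverse_fourier g p)"
      using f g by (simp add: fun_eq_iff inverse_fourier_def ft_add schwartz_integrable distrib_left)
    show ?thesis
      unfolding eq[OF f] eq[OF g] eq[OF schwartz_add[OF f g]]
      unfolding inv
      using int[OF f] int[OF g] by (simp add: distrib_left)
  qed
  moreover have "?u (\<lambda>x. a * f x) = a * ?u f" if f: "schwartz f" for f a
  proof -
    have inv: "inverse_fourier (\<lambda>x. a * f x) = (\<lambda>p. a * inverse_fourier f p)"
      by (simp add: fun_eq_iff inverse_fourier_def ft_cmult mult.left_commute)
    show ?thesis
      unfolding eq[OF f] eq[OF schwartz_cmult[OF f]]
      unfolding inv by (simp add: mult.left_commute[of _ a])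
  qed
  moreover have "norm (?u f) \<le> (2 * pi * ?I * ?c * ?J) * schwartz_norm (2 * DIM(('d, 'n) xy)) f"
    if f: "schwartz f" for f
  proof -
    have "norm (LINT q|lborel. ft v\<^sub>0 q * inverse_fourier f (cone_point q)) \<le>
        (LINT q|lborel. norm (ft v\<^sub>0 q) * (?c * (LINT x|lborel. norm (f x))))"
    proof (rule norm_integral_le[OF int[OF f]])
      show "integrable lborel (\<lambda>q. norm (ft v\<^sub>0 q) * (?c * (LINT x|lborel. norm (f x))))"
        by (intro integrable_mult_left integrable_norm schwartz_integrable schwartz_ft v0)
    qed (unfold norm_mult, intro mult_left_mono norm_inverse_fourier_le, simp)
    also have "\<dots> = ?I * ?c * (LINT x|lborel. norm (f x))" by simp
    also have "\<dots> \<le> ?I * ?c * (?J * schwartz_norm (2 * DIM(('d, 'n) xy)) f)"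
      by (intro mult_left_mono schwartz_norm_integral_bound f) simp
    finally have "2 * pi * norm (LINT q|lborel. ft v\<^sub>0 q * inverse_fourier f (cone_point q)) \<le>
        2 * pi * (?I * ?c * (?J * schwartz_norm (2 * DIM(('d, 'n) xy)) f))"
      by (intro mult_left_mono) auto
    moreover have "norm (?u f) = 2 * pi * norm (LINT q|lborel. ft v\<^sub>0 q * inverse_fourier f (cone_point q))"
      unfolding eq[OF f] by (simp add: norm_mult)
    ultimately show ?thesis by (simp only: mult.assoc)
  qed
  ultimately show ?thesis unfolding tempered_distribution_def by blast
qed

section \<open>The wave as a function\<close>

text \<open>The superposition of the plane waves with the frequencies \<open>(cone_frequency q, q)\<close>, weighted by the transform of the initial datum.\<close>

definition wave :: "(('d::finite, 'n::finite) sxy \<Rightarrow> complex) \<Rightarrow> ('d, 'n) tsxy \<Rightarrow> complex" where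
  "wave v\<^sub>0 p = 1 / (2 * pi) ^ (CARD('d) + CARD('n) + 1) *
    (LINT q|lborel. cis (p \<bullet> (cone_frequency q, q)) * ft v\<^sub>0 q)"

lemma measurable_wave [measurable]:
  fixes v\<^sub>0 :: "('d::finite, 'n::finite) sxy \<Rightarrow> complex"
  assumes [measurable]: "v\<^sub>0 \<in> borel_measurable borel"
  shows "wave v\<^sub>0 \<in> borel_measurable borel"
proof -
  have [measurable]: "(\<lambda>x. (snd x :: ('d, 'n) tsxy) \<bullet> (cone_frequency (fst x), fst x)) \<in> borel_measurable (borel \<Otimes>\<^sub>M borel)"
    by measurable
  show ?thesis unfolding wave_def[abs_def] by measurable
qed

lemma regular_distribution_of_wave:
  fixes v\<^sub>0 :: "('d::finite, 'n::finite) sxy \<Rightarrow> complex"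
  assumes v0: "schwartz v\<^sub>0"
    and u: "\<And>\<Phi>. schwartz \<Phi> \<Longrightarrow> fourier_dist u \<Phi> = cone_functional v\<^sub>0 \<Phi>"
  shows "regular_distribution_of (wave v\<^sub>0) (pullback u)"
  unfolding regular_distribution_of_def
proof (intro allI impI)
  fix \<phi> :: "('d, 'n) tsxy \<Rightarrow> complex"
  assume "test_function \<phi>"
  then have \<phi>: "schwartz \<phi>" by (rule schwartz_test_function)
  note [measurable] = schwartz_measurable[OF v0] schwartz_measurable[OF \<phi>]
  let ?c = "1 / (2 * complex_of_real pi) ^ (CARD('d) + CARD('n) + 1)"
  let ?k = "\<lambda>x :: ('d, 'n) sxy \<times> ('d, 'n) tsxy. cis (snd x \<bullet> (cone_frequency (fst x), fst x))"
  have k: "?k \<in> borel_measurable borel"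
    by measurable
  have "pullback u \<phi> = ?c * (LINT q|lborel. ft v\<^sub>0 q * (LINT p|lborel. ?k (q, p) * \<phi> p))"
    using pullback_eq_of_fourier_dist[OF v0 u \<phi>] by (simp add: ft_uminus del: uminus_Pair)
  also have "(LINT q|lborel. ft v\<^sub>0 q * (LINT p|lborel. ?k (q, p) * \<phi> p)) =
      (LINT p|lborel. \<phi> p * (LINT q|lborel. ?k (q, p) * ft v\<^sub>0 q))"
    by (rule Fubini_bounded_kernel[OF schwartz_integrable[OF schwartz_ft[OF v0]] schwartz_integrable[OF \<phi>] k]) simp
  also have "?c * \<dots> = (LINT p|lborel. wave v\<^sub>0 p * \<phi> p)"
    unfolding integral_mult_right_zero[symmetric] by (simp add: wave_def mult_ac)
  also have "\<dots> = (LINT p|lebesgue. wave v\<^sub>0 p * \<phi> p)"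
    by (rule integral_completion[symmetric]) measurable
  finally show "pullback u \<phi> = (LINT p|lebesgue. wave v\<^sub>0 p * \<phi> p)" .
qed

lemma wave_initial_value:
  fixes v\<^sub>0 :: "('d::finite, 'n::finite) sxy \<Rightarrow> complex"
  assumes "schwartz v\<^sub>0"
  shows "wave v\<^sub>0 (0, z) = v\<^sub>0 z"
  using ft_inversion[OF assms, of z] by (simp add: wave_def inner_prod_def add.assoc)

lemma schwartz_square_integrable:
  assumes f: "schwartz f"
  shows "integrable lborel (\<lambda>x. (norm (f x))\<^sup>2)"
proof -
  note [measurable] = schwartz_measurable[OF f]
  obtain B where B: "\<And>x. norm (f x) \<le> B" using schwartz_bound[OF f, of 0] by auto
  have "integrable lborel (\<lambda>x. cnj (f x) * f x)"
    by (rule integrable_bounded_mult[OF schwartz_integrable[OF f], of _ B]) (auto simp: B)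
  then have "integrable lborel (\<lambda>x. norm (cnj (f x) * f x))" by (rule integrable_norm)
  then show ?thesis by (simp add: norm_mult power2_eq_square)
qed

text \<open>
  The wave at time \<open>t\<close> has this form with \<open>c q = cis (t * cone_frequency q)\<close>, and the difference of
  two times with the difference of these phase factors.
\<close>

lemma L2_transform_of_multiplier:
  fixes v\<^sub>0 :: "('d::finite, 'n::finite) sxy \<Rightarrow> complex" and c :: "('d, 'n) sxy \<Rightarrow> complex"
  defines "K \<equiv> (2 * pi) ^ (CARD('d) + CARD('n) + 1)"
  assumes v0: "schwartz v\<^sub>0" and [measurable]: "c \<in> borel_measurable borel" and B: "\<And>q. norm (c q) \<le> B"
  defines "W \<equiv> \<lambda>z. complex_of_real (1 / K) * ft (\<lambda>q. c q * ft v\<^sub>0 q) (- z)"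
  shows "W \<in> L2" and "L2_norm W \<le> sqrt (1 / K * (LINT q|lborel. (norm (c q * ft v\<^sub>0 q))\<^sup>2))"
proof -
  let ?h = "\<lambda>q. c q * ft v\<^sub>0 q"
  have K: "0 < K" by (simp add: K_def)
  note [measurable] = schwartz_measurable[OF v0]
  have h: "integrable lborel ?h"
    by (rule integrable_bounded_mult[OF schwartz_integrable[OF schwartz_ft[OF v0]], of _ B]) (auto simp: B)
  have h2: "integrable lborel (\<lambda>q. (norm (?h q))\<^sup>2)"
  proof (rule Bochner_Integration.integrable_bound)
    show "integrable lborel (\<lambda>q. B\<^sup>2 * (norm (ft v\<^sub>0 q))\<^sup>2)"
      by (intro integrable_mult_right schwartz_square_integrable schwartz_ft v0)
    show "AE q in lborel. norm ((norm (?h q))\<^sup>2) \<le> norm (B\<^sup>2 * (norm (ft v\<^sub>0 q))\<^sup>2)"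
      using B by (auto simp: norm_mult power_mult_distrib intro!: mult_right_mono power_mono)
  qed measurable
  have [measurable]: "W \<in> borel_measurable borel" unfolding W_def by measurable
  have W: "(norm (W z))\<^sup>2 = 1 / K\<^sup>2 * (norm (ft ?h (- z)))\<^sup>2" for z
    using K by (simp add: W_def norm_mult norm_divide power_mult_distrib power_divide)
  have int: "integrable lborel (\<lambda>z. (norm (W z))\<^sup>2)"
    unfolding W
    using integrable_lborel_scaleR[of "\<lambda>z. (norm (ft ?h z))\<^sup>2" "-1"] ft_square_integrable[OF h h2]
    by simp
  then show "W \<in> L2"
    by (simp add: L2_def integrable_completion measurable_completion)
  have "(LINT z|lebesgue. (norm (W z))\<^sup>2) = (LINT z|lborel. (norm (W z))\<^sup>2)"
    by (rule integral_completion) simp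
  also have "\<dots> = 1 / K\<^sup>2 * (LINT z|lborel. (norm (ft ?h z))\<^sup>2)"
    unfolding W using integral_lborel_uminus[of "\<lambda>z. (norm (ft ?h z))\<^sup>2"] by simp
  also have "\<dots> \<le> 1 / K\<^sup>2 * (K * (LINT q|lborel. (norm (?h q))\<^sup>2))"
    using ft_L2_bound[OF h h2] by (intro mult_left_mono) (auto simp: K_def)
  also have "\<dots> = 1 / K * (LINT q|lborel. (norm (?h q))\<^sup>2)"
    using K by (simp add: power2_eq_square)
  finally show "L2_norm W \<le> sqrt (1 / K * (LINT q|lborel. (norm (?h q))\<^sup>2))"
    unfolding L2_norm_def by (rule real_sqrt_le_mono)
qed

lemma wave_C_L2:
  fixes v\<^sub>0 :: "('d::finite, 'n::finite) sxy \<Rightarrow> complex"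
  assumes v0: "schwartz v\<^sub>0"
  shows "wave v\<^sub>0 \<in> C_L2"
proof -
  define K where "K = (2 * pi) ^ (CARD('d) + CARD('n) + 1)"
  define m where "m = (cone_frequency :: ('d, 'n) sxy \<Rightarrow> real)"
  have [measurable]: "m \<in> borel_measurable borel" by (simp add: m_def)
  note [measurable] = schwartz_measurable[OF v0]
  have int: "integrable lborel (\<lambda>q. cis (z \<bullet> q) * (cis (t * m q) * ft v\<^sub>0 q))" for t z
    by (intro integrable_bounded_mult[where B = 1] schwartz_integrable schwartz_ft v0) auto
  have wave: "wave v\<^sub>0 (t, z) = complex_of_real (1 / K) * ft (\<lambda>q. cis (t * m q) * ft v\<^sub>0 q) (- z)" for t z
    unfolding wave_def ft_uminus K_def m_def inner_Pair inner_commute[of z] cis_mult[symmetric]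
    by (simp add: mult_ac)
  have diff: "wave v\<^sub>0 (t', z) - wave v\<^sub>0 (t, z) =
      complex_of_real (1 / K) * ft (\<lambda>q. (cis (t' * m q) - cis (t * m q)) * ft v\<^sub>0 q) (- z)" for t' t z
    unfolding wave right_diff_distrib[symmetric] ft_def[of _ "- z"]
    using int[of z t'] int[of z t]
    by (simp add: inner_commute left_diff_distrib right_diff_distrib Bochner_Integration.integral_diff)
  have "(\<lambda>z. wave v\<^sub>0 (t, z)) \<in> L2" for t
    unfolding wave K_def
    using L2_transform_of_multiplier(1)[OF v0, of "\<lambda>q. cis (t * m q)" 1] by simp
  moreover have "((\<lambda>t'. L2_norm (\<lambda>z. wave v\<^sub>0 (t', z) - wave v\<^sub>0 (t, z))) \<longlongrightarrow> 0) (at t)" for t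
    unfolding tendsto_at_iff_sequentially
  proof (intro allI impI)
    fix X assume X: "X \<longlonglongrightarrow> t"
    let ?c = "\<lambda>n q. cis (X n * m q) - cis (t * m q)"
    have c2: "norm (?c n q) \<le> 2" for n q
      using norm_triangle_ineq4[of "cis (X n * m q)" "cis (t * m q)"] by simp
    have "(\<lambda>n. LINT q|lborel. (norm (?c n q * ft v\<^sub>0 q))\<^sup>2) \<longlonglongrightarrow> (LINT q::('d, 'n) sxy|lborel. 0)"
    proof (rule integral_dominated_convergence[where w = "\<lambda>q. 2\<^sup>2 * (norm (ft v\<^sub>0 q))\<^sup>2"])
      show "integrable lborel (\<lambda>q. 2\<^sup>2 * (norm (ft v\<^sub>0 q))\<^sup>2)"
        by (intro integrable_mult_right schwartz_square_integrable schwartz_ft v0)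
      show "AE q in lborel. norm ((norm (?c n q * ft v\<^sub>0 q))\<^sup>2) \<le> 2\<^sup>2 * (norm (ft v\<^sub>0 q))\<^sup>2" for n
      proof (intro always_eventually allI)
        fix q
        have "(norm (?c n q))\<^sup>2 * (norm (ft v\<^sub>0 q))\<^sup>2 \<le> 2\<^sup>2 * (norm (ft v\<^sub>0 q))\<^sup>2"
          by (rule mult_right_mono[OF power_mono[OF c2 norm_ge_zero] zero_le_power2])
        then show "norm ((norm (?c n q * ft v\<^sub>0 q))\<^sup>2) \<le> 2\<^sup>2 * (norm (ft v\<^sub>0 q))\<^sup>2"
          by (simp add: norm_mult power_mult_distrib)
      qed
      \<comment> \<open>The phases converge pointwise, although not uniformly: \<open>m\<close> is unbounded.\<close>
      show "AE q in lborel. (\<lambda>n. (norm (?c n q * ft v\<^sub>0 q))\<^sup>2) \<longlonglongrightarrow> 0"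
      proof (intro always_eventually allI)
        fix q
        have "(\<lambda>n. (norm ((cis (X n * m q) - cis (t * m q)) * ft v\<^sub>0 q))\<^sup>2) \<longlonglongrightarrow>
            (norm ((cis (t * m q) - cis (t * m q)) * ft v\<^sub>0 q))\<^sup>2"
          by (intro tendsto_intros X)
        then show "(\<lambda>n. (norm (?c n q * ft v\<^sub>0 q))\<^sup>2) \<longlonglongrightarrow> 0" by simp
      qed
    qed measurable
    then have "(\<lambda>n. sqrt (1 / K * (LINT q|lborel. (norm (?c n q * ft v\<^sub>0 q))\<^sup>2))) \<longlonglongrightarrow> sqrt (1 / K * 0)"
      by (intro tendsto_intros) simp
    then have lim: "(\<lambda>n. sqrt (1 / K * (LINT q|lborel. (norm (?c n q * ft v\<^sub>0 q))\<^sup>2))) \<longlonglongrightarrow> 0" by simp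
    have le: "L2_norm (\<lambda>z. wave v\<^sub>0 (X n, z) - wave v\<^sub>0 (t, z)) \<le>
        sqrt (1 / K * (LINT q|lborel. (norm (?c n q * ft v\<^sub>0 q))\<^sup>2))" for n
      unfolding diff K_def
      using L2_transform_of_multiplier(2)[OF v0, of "?c n" 2] c2 by simp
    show "((\<lambda>t'. L2_norm (\<lambda>z. wave v\<^sub>0 (t', z) - wave v\<^sub>0 (t, z))) \<circ> X) \<longlonglongrightarrow> 0"
      unfolding comp_def
    proof (rule tendsto_sandwich[OF _ _ tendsto_const lim])
      show "\<forall>\<^sub>F n in sequentially. 0 \<le> L2_norm (\<lambda>z. wave v\<^sub>0 (X n, z) - wave v\<^sub>0 (t, z))"
        by (simp add: L2_norm_def)
    qed (intro always_eventually allI le)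
  qed
  ultimately show ?thesis
    by (simp add: C_L2_def measurable_completion)
qed

section \<open>The equation\<close>

lemma AE_first_coordinate_nonzero: "AE q :: real \<times> 'a::euclidean_space in lborel. fst q \<noteq> 0"
proof -
  have "{q. ((1, 0) :: real \<times> 'a) \<bullet> q = 0} \<in> null_sets lebesgue"
    using negligible_hyperplane[of "(1, 0) :: real \<times> 'a" 0]
    by (simp add: negligible_iff_null_sets zero_prod_def)
  then have "{q. ((1, 0) :: real \<times> 'a) \<bullet> q = 0} \<in> null_sets lborel"
    by (subst (asm) null_sets_completion_iff) (auto intro!: borel_closed closed_hyperplane)
  then show ?thesis by (rule AE_I') (auto simp: inner_prod_def)
qed

text \<open>
  A second derivative acts on the transform by the product of two frequencies, and the symbol of
  the equation vanishes at the frequencies \<open>(cone_frequency q, q)\<close>.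
\<close>

lemma pullback_solves_equation:
  fixes v\<^sub>0 :: "('d::finite, 'n::finite) sxy \<Rightarrow> complex" and \<phi> :: "('d, 'n) tsxy \<Rightarrow> complex"
  assumes v0: "schwartz v\<^sub>0"
    and u: "\<And>\<Phi>. schwartz \<Phi> \<Longrightarrow> fourier_dist u \<Phi> = cone_functional v\<^sub>0 \<Phi>"
    and \<phi>: "schwartz \<phi>"
  defines "v \<equiv> pullback u"
  shows "dist_deriv (1, 0, 0, 0) (dist_deriv (0, 1, 0, 0) v) \<phi> +
    (\<Sum>i\<in>UNIV. dist_deriv (0, 0, axis i 1, 0) (dist_deriv (0, 0, axis i 1, 0) v) \<phi>) -
    (\<Sum>j\<in>UNIV. dist_deriv (0, 0, 0, axis j 1) (dist_deriv (0, 0, 0, axis j 1) v) \<phi>) = 0"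
proof -
  let ?c = "1 / (2 * complex_of_real pi) ^ (CARD('d) + CARD('n) + 1)"
  define \<kappa> where "\<kappa> q = (cone_frequency q, q)" for q :: "('d, 'n) sxy"
  define E where "E q = ft v\<^sub>0 q * ft \<phi> (- \<kappa> q)" for q
  have [measurable]: "\<kappa> \<in> borel_measurable borel"
    unfolding \<kappa>_def[abs_def] by measurable
  note [measurable] = schwartz_measurable[OF v0] schwartz_measurable[OF \<phi>]
  define D where "D a b q = complex_of_real ((\<kappa> q \<bullet> a) * (\<kappa> q \<bullet> b)) * E q" for a b q
  have second: "integrable lborel (D a b)"
      "dist_deriv a (dist_deriv b v) \<phi> = - ?c * (LINT q|lborel. D a b q)"
    if a: "a \<in> Basis" and b: "b \<in> Basis" for a b
  proof -
    have s: "schwartz (pd b (pd a \<phi>))" using a b \<phi> by (intro schwartz_pd)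
    note [measurable] = schwartz_measurable[OF s]
    have eq: "ft v\<^sub>0 q * ft (pd b (pd a \<phi>)) (- \<kappa> q) = - D a b q" for q
      by (simp add: ft_pd a b \<phi> schwartz_pd D_def E_def mult_ac)
    have "integrable lborel (\<lambda>q. ft v\<^sub>0 q * ft (pd b (pd a \<phi>)) (- \<kappa> q))"
      by (rule integrable_ft_mult_bounded[OF v0 _ norm_ft_le]) measurable
    then show "integrable lborel (D a b)" unfolding eq by simp
    have "dist_deriv a (dist_deriv b v) \<phi> = pullback u (pd b (pd a \<phi>))"
      by (simp add: dist_deriv_def v_def)
    also have "\<dots> = ?c * (LINT q|lborel. ft v\<^sub>0 q * ft (pd b (pd a \<phi>)) (- \<kappa> q))"
      unfolding \<kappa>_def using pullback_eq_of_fourier_dist[OF v0 u s] by simp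
    also have "\<dots> = - ?c * (LINT q|lborel. D a b q)" unfolding eq by simp
    finally show "dist_deriv a (dist_deriv b v) \<phi> = - ?c * (LINT q|lborel. D a b q)" .
  qed
  have basis: "(1, 0, 0, 0) \<in> (Basis :: ('d, 'n) tsxy set)" "(0, 1, 0, 0) \<in> (Basis :: ('d, 'n) tsxy set)"
    "(0, 0, axis i 1, 0) \<in> (Basis :: ('d, 'n) tsxy set)" "(0, 0, 0, axis j 1) \<in> (Basis :: ('d, 'n) tsxy set)" for i j
    by (auto simp: Basis_prod_def zero_prod_def image_iff axis_in_Basis_iff)
  let ?t = "(1, 0, 0, 0) :: ('d, 'n) tsxy" and ?s = "(0, 1, 0, 0) :: ('d, 'n) tsxy"
  let ?x = "\<lambda>i. (0, 0, axis i 1, 0) :: ('d, 'n) tsxy" and ?y = "\<lambda>j. (0, 0, 0, axis j 1) :: ('d, 'n) tsxy"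
  let ?P = "\<lambda>q. D ?t ?s q + (\<Sum>i\<in>UNIV. D (?x i) (?x i) q) - (\<Sum>j\<in>UNIV. D (?y j) (?y j) q)"
  have "(LINT q|lborel. ?P q) = 0"
  proof (rule integral_eq_zero_AE)
    show "AE q in lborel. ?P q = 0"
      using AE_first_coordinate_nonzero
    proof eventually_elim
      case (elim q)
      obtain l x y where q: "q = (l, x, y)" by (cases q)
      have "?P q = complex_of_real (cone_frequency q * l + (\<Sum>i\<in>UNIV. x $ i * x $ i) - (\<Sum>j\<in>UNIV. y $ j * y $ j)) * E q"
        by (simp add: D_def \<kappa>_def q inner_prod_def inner_axis sum_distrib_right distrib_right left_diff_distrib)
      also have "cone_frequency q * l + (\<Sum>i\<in>UNIV. x $ i * x $ i) - (\<Sum>j\<in>UNIV. y $ j * y $ j) = 0"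
        using elim by (simp add: q cone_frequency_def power2_norm_eq_inner inner_vec_def)
      finally show ?case by simp
    qed
  qed
  moreover have "(LINT q|lborel. ?P q) = (LINT q|lborel. D ?t ?s q) +
      (\<Sum>i\<in>UNIV. LINT q|lborel. D (?x i) (?x i) q) - (\<Sum>j\<in>UNIV. LINT q|lborel. D (?y j) (?y j) q)"
    using second(1) basis by (simp add: integral_sum Bochner_Integration.integrable_sum)
  ultimately have "- ?c * ((LINT q|lborel. D ?t ?s q) + (\<Sum>i\<in>UNIV. LINT q|lborel. D (?x i) (?x i) q) -
      (\<Sum>j\<in>UNIV. LINT q|lborel. D (?y j) (?y j) q)) = 0"
    by simp
  then show ?thesis
    by (simp only: second(2) basis right_diff_distrib distrib_left sum_distrib_left)
qed

theorem theorem2: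
  fixes v\<^sub>0 :: "real \<times> (real ^ 'd::finite) \<times> (real ^ 'n::finite) \<Rightarrow> complex"
  assumes "schwartz v\<^sub>0"
  shows
    "(\<exists>u. tempered_distribution u \<and>
        (\<forall>\<Phi>. schwartz \<Phi> \<longrightarrow> fourier_dist u \<Phi> = cone_functional v\<^sub>0 \<Phi>)) \<and>
     (\<forall>u v. tempered_distribution u \<longrightarrow>
        (\<forall>\<Phi>. schwartz \<Phi> \<longrightarrow> fourier_dist u \<Phi> = cone_functional v\<^sub>0 \<Phi>) \<longrightarrow>
        v = pullback u \<longrightarrow>
        (\<exists>w \<in> C_L2. regular_distribution_of w v \<and> (AE z in lebesgue. w (0, z) = v\<^sub>0 z)) \<and>
        (\<forall>\<phi>. test_function \<phi> \<longrightarrow>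
           dist_deriv (1, 0, 0, 0) (dist_deriv (0, 1, 0, 0) v) \<phi> +
           (\<Sum>i\<in>UNIV. dist_deriv (0, 0, axis i 1, 0) (dist_deriv (0, 0, axis i 1, 0) v) \<phi>) -
           (\<Sum>j\<in>UNIV. dist_deriv (0, 0, 0, axis j 1) (dist_deriv (0, 0, 0, axis j 1) v) \<phi>) = 0))"
proof (intro conjI allI impI)
  show "\<exists>u. tempered_distribution u \<and> (\<forall>\<Phi>. schwartz \<Phi> \<longrightarrow> fourier_dist u \<Phi> = cone_functional v\<^sub>0 \<Phi>)"
    using tempered_distribution_cone_functional[OF assms]
    by (intro exI[of _ "\<lambda>f. cone_functional v\<^sub>0 (inverse_fourier f)"])
       (simp add: fourier_dist_def inverse_fourier_fourier)
next
  fix u v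
  assume u: "\<forall>\<Phi>. schwartz \<Phi> \<longrightarrow> fourier_dist u \<Phi> = cone_functional v\<^sub>0 \<Phi>" and v: "v = pullback u"
  show "\<exists>w\<in>C_L2. regular_distribution_of w v \<and> (AE z in lebesgue. w (0, z) = v\<^sub>0 z)"
    using wave_C_L2[OF assms] regular_distribution_of_wave[OF assms, of u] wave_initial_value[OF assms] u v
    by (intro bexI[of _ "wave v\<^sub>0"]) auto
  fix \<phi> :: "('d, 'n) tsxy \<Rightarrow> complex" assume "test_function \<phi>"
  then show "dist_deriv (1, 0, 0, 0) (dist_deriv (0, 1, 0, 0) v) \<phi> +
      (\<Sum>i\<in>UNIV. dist_deriv (0, 0, axis i 1, 0) (dist_deriv (0, 0, axis i 1, 0) v) \<phi>) -
      (\<Sum>j\<in>UNIV. dist_deriv (0, 0, 0, axis j 1) (dist_deriv (0, 0, 0, axis j 1) v) \<phi>) = 0"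
    unfolding v using u by (intro pullback_solves_equation[OF assms]) (auto intro: schwartz_test_function)
qed

end
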